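(* Let $f\colon K\to L$ be a continuous map between projective simplicial complexes. The following conditions are equivalent: (1) $f$ is c-proper. (2) $f$ is proper. (3) $f$ is simplicial.
   Context: A finite space is a finite $T_0$ topological space, equivalently a finite poset with $p\le q$ iff $\overline{\{p\}}\subseteq\overline{\{q\}}$; open subsets are upper sets, closed subsets are lower sets; continuous maps are the order-preserving maps. $C_p=\{x\le p\}$ is the closure of $\{p\}$. Closed points are minimal elements. $\mathbb P^n_{\mathbb F_1}$ is the poset of non-empty subsets of a set with $n+1$ elements, ordered by inclusion. A projective simplicial complex is a closed subset (lower set) of some $\mathbb P^n_{\mathbb F_1}$ (i.e. a usual abstract simplicial complex, regarded as the poset of its non-empty simplices). A map of sets $\phi\colon\Delta\to\Delta'$, with $\#\Delta=n+1$, $\#\Delta'=m+1$, induces $\mathbb P(\phi)\colon\mathbb P^n_{\mathbb F_1}\to\mathbb P^m_{\mathbb F_1}$, $S\mapsto\phi(S)$. Given projective simplicial complexes $K\subseteq\mathbb P^n_{\mathbb F_1}$, $L\subseteq\mathbb P^m_{\mathbb F_1}$, where $n+1$ and $m+1$ are the numbers of vertices (closed points) of $K$ and $L$, a continuous map $f\colon K\to L$ is simplicial if it is the restriction of some $\mathbb P(\phi)\colon\mathbb P^n_{\mathbb F_1}\to\mathbb P^m_{\mathbb F_1}$. $\mathrm D(X)$ is the derived category of complexes of sheaves of abelian groups on $X$; $\mathbb Z_S$ is the constant sheaf on a locally closed $S$ extended by zero; a finite space $X$ is cohomologically trivial if the cone of $\mathbb Z\to\mathbb R\Gamma(X,\mathbb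 Z)$ is $0$. A continuous map $f\colon X\to Y$ is c-proper if for every $p\in X$ the map $f|_{C_p}\colon C_p\to C_{f(p)}$ has cohomologically trivial fibres. A point $x_0\in X$ is $f$-closed if it is a closed point of $f^{-1}(f(x_0))$. $f$ is proper if it is c-proper and, for every $f$-closed point $x_0$ and every $p\ge x_0$, the natural morphism $\mathbb R\mathrm{Hom}_X^\bullet(\mathbb Z_{\{x_0\}},\mathbb Z_{\{p\}})\to\mathbb R\mathrm{Hom}_Y^\bullet(\mathbb Z_{\{f(x_0)\}},\mathbb R f_*\mathbb Z_{\{p\}})$ is an isomorphism; this morphism is obtained by precomposition with the canonical surjection $f^{-1}\mathbb Z_{\{f(x_0)\}}=\mathbb Z_{f^{-1}(f(x_0))}\to\mathbb Z_{\{x_0\}}$ and adjunction. *)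

theory Defs
  imports "HOL-Analysis.Analysis" "HOL-Algebra.Elementary_Groups"
begin

section \<open>Finite spaces and projective simplicial complexes\<close>

text \<open>Open sets are the upper sets, so that the closure of \<open>{p}\<close> is
  \<open>{x. x \<le> p}\<close>.\<close>

definition upper_topology :: "'a::order set \<Rightarrow> 'a topology" where
  "upper_topology P = topology (\<lambda>U. U \<subseteq> P \<and> (\<forall>x\<in>U. \<forall>y\<in>P. x \<le> y \<longrightarrow> y \<in> U))"

lemma openin_upper_topology:
  "openin (upper_topology P) U \<longleftrightarrow> U \<subseteq> P \<and> (\<forall>x\<in>U. \<forall>y\<in>P. x \<le> y \<longrightarrow> y \<in> U)"
proof -
  have "istopology (\<lambda>U. U \<subseteq> P \<and> (\<forall>x\<in>U. \<forall>y\<in>P. x \<le> y \<longrightarrow> y \<in> U))"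
    unfolding istopology_def by blast
  then show ?thesis
    unfolding upper_topology_def by (simp add: topology_inverse')
qed

lemma topspace_upper_topology [simp]: "topspace (upper_topology P) = P"
  unfolding topspace_def openin_upper_topology by blast

lemma closedin_upper_topology:
  "closedin (upper_topology P) C \<longleftrightarrow> C \<subseteq> P \<and> (\<forall>y\<in>C. \<forall>x\<in>P. x \<le> y \<longrightarrow> x \<in> C)"
  unfolding closedin_def openin_upper_topology by auto

lemma closure_of_upper_topology:
  assumes "p \<in> P"
  shows "upper_topology P closure_of {p} = {x \<in> P. x \<le> p}"
proof (rule closure_of_unique)
  show "closedin (upper_topology P) {x \<in> P. x \<le> p}"
    unfolding closedin_upper_topology by auto
  show "{x \<in> P. x \<le> p} \<subseteq> T" if "{p} \<subseteq> T" "closedin (upper_topology P) T" for T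
    using that unfolding closedin_upper_topology by auto
qed (use assms in auto)

definition projective_space :: "'v set \<Rightarrow> 'v set set" where
  "projective_space \<Delta> = {S. S \<subseteq> \<Delta> \<and> S \<noteq> {}}"

definition projective_complex :: "'v set set \<Rightarrow> bool" where
  "projective_complex K \<longleftrightarrow>
     (\<exists>\<Delta>. finite \<Delta> \<and> \<Delta> \<noteq> {} \<and> closedin (upper_topology (projective_space \<Delta>)) K)"

text \<open>The closed points of \<open>K\<close> are the singletons it contains. Identifying a vertex with its
  singleton, \<open>K \<subseteq> projective_space (vertices K)\<close>.\<close>

definition vertices :: "'v set set \<Rightarrow> 'v set" where
  "vertices K = {v. {v} \<in> K}"

definition projective_map :: "('v \<Rightarrow> 'w) \<Rightarrow> 'v set \<Rightarrow> 'w set" where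
  "projective_map \<phi> = (\<lambda>S. \<phi> ` S)"

definition simplicial :: "'v set set \<Rightarrow> 'w set set \<Rightarrow> ('v set \<Rightarrow> 'w set) \<Rightarrow> bool" where
  "simplicial K L f \<longleftrightarrow>
     (\<exists>\<phi> \<in> vertices K \<rightarrow> vertices L. \<forall>S\<in>K. f S = projective_map \<phi> S)"


section \<open>Complexes of abelian groups\<close>

text \<open>Abelian groups are commutative groups in the sense of HOL-Algebra, hence written
  multiplicatively. Complexes are cohomological and indexed by the integers.\<close>

record 'b cochain =
  grp :: "int \<Rightarrow> 'b monoid"
  diff :: "int \<Rightarrow> 'b \<Rightarrow> 'b"

definition cocycles :: "'b cochain \<Rightarrow> int \<Rightarrow> 'b set" where
  "cocycles C n = kernel (grp C n) (grp C (n + 1)) (diff C n)"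

definition coboundaries :: "'b cochain \<Rightarrow> int \<Rightarrow> 'b set" where
  "coboundaries C n = diff C (n - 1) ` carrier (grp C (n - 1))"

definition cohomology :: "'b cochain \<Rightarrow> int \<Rightarrow> 'b set monoid" where
  "cohomology C n = ((grp C n)\<lparr>carrier := cocycles C n\<rparr>) Mod coboundaries C n"

text \<open>The class \<open>c\<close> of a cocycle goes to the class of the image of any of its representatives.\<close>

definition cohomology_map ::
    "'c cochain \<Rightarrow> (int \<Rightarrow> 'b \<Rightarrow> 'c) \<Rightarrow> int \<Rightarrow> 'b set \<Rightarrow> 'c set" where
  "cohomology_map D g n c = coboundaries D n <#>\<^bsub>grp D n\<^esub> (g n ` c)"

text \<open>A chain map becomes an isomorphism in the derived category of abelian groups iff it is a
  quasi-isomorphism, and a complex becomes \<open>0\<close> iff it is acyclic.\<close>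

definition quasi_iso :: "'b cochain \<Rightarrow> 'c cochain \<Rightarrow> (int \<Rightarrow> 'b \<Rightarrow> 'c) \<Rightarrow> bool" where
  "quasi_iso C D g \<longleftrightarrow> (\<forall>n. cohomology_map D g n \<in> iso (cohomology C n) (cohomology D n))"

definition acyclic_cochain :: "'b cochain \<Rightarrow> bool" where
  "acyclic_cochain C \<longleftrightarrow> (\<forall>n. cocycles C n = coboundaries C n)"

definition cone :: "'b cochain \<Rightarrow> 'c cochain \<Rightarrow> (int \<Rightarrow> 'b \<Rightarrow> 'c) \<Rightarrow> ('b \<times> 'c) cochain" where
  "cone C D g =
     \<lparr>grp = (\<lambda>n. grp C (n + 1) \<times>\<times> grp D n),
      diff = (\<lambda>n (a, b). (inv\<^bsub>grp C (n + 1 + 1)\<^esub> (diff C (n + 1) a),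
                          g (n + 1) a \<otimes>\<^bsub>grp D (n + 1)\<^esub> diff D n b))\<rparr>"

definition integers_in_degree_0 :: "int cochain" where
  "integers_in_degree_0 =
     \<lparr>grp = (\<lambda>n. if n = 0 then integer_group else singleton_group 0),
      diff = (\<lambda>n k. 0)\<rparr>"


section \<open>Sheaves of abelian groups\<close>

text \<open>\<open>restr F U V\<close> is the restriction map from the sections over \<open>U\<close> to those over \<open>V\<close>.\<close>

record ('a, 'b) presheaf =
  sections :: "'a set \<Rightarrow> 'b monoid"
  restr :: "'a set \<Rightarrow> 'a set \<Rightarrow> 'b \<Rightarrow> 'b"

definition sheaf :: "'a topology \<Rightarrow> ('a, 'b) presheaf \<Rightarrow> bool" where
  "sheaf X F \<longleftrightarrow>
     (\<forall>U. openin X U \<longrightarrow> comm_group (sections F U)) \<and>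
     (\<forall>U V. openin X U \<and> openin X V \<and> V \<subseteq> U \<longrightarrow>
        restr F U V \<in> hom (sections F U) (sections F V)) \<and>
     (\<forall>U. openin X U \<longrightarrow> (\<forall>s\<in>carrier (sections F U). restr F U U s = s)) \<and>
     (\<forall>U V W. openin X U \<and> openin X V \<and> openin X W \<and> W \<subseteq> V \<and> V \<subseteq> U \<longrightarrow>
        (\<forall>s\<in>carrier (sections F U). restr F V W (restr F U V s) = restr F U W s)) \<and>
     (\<forall>\<U> s. (\<forall>U\<in>\<U>. openin X U \<and> s U \<in> carrier (sections F U)) \<and>
        (\<forall>U\<in>\<U>. \<forall>V\<in>\<U>. restr F U (U \<inter> V) (s U) = restr F V (U \<inter> V) (s V)) \<longrightarrow>
        (\<exists>!t. t \<in> carrier (sections F (\<Union>\<U>)) \<and> (\<forall>U\<in>\<U>. restr F (\<Union>\<U>) U t = s U)))"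

definition sheaf_morphism ::
    "'a topology \<Rightarrow> ('a, 'b) presheaf \<Rightarrow> ('a, 'c) presheaf \<Rightarrow> ('a set \<Rightarrow> 'b \<Rightarrow> 'c) \<Rightarrow> bool" where
  "sheaf_morphism X A B \<phi> \<longleftrightarrow>
     (\<forall>U. openin X U \<longrightarrow> \<phi> U \<in> hom (sections A U) (sections B U)) \<and>
     (\<forall>U V. openin X U \<and> openin X V \<and> V \<subseteq> U \<longrightarrow>
        (\<forall>s\<in>carrier (sections A U). \<phi> V (restr A U V s) = restr B U V (\<phi> U s)))"

definition sheaf_mono ::
    "'a topology \<Rightarrow> ('a, 'b) presheaf \<Rightarrow> ('a, 'c) presheaf \<Rightarrow> ('a set \<Rightarrow> 'b \<Rightarrow> 'c) \<Rightarrow> bool" where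
  "sheaf_mono X A B \<phi> \<longleftrightarrow> sheaf_morphism X A B \<phi> \<and>
     (\<forall>U. openin X U \<longrightarrow> inj_on (\<phi> U) (carrier (sections A U)))"

text \<open>Exactness at \<open>B\<close> of a sequence of sheaves \<open>A \<rightarrow> B \<rightarrow> C\<close>: sections in the kernel are locally
  in the image.\<close>

definition sheaf_exact ::
    "'a topology \<Rightarrow> ('a, 'b) presheaf \<Rightarrow> ('a set \<Rightarrow> 'b \<Rightarrow> 'c) \<Rightarrow> ('a, 'c) presheaf \<Rightarrow>
     ('a set \<Rightarrow> 'c \<Rightarrow> 'd) \<Rightarrow> ('a, 'd) presheaf \<Rightarrow> bool" where
  "sheaf_exact X A \<phi> B \<psi> C \<longleftrightarrow>
     (\<forall>U. openin X U \<longrightarrow> (\<forall>s\<in>carrier (sections A U). \<psi> U (\<phi> U s) = \<one>\<^bsub>sections C U\<^esub>)) \<and>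
     (\<forall>U. openin X U \<longrightarrow> (\<forall>s\<in>carrier (sections B U). \<psi> U s = \<one>\<^bsub>sections C U\<^esub> \<longrightarrow>
        (\<forall>x\<in>U. \<exists>V. openin X V \<and> x \<in> V \<and> V \<subseteq> U \<and>
           (\<exists>t\<in>carrier (sections A V). \<phi> V t = restr B U V s))))"

text \<open>The group \<open>Hom X A B\<close>; its elements are normalised to be \<open>undefined\<close> off the sections of \<open>A\<close>
  over open sets, so that equal morphisms are equal functions.\<close>

definition normalise ::
    "'a topology \<Rightarrow> ('a, 'b) presheaf \<Rightarrow> ('a set \<Rightarrow> 'b \<Rightarrow> 'c) \<Rightarrow> 'a set \<Rightarrow> 'b \<Rightarrow> 'c" where
  "normalise X A \<phi> =
     (\<lambda>U s. if openin X U \<and> s \<in> carrier (sections A U) then \<phi> U s else undefined)"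

definition hom_group ::
    "'a topology \<Rightarrow> ('a, 'b) presheaf \<Rightarrow> ('a, 'c) presheaf \<Rightarrow> ('a set \<Rightarrow> 'b \<Rightarrow> 'c) monoid" where
  "hom_group X A B =
     \<lparr>carrier = {\<phi>. sheaf_morphism X A B \<phi> \<and> normalise X A \<phi> = \<phi>},
      monoid.mult = (\<lambda>\<phi> \<psi>. normalise X A (\<lambda>U s. \<phi> U s \<otimes>\<^bsub>sections B U\<^esub> \<psi> U s)),
      one = normalise X A (\<lambda>U s. \<one>\<^bsub>sections B U\<^esub>)\<rparr>"

definition direct_image ::
    "'a topology \<Rightarrow> ('a \<Rightarrow> 'c) \<Rightarrow> ('a, 'b) presheaf \<Rightarrow> ('c, 'b) presheaf" where
  "direct_image X f F =
     \<lparr>sections = (\<lambda>V. sections F {x \<in> topspace X. f x \<in> V}),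
      restr = (\<lambda>V W. restr F {x \<in> topspace X. f x \<in> V} {x \<in> topspace X. f x \<in> W})\<rparr>"

text \<open>The constant sheaf of integers on a locally closed subset \<open>S\<close>, extended by zero to \<open>X\<close>: its
  sections over \<open>U\<close> are the locally constant functions on \<open>U \<inter> S\<close> whose support is closed in \<open>U\<close>.
  Such a function is represented by its extension by \<open>0\<close> to the whole type.\<close>

definition const_sheaf :: "'a topology \<Rightarrow> 'a set \<Rightarrow> ('a, 'a \<Rightarrow> int) presheaf" where
  "const_sheaf X S =
     \<lparr>sections = (\<lambda>U.
        \<lparr>carrier = {s. (\<forall>x. x \<notin> U \<inter> S \<longrightarrow> s x = 0) \<and>
            continuous_map (subtopology X (U \<inter> S)) (discrete_topology UNIV) s \<and>
            closedin (subtopology X U) {x. s x \<noteq> 0}},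
         monoid.mult = (\<lambda>s t x. s x + t x),
         one = (\<lambda>x. 0)\<rparr>),
      restr = (\<lambda>U V s x. if x \<in> V then s x else 0)\<rparr>"


section \<open>Injective resolutions and derived functors\<close>

text \<open>Injectivity is tested on sheaves whose sections lie in the type of sections of \<open>I\<close>.
  Below, this type is \<open>'a \<Rightarrow> int\<close>, where \<open>'a\<close> is the type of points. It is infinite and closed, up to
  cardinality, under products indexed by \<open>'a\<close>, so on any topology on \<open>'a\<close> every sheaf with sections
  in this type embeds into a product of skyscrapers with divisible stalks in this type. Hence
  there are enough injectives of this type, and they are injective without size restriction.\<close>

definition injective_sheaf :: "'a topology \<Rightarrow> ('a, 'b) presheaf \<Rightarrow> bool" where
  "injective_sheaf X I \<longleftrightarrow> sheaf X I \<and>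
     (\<forall>(A :: ('a, 'b) presheaf) (B :: ('a, 'b) presheaf) \<iota> \<alpha>.
        sheaf X A \<and> sheaf X B \<and> sheaf_mono X A B \<iota> \<and> sheaf_morphism X A I \<alpha> \<longrightarrow>
        (\<exists>\<beta>. sheaf_morphism X B I \<beta> \<and>
           (\<forall>U. openin X U \<longrightarrow> (\<forall>s\<in>carrier (sections A U). \<beta> U (\<iota> U s) = \<alpha> U s))))"

record ('a, 'b) sheaf_complex =
  obj :: "int \<Rightarrow> ('a, 'b) presheaf"
  sdiff :: "int \<Rightarrow> 'a set \<Rightarrow> 'b \<Rightarrow> 'b"

definition injective_resolution ::
    "'a topology \<Rightarrow> ('a, 'a \<Rightarrow> int) presheaf \<Rightarrow> ('a, 'a \<Rightarrow> int) sheaf_complex \<Rightarrow>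
     ('a set \<Rightarrow> ('a \<Rightarrow> int) \<Rightarrow> ('a \<Rightarrow> int)) \<Rightarrow> bool" where
  "injective_resolution X F I \<epsilon> \<longleftrightarrow>
     (\<forall>n. injective_sheaf X (obj I n)) \<and>
     (\<forall>n. sheaf_morphism X (obj I n) (obj I (n + 1)) (sdiff I n)) \<and>
     (\<forall>n<0. \<forall>U. openin X U \<longrightarrow>
        carrier (sections (obj I n) U) = {\<one>\<^bsub>sections (obj I n) U\<^esub>}) \<and>
     sheaf_mono X F (obj I 0) \<epsilon> \<and>
     sheaf_exact X F \<epsilon> (obj I 0) (sdiff I 0) (obj I 1) \<and>
     (\<forall>n\<ge>0. sheaf_exact X (obj I n) (sdiff I n) (obj I (n + 1)) (sdiff I (n + 1)) (obj I (n + 1 + 1)))"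

definition global_sections :: "'a topology \<Rightarrow> ('a, 'b) sheaf_complex \<Rightarrow> 'b cochain" where
  "global_sections X I =
     \<lparr>grp = (\<lambda>n. sections (obj I n) (topspace X)),
      diff = (\<lambda>n. sdiff I n (topspace X))\<rparr>"

definition hom_complex ::
    "'a topology \<Rightarrow> ('a, 'b) presheaf \<Rightarrow> ('a, 'c) sheaf_complex \<Rightarrow> ('a set \<Rightarrow> 'b \<Rightarrow> 'c) cochain" where
  "hom_complex X A I =
     \<lparr>grp = (\<lambda>n. hom_group X A (obj I n)),
      diff = (\<lambda>n \<phi>. normalise X A (\<lambda>U s. sdiff I n U (\<phi> U s)))\<rparr>"

definition direct_image_complex ::
    "'a topology \<Rightarrow> ('a \<Rightarrow> 'c) \<Rightarrow> ('a, 'b) sheaf_complex \<Rightarrow> ('c, 'b) sheaf_complex" where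
  "direct_image_complex X f I =
     \<lparr>obj = (\<lambda>n. direct_image X f (obj I n)),
      sdiff = (\<lambda>n V. sdiff I n {x \<in> topspace X. f x \<in> V})\<rparr>"


section \<open>Cohomologically trivial spaces, c-proper and proper maps\<close>

text \<open>Derived functors of a sheaf \<open>F\<close> are computed by an injective resolution \<open>I\<close> of \<open>F\<close>. The
  conditions below do not depend on \<open>I\<close>, and are stated for all \<open>I\<close>.

  The next definition is the morphism from the integers to \<open>\<R>\<Gamma>(X, \<int>)\<close>, represented by the chain
  map to \<open>global_sections X I\<close> that sends \<open>k\<close> to the image of the constant section \<open>k\<close>.\<close>

definition constants_map ::
    "'a topology \<Rightarrow> ('a, 'a \<Rightarrow> int) sheaf_complex \<Rightarrow> ('a set \<Rightarrow> ('a \<Rightarrow> int) \<Rightarrow> ('a \<Rightarrow> int)) \<Rightarrow>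
     int \<Rightarrow> int \<Rightarrow> ('a \<Rightarrow> int)" where
  "constants_map X I \<epsilon> n k =
     (if n = 0 then \<epsilon> (topspace X) (\<lambda>x. if x \<in> topspace X then k else 0)
      else \<one>\<^bsub>sections (obj I n) (topspace X)\<^esub>)"

definition cohomologically_trivial :: "'a topology \<Rightarrow> bool" where
  "cohomologically_trivial X \<longleftrightarrow>
     (\<forall>I \<epsilon>. injective_resolution X (const_sheaf X (topspace X)) I \<epsilon> \<longrightarrow>
        acyclic_cochain
          (cone integers_in_degree_0 (global_sections X I) (constants_map X I \<epsilon>)))"

definition c_proper :: "'a topology \<Rightarrow> 'b topology \<Rightarrow> ('a \<Rightarrow> 'b) \<Rightarrow> bool" where
  "c_proper X Y f \<longleftrightarrow> continuous_map X Y f \<and>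
     (\<forall>p\<in>topspace X. \<forall>y\<in>Y closure_of {f p}.
        cohomologically_trivial (subtopology X {x \<in> X closure_of {p}. f x = y}))"

definition fibre_closed :: "'a topology \<Rightarrow> ('a \<Rightarrow> 'b) \<Rightarrow> 'a \<Rightarrow> bool" where
  "fibre_closed X f x0 \<longleftrightarrow> x0 \<in> topspace X \<and>
     closedin (subtopology X {x \<in> topspace X. f x = f x0}) {x0}"

text \<open>With \<open>y = f x0\<close> and \<open>F\<close> the fibre of \<open>y\<close>, the morphism from \<open>\<R>Hom\<^sub>X(\<int>\<^bsub>{x0}\<^esub>, G)\<close> to
  \<open>\<R>Hom\<^sub>Y(\<int>\<^bsub>{y}\<^esub>, \<R>f\<^sub>* G)\<close> is built from the unit \<open>\<int>\<^bsub>{y}\<^esub> \<rightarrow> f\<^sub>* f\<inverse> \<int>\<^bsub>{y}\<^esub> = f\<^sub>* \<int>\<^bsub>F\<^esub>\<close>, which is pullback of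
  functions, and the surjection \<open>\<int>\<^bsub>F\<^esub> \<rightarrow> \<int>\<^bsub>{x0}\<^esub>\<close>, which is restriction of functions to \<open>{x0}\<close>. If \<open>I\<close> is
  an injective resolution of \<open>G\<close>, then \<open>\<R>f\<^sub>* G\<close> is represented by \<open>direct_image_complex X f I\<close>. Its
  terms are injective, since direct image has an exact left adjoint, so \<open>\<R>Hom\<^sub>Y\<close> into it is
  the complex of homomorphisms into it. The adjoint of \<open>\<beta> : \<int>\<^bsub>F\<^esub> \<rightarrow> I n\<close> is the composite of the unit
  with the direct image of \<open>\<beta>\<close>.\<close>

definition pullback_unit :: "'a topology \<Rightarrow> ('a \<Rightarrow> 'c) \<Rightarrow> 'c set \<Rightarrow> ('c \<Rightarrow> int) \<Rightarrow> ('a \<Rightarrow> int)" where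
  "pullback_unit X f V s = (\<lambda>x. if x \<in> topspace X then s (f x) else 0)"

definition restrict_to_point :: "'a \<Rightarrow> 'a set \<Rightarrow> ('a \<Rightarrow> int) \<Rightarrow> ('a \<Rightarrow> int)" where
  "restrict_to_point x0 U s = (\<lambda>x. if x = x0 then s x else 0)"

definition adjoint_morphism ::
    "'a topology \<Rightarrow> 'c topology \<Rightarrow> ('a \<Rightarrow> 'c) \<Rightarrow> 'c set \<Rightarrow>
     ('a set \<Rightarrow> ('a \<Rightarrow> int) \<Rightarrow> 'b) \<Rightarrow> 'c set \<Rightarrow> ('c \<Rightarrow> int) \<Rightarrow> 'b" where
  "adjoint_morphism X Y f S \<beta> =
     normalise Y (const_sheaf Y S)
       (\<lambda>V s. \<beta> {x \<in> topspace X. f x \<in> V} (pullback_unit X f V s))"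

definition natural_map ::
    "'a topology \<Rightarrow> 'c topology \<Rightarrow> ('a \<Rightarrow> 'c) \<Rightarrow> 'a \<Rightarrow> int \<Rightarrow>
     ('a set \<Rightarrow> ('a \<Rightarrow> int) \<Rightarrow> 'b) \<Rightarrow> 'c set \<Rightarrow> ('c \<Rightarrow> int) \<Rightarrow> 'b" where
  "natural_map X Y f x0 n \<alpha> =
     adjoint_morphism X Y f {f x0} (\<lambda>U s. \<alpha> U (restrict_to_point x0 U s))"

definition proper :: "'a topology \<Rightarrow> 'b topology \<Rightarrow> ('a \<Rightarrow> 'b) \<Rightarrow> bool" where
  "proper X Y f \<longleftrightarrow> c_proper X Y f \<and>
     (\<forall>x0 p. fibre_closed X f x0 \<and> p \<in> topspace X \<and> x0 \<in> X closure_of {p} \<longrightarrow>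
        (\<forall>I \<epsilon>. injective_resolution X (const_sheaf X {p}) I \<epsilon> \<longrightarrow>
           quasi_iso (hom_complex X (const_sheaf X {x0}) I)
             (hom_complex Y (const_sheaf Y {f x0}) (direct_image_complex X f I))
             (natural_map X Y f x0)))"

end

theory Submission
  imports Defs
begin

text \<open>If \<open>f\<close> is c-proper then the fibres of \<open>C\<^bsub>p\<^esub> \<rightarrow> C\<^bsub>f(p)\<^esub>\<close> are nonempty, and this alone forces \<open>f\<close> to send
  vertices to vertices and to be determined by them. Conversely, if \<open>f\<close> is induced by \<open>\<phi>\<close>, each of these
  fibres has a greatest element, hence is cohomologically trivial.

  For properness, let \<open>I\<close> be an injective resolution of \<open>\<int>\<^bsub>{p}\<^esub>\<close>, \<open>y = f x0\<close>, \<open>V\<close> the preimage of the smallest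
  open neighbourhood of \<open>y\<close>, and \<open>F\<close> the fibre of \<open>y\<close>. The natural map is the inclusion of the sections of
  \<open>I\<close> over \<open>V\<close> supported in \<open>{x0}\<close> into those supported in \<open>F\<close>. Its cokernel consists of the sections over
  \<open>V - {x0}\<close> supported in \<open>F - {x0}\<close>, so the claim is that this complex is acyclic. Simplices not
  contained in \<open>p\<close> do not contribute. The others fall, one vertex \<open>a\<close> of \<open>x0\<close> after the other, into
  families closed under adding and removing \<open>a\<close>; here the pairs \<open>{z - {a}, z \<union> {a}}\<close> cancel.\<close>

section \<open>Sheaves on finite spaces\<close>

text \<open>The definitions quantify over all injective resolutions, so the argument cannot choose a
  convenient \<open>I\<close>. Every \<open>I\<close> is flasque, and exact over the minimal open
  sets \<open>up P x\<close>, whose sections are stalks. Long exact sequences are replaced by one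
  notion, \<open>rel_acyclic A V\<close>, the vanishing of the cohomology of \<open>V\<close>
  relative to \<open>A\<close>. It obeys transitivity, cancellation and excision, all proved by
  extending and gluing sections. In the opposite direction, showing that an empty fibre is not
  cohomologically trivial needs an explicit resolution, which the empty space provides.

  A pair \<open>{b, insert a b}\<close> cancels because \<open>a\<close> lies in \<open>p\<close>,
  so \<open>b\<close> is not \<open>p\<close> and the stalk of \<int> on \<open>{p}\<close> at
  \<open>b\<close> is zero. What remains is the part of the neighbourhood of \<open>b\<close>
  outside the pair. Its faces of \<open>p\<close> are again stable under toggling \<open>a\<close>
  but have more vertices, which is why the induction runs on the codimension in
  \<open>p\<close>.\<close>

lemma sheaf_comm_group: "sheaf X F \<Longrightarrow> openin X U \<Longrightarrow> comm_group (sections F U)"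
  by (simp add: sheaf_def)

lemma sheaf_group: "sheaf X F \<Longrightarrow> openin X U \<Longrightarrow> group (sections F U)"
  by (simp add: sheaf_comm_group comm_group.axioms(2))

lemma sheaf_restr_hom:
  "sheaf X F \<Longrightarrow> openin X U \<Longrightarrow> openin X V \<Longrightarrow> V \<subseteq> U \<Longrightarrow>
    restr F U V \<in> hom (sections F U) (sections F V)"
  by (simp add: sheaf_def)

lemma sheaf_restr_group_hom:
  "sheaf X F \<Longrightarrow> openin X U \<Longrightarrow> openin X V \<Longrightarrow> V \<subseteq> U \<Longrightarrow>
    group_hom (sections F U) (sections F V) (restr F U V)"
  by (simp add: group_hom_def group_hom_axioms_def sheaf_group sheaf_restr_hom)

lemma sheaf_restr_id:
  "sheaf X F \<Longrightarrow> openin X U \<Longrightarrow> s \<in> carrier (sections F U) \<Longrightarrow> restr F U U s = s"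
  by (simp add: sheaf_def)

lemma sheaf_restr_restr:
  "sheaf X F \<Longrightarrow> openin X U \<Longrightarrow> openin X V \<Longrightarrow> openin X W \<Longrightarrow> W \<subseteq> V \<Longrightarrow> V \<subseteq> U \<Longrightarrow>
    s \<in> carrier (sections F U) \<Longrightarrow> restr F V W (restr F U V s) = restr F U W s"
  by (simp add: sheaf_def)

lemma sheaf_restr_closed:
  "sheaf X F \<Longrightarrow> openin X U \<Longrightarrow> openin X V \<Longrightarrow> V \<subseteq> U \<Longrightarrow> s \<in> carrier (sections F U) \<Longrightarrow>
    restr F U V s \<in> carrier (sections F V)"
  using sheaf_restr_hom hom_in_carrier by metis

lemma sheaf_ex1_glue:
  assumes "sheaf X F" and "\<And>U. U \<in> \<U> \<Longrightarrow> openin X U"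
    and "\<And>U. U \<in> \<U> \<Longrightarrow> s U \<in> carrier (sections F U)"
    and "\<And>U V. U \<in> \<U> \<Longrightarrow> V \<in> \<U> \<Longrightarrow> restr F U (U \<inter> V) (s U) = restr F V (U \<inter> V) (s V)"
  shows "\<exists>!t. t \<in> carrier (sections F (\<Union>\<U>)) \<and> (\<forall>U\<in>\<U>. restr F (\<Union>\<U>) U t = s U)"
proof -
  have gl: "\<forall>\<U> s. (\<forall>U\<in>\<U>. openin X U \<and> s U \<in> carrier (sections F U)) \<and>
        (\<forall>U\<in>\<U>. \<forall>V\<in>\<U>. restr F U (U \<inter> V) (s U) = restr F V (U \<inter> V) (s V)) \<longrightarrow>
        (\<exists>!t. t \<in> carrier (sections F (\<Union>\<U>)) \<and> (\<forall>U\<in>\<U>. restr F (\<Union>\<U>) U t = s U))"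
    using assms(1) unfolding sheaf_def by (elim conjE)
  show ?thesis by (rule gl[rule_format]) (use assms(2-4) in blast)
qed

text \<open>Uniqueness of gluing, applied to the restrictions of \<open>s\<close> to the members of
  the cover: both \<open>s\<close> and \<open>t\<close> glue them.\<close>

lemma sheaf_eqI:
  assumes F: "sheaf X F" and op: "\<And>i. i \<in> A \<Longrightarrow> openin X (W i)" and U: "U = (\<Union>i\<in>A. W i)"
    and s: "s \<in> carrier (sections F U)" and t: "t \<in> carrier (sections F U)"
    and eq: "\<And>i. i \<in> A \<Longrightarrow> restr F U (W i) s = restr F U (W i) t"
  shows "s = t"
proof -
  have opU: "openin X U" unfolding U using op by blast
  have UN: "\<Union>(W ` A) = U" using U by simp
  have sub: "openin X V \<and> V \<subseteq> U" if "V \<in> W ` A" for V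
    using that op U by blast
  let ?Q = "\<lambda>r. r \<in> carrier (sections F (\<Union>(W ` A))) \<and>
          (\<forall>V\<in>W ` A. restr F (\<Union>(W ` A)) V r = restr F U V s)"
  have ex1: "\<exists>!r. ?Q r"
  proof (rule sheaf_ex1_glue[OF F])
    show "restr F V (V \<inter> V') (restr F U V s) = restr F V' (V \<inter> V') (restr F U V' s)"
      if "V \<in> W ` A" "V' \<in> W ` A" for V V'
      using sub[OF that(1)] sub[OF that(2)] sheaf_restr_restr[OF F opU _ _ _ _ s, of V "V \<inter> V'"]
        sheaf_restr_restr[OF F opU _ _ _ _ s, of V' "V \<inter> V'"] by (simp add: openin_Int)
    show "openin X V" if "V \<in> W ` A" for V using sub[OF that] by simp
    show "restr F U V s \<in> carrier (sections F V)" if "V \<in> W ` A" for V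
      using sheaf_restr_closed[OF F opU _ _ s] sub[OF that] by simp
  qed
  have "(THE r. ?Q r) = s" by (rule the1_equality[OF ex1]) (use s in \<open>simp add: UN\<close>)
  moreover have "(THE r. ?Q r) = t" by (rule the1_equality[OF ex1]) (use t eq in \<open>simp add: UN\<close>)
  ultimately show ?thesis by simp
qed

text \<open>The sheaf axiom is stated for sets of open sets, whereas an indexed family may repeat a
  member. Repetitions are harmless: if \<open>W i = W j\<close>, compatibility on
  \<open>W i \<inter> W j\<close> says \<open>s i = s j\<close>.\<close>

lemma sheaf_glue:
  assumes F: "sheaf X F" and op: "\<And>i. i \<in> A \<Longrightarrow> openin X (W i)"
    and s: "\<And>i. i \<in> A \<Longrightarrow> s i \<in> carrier (sections F (W i))"
    and eq: "\<And>i j. i \<in> A \<Longrightarrow> j \<in> A \<Longrightarrow>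
      restr F (W i) (W i \<inter> W j) (s i) = restr F (W j) (W i \<inter> W j) (s j)"
  obtains t where "t \<in> carrier (sections F (\<Union>i\<in>A. W i))"
    and "\<And>i. i \<in> A \<Longrightarrow> restr F (\<Union>i\<in>A. W i) (W i) t = s i"
proof -
  define c where "c V = (SOME i. i \<in> A \<and> W i = V)" for V
  have c: "c V \<in> A \<and> W (c V) = V" if "V \<in> W ` A" for V
    unfolding c_def by (rule someI_ex) (use that in auto)
  have ind: "s (c (W i)) = s i" if "i \<in> A" for i
  proof -
    have "c (W i) \<in> A" "W (c (W i)) = W i" using c that by auto
    then show ?thesis
      using eq[of "c (W i)" i] that s[of "c (W i)"] s[of i] sheaf_restr_id[OF F op[OF that]]
      by simp
  qed
  have "\<exists>!t. t \<in> carrier (sections F (\<Union>(W ` A))) \<and>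
          (\<forall>V\<in>W ` A. restr F (\<Union>(W ` A)) V t = s (c V))"
  proof (rule sheaf_ex1_glue[OF F])
    show "s (c V) \<in> carrier (sections F V)" if "V \<in> W ` A" for V
      using c[OF that] s by metis
    show "restr F V (V \<inter> V') (s (c V)) = restr F V' (V \<inter> V') (s (c V'))"
      if "V \<in> W ` A" "V' \<in> W ` A" for V V'
      using c[OF that(1)] c[OF that(2)] eq[of "c V" "c V'"] by metis
  qed (use op in auto)
  then obtain t where t: "t \<in> carrier (sections F (\<Union>(W ` A)))"
      "\<forall>V\<in>W ` A. restr F (\<Union>(W ` A)) V t = s (c V)"
    by blast
  show ?thesis
    by (rule that[OF t(1)]) (use t(2) ind in simp)
qed

lemma sheaf_glue2:
  assumes F: "sheaf X F" and op: "openin X V" "openin X W"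
    and s: "s \<in> carrier (sections F V)" and t: "t \<in> carrier (sections F W)"
    and eq: "restr F V (V \<inter> W) s = restr F W (V \<inter> W) t"
  obtains r where "r \<in> carrier (sections F (V \<union> W))"
    and "restr F (V \<union> W) V r = s" and "restr F (V \<union> W) W r = t"
proof -
  define Z where "Z b = (if b then V else W)" for b
  define u where "u b = (if b then s else t)" for b
  have Z: "Z True = V" "Z False = W" "u True = s" "u False = t"
    by (simp_all add: Z_def u_def)
  have UN: "(\<Union>b\<in>UNIV. Z b) = V \<union> W" by (simp add: UNIV_bool Z Un_commute)
  obtain r where r: "r \<in> carrier (sections F (V \<union> W))"
      "\<And>b. restr F (V \<union> W) (Z b) r = u b"
  proof (rule sheaf_glue[OF F, of UNIV Z u, unfolded UN])
    show "openin X (Z b)" "u b \<in> carrier (sections F (Z b))" for b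
      using op s t Z by (cases b; simp)+
    have eq': "restr F W (W \<inter> V) t = restr F V (W \<inter> V) s"
      using eq by (simp only: Int_commute)
    show "restr F (Z b) (Z b \<inter> Z c) (u b) = restr F (Z c) (Z b \<inter> Z c) (u c)" for b c
      by (cases b; cases c; simp only: Z eq eq')
  qed blast
  then show ?thesis using that r(1) r(2)[of True] r(2)[of False] unfolding Z by blast
qed

lemma sheaf_eqI2:
  assumes "sheaf X F" "openin X V" "openin X W"
    and "s \<in> carrier (sections F (V \<union> W))" "t \<in> carrier (sections F (V \<union> W))"
    and "restr F (V \<union> W) V s = restr F (V \<union> W) V t"
    and "restr F (V \<union> W) W s = restr F (V \<union> W) W t"
  shows "s = t"
proof (rule sheaf_eqI[OF assms(1), of "{V, W}" id])
  show "restr F (V \<union> W) (id i) s = restr F (V \<union> W) (id i) t" if "i \<in> {V, W}" for i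
    using that assms(6,7) by (elim insertE) simp_all
qed (use assms(2-5) in auto)

text \<open>The empty family covers \<open>{}\<close>, so any two sections over it agree.\<close>

lemma sheaf_sections_empty:
  assumes F: "sheaf X F"
  shows "carrier (sections F {}) = {\<one>\<^bsub>sections F {}\<^esub>}"
proof -
  interpret group "sections F {}" using sheaf_group[OF F] by simp
  have "s = \<one>\<^bsub>sections F {}\<^esub>" if "s \<in> carrier (sections F {})" for s
    by (rule sheaf_eqI[OF F, of "{}" "\<lambda>_. {}" "{}"]) (use that in simp_all)
  then show ?thesis by auto
qed


subsection \<open>Minimal open neighbourhoods\<close>

text \<open>The smallest open neighbourhood of \<open>x\<close>. Its sections form the stalk at
  \<open>x\<close>, so exactness and gluing can be tested on these sets.\<close>

definition up :: "'a::order set \<Rightarrow> 'a \<Rightarrow> 'a set" where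
  "up P x = {z \<in> P. x \<le> z}"

lemma up_self: "x \<in> P \<Longrightarrow> x \<in> up P x"
  by (simp add: up_def)

lemma openin_up [simp]: "openin (upper_topology P) (up P x)"
  by (auto simp: openin_upper_topology up_def)

lemma openin_up_Diff [simp]: "openin (upper_topology P) (up P x - {x})"
  by (auto simp: openin_upper_topology up_def)

lemma up_subset: "openin (upper_topology P) U \<Longrightarrow> x \<in> U \<Longrightarrow> up P x \<subseteq> U"
  by (auto simp: openin_upper_topology up_def)

lemma open_eq_UN_up: "openin (upper_topology P) U \<Longrightarrow> U = (\<Union>x\<in>U. up P x)"
  by (auto simp: openin_upper_topology up_def)

lemma up_mono: "x \<le> z \<Longrightarrow> up P z \<subseteq> up P x"
  by (auto simp: up_def)

lemma upper_sheaf_eqI: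
  assumes F: "sheaf (upper_topology P) F" and U: "openin (upper_topology P) U"
    and "s \<in> carrier (sections F U)" "t \<in> carrier (sections F U)"
    and "\<And>x. x \<in> U \<Longrightarrow> restr F U (up P x) s = restr F U (up P x) t"
  shows "s = t"
  by (rule sheaf_eqI[OF F, of U "up P"]) (use assms open_eq_UN_up[OF U] in auto)

text \<open>A sheaf on a poset amounts to a functor on it: compatibility is needed only along
  \<open>x \<le> z\<close>. This implies compatibility on overlaps, because
  \<open>up P x \<inter> up P z\<close> is covered by the sets \<open>up P w\<close> with
  \<open>w\<close> above both points.\<close>

lemma upper_sheaf_glue:
  assumes F: "sheaf (upper_topology P) F" and U: "openin (upper_topology P) U"
    and s: "\<And>x. x \<in> U \<Longrightarrow> s x \<in> carrier (sections F (up P x))"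
    and eq: "\<And>x z. x \<in> U \<Longrightarrow> z \<in> U \<Longrightarrow> x \<le> z \<Longrightarrow> restr F (up P x) (up P z) (s x) = s z"
  obtains t where "t \<in> carrier (sections F U)"
    and "\<And>x. x \<in> U \<Longrightarrow> restr F U (up P x) t = s x"
proof (rule sheaf_glue[OF F, of U "up P" s])
  show "restr F (up P x) (up P x \<inter> up P z) (s x) = restr F (up P z) (up P x \<inter> up P z) (s z)"
    if x: "x \<in> U" and z: "z \<in> U" for x z
  proof (rule upper_sheaf_eqI[OF F, of "up P x \<inter> up P z"])
    fix w assume w: "w \<in> up P x \<inter> up P z"
    have wU: "w \<in> U" using w up_subset[OF U x] by auto
    have sub: "up P w \<subseteq> up P x \<inter> up P z" using w by (auto simp: up_def)
    have op: "openin (upper_topology P) (up P x \<inter> up P z)" by (simp add: openin_Int)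
    have xw: "x \<le> w" "z \<le> w" using w by (auto simp: up_def)
    have "restr F (up P x \<inter> up P z) (up P w) (restr F (up P x) (up P x \<inter> up P z) (s x)) = s w"
      using sheaf_restr_restr[OF F openin_up op openin_up sub inf_le1 s[OF x]] eq[OF x wU xw(1)] by simp
    moreover have "restr F (up P x \<inter> up P z) (up P w) (restr F (up P z) (up P x \<inter> up P z) (s z)) = s w"
      using sheaf_restr_restr[OF F openin_up op openin_up sub inf_le2 s[OF z]] eq[OF z wU xw(2)] by simp
    ultimately show "restr F (up P x \<inter> up P z) (up P w) (restr F (up P x) (up P x \<inter> up P z) (s x)) =
        restr F (up P x \<inter> up P z) (up P w) (restr F (up P z) (up P x \<inter> up P z) (s z))" by simp
  qed (use s[OF x] s[OF z] in \<open>auto intro!: sheaf_restr_closed[OF F]\<close>)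
qed (use s that open_eq_UN_up[OF U] in auto)

lemma subtopology_upper_topology:
  assumes "S \<subseteq> P"
  shows "subtopology (upper_topology P) S = upper_topology S"
proof -
  have "openin (subtopology (upper_topology P) S) U \<longleftrightarrow> openin (upper_topology S) U" for U
  proof
    assume "openin (upper_topology S) U"
    \<comment> \<open>The open subset of \<open>P\<close> that cuts out \<open>U\<close> is the
      upward closure of \<open>U\<close>.\<close>
    then have "U = {z \<in> P. \<exists>x\<in>U. x \<le> z} \<inter> S"
      using assms by (auto simp: openin_upper_topology)
    moreover have "openin (upper_topology P) {z \<in> P. \<exists>x\<in>U. x \<le> z}"
      using order_trans by (fastforce simp: openin_upper_topology)
    ultimately show "openin (subtopology (upper_topology P) S) U"
      by (metis openin_subtopology)
  qed (use assms in \<open>auto simp: openin_subtopology openin_upper_topology subset_iff\<close>)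
  then show ?thesis by (simp add: topology_eq)
qed

lemma continuous_map_upper_mono:
  assumes "continuous_map (upper_topology P) (upper_topology Q) f" "x \<in> P" "z \<in> P" "x \<le> z"
  shows "f x \<le> f z"
proof -
  have fx: "f x \<in> Q"
    using assms by (auto simp: continuous_map_def)
  have "openin (upper_topology P) {w \<in> P. f w \<in> up Q (f x)}"
    using openin_continuous_map_preimage[OF assms(1) openin_up] by simp
  then have "z \<in> {w \<in> P. f w \<in> up Q (f x)}"
    using assms(2-4) fx up_self unfolding openin_upper_topology by blast
  then show ?thesis by (simp add: up_def)
qed


subsection \<open>Constant sheaves on locally closed subsets\<close>

lemma restr_const_sheaf [simp]:
  "restr (const_sheaf X S) U V s = (\<lambda>x. if x \<in> V then s x else 0)"
  by (simp add: const_sheaf_def)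

lemma mult_const_sheaf [simp]: "monoid.mult (sections (const_sheaf X S) U) s t = (\<lambda>x. s x + t x)"
  by (simp add: const_sheaf_def)

lemma one_const_sheaf [simp]: "\<one>\<^bsub>sections (const_sheaf X S) U\<^esub> = (\<lambda>x. 0)"
  by (simp add: const_sheaf_def)

text \<open>For \<open>x \<le> z\<close> with \<open>z\<close> in \<open>S\<close>, the equation
  \<open>s x = s z\<close> merges two conditions: for \<open>x\<close> in \<open>S\<close> it is
  local constancy; for \<open>x\<close> outside \<open>S\<close> it makes \<open>s z\<close> vanish,
  which expresses closedness of the support. Nothing is asked when \<open>z\<close> lies outside
  \<open>S\<close>.\<close>

lemma carrier_const_sheaf:
  assumes S: "S \<subseteq> P" and U: "openin (upper_topology P) U"
  shows "carrier (sections (const_sheaf (upper_topology P) S) U) =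
    {s. (\<forall>x. x \<notin> U \<inter> S \<longrightarrow> s x = 0) \<and> (\<forall>x\<in>U. \<forall>z\<in>U \<inter> S. x \<le> z \<longrightarrow> s x = s z)}"
proof -
  have UP: "U \<subseteq> P" using openin_subset[OF U] by simp
  have sub: "subtopology (upper_topology P) T = upper_topology T" if "T \<subseteq> U" for T
    using subtopology_upper_topology[OF subset_trans[OF that UP]] .
  have "continuous_map (upper_topology (U \<inter> S)) (discrete_topology UNIV) s \<and>
      closedin (upper_topology U) {x. s x \<noteq> 0} \<longleftrightarrow>
      (\<forall>x\<in>U. \<forall>z\<in>U \<inter> S. x \<le> z \<longrightarrow> s x = s z)" (is "?l \<longleftrightarrow> ?r")
    if z: "\<forall>x. x \<notin> U \<inter> S \<longrightarrow> s x = 0" for s :: "'a \<Rightarrow> int"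
  proof
    assume l: ?l
    show ?r
    proof (intro ballI impI)
      fix x z assume xz: "x \<in> U" "z \<in> U \<inter> S" "x \<le> z"
      show "s x = s z"
      proof (cases "x \<in> S")
        case True
        have op: "openin (upper_topology (U \<inter> S)) {w \<in> U \<inter> S. s w \<in> {s x}}"
          using l openin_continuous_map_preimage[of "upper_topology (U \<inter> S)" "discrete_topology UNIV" s "{s x}"]
          by simp
        have "x \<in> {w \<in> U \<inter> S. s w \<in> {s x}}" using True xz(1) by simp
        then have "z \<in> {w \<in> U \<inter> S. s w \<in> {s x}}"
          using op xz(2,3) unfolding openin_upper_topology by blast
        then show ?thesis by simp
      next
        case False
        then have "s x = 0" using that by blast
        then show ?thesis using l xz unfolding closedin_upper_topology by auto
      qed
    qed
  next
    assume r: ?r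
    have c: "closedin (upper_topology U) {x. s x \<noteq> 0}"
      unfolding closedin_upper_topology using r z by (smt (verit) IntD1 mem_Collect_eq subsetI)
    have "openin (upper_topology (U \<inter> S)) {w \<in> U \<inter> S. s w \<in> A}" for A
      unfolding openin_upper_topology
    proof (intro conjI ballI impI)
      fix x w assume "x \<in> {w \<in> U \<inter> S. s w \<in> A}" and w: "w \<in> U \<inter> S" "x \<le> w"
      then have x: "x \<in> U" "s x \<in> A" by simp_all
      have "s x = s w" using r x(1) w by blast
      then show "w \<in> {w \<in> U \<inter> S. s w \<in> A}" using w x by simp
    qed blast
    then show ?l
      using c by (simp add: continuous_map_def)
  qed
  moreover have "subtopology (upper_topology P) (U \<inter> S) = upper_topology (U \<inter> S)"
    "subtopology (upper_topology P) U = upper_topology U" by (rule sub; simp)+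
  ultimately show ?thesis unfolding const_sheaf_def by (simp cong: conj_cong)
qed

lemma const_sheaf_memI:
  assumes "S \<subseteq> P" "openin (upper_topology P) U" and "\<And>x. x \<notin> U \<Longrightarrow> s x = 0" "\<And>x. x \<notin> S \<Longrightarrow> s x = 0"
    and "\<And>x z. x \<in> U \<Longrightarrow> z \<in> U \<Longrightarrow> z \<in> S \<Longrightarrow> x \<le> z \<Longrightarrow> s x = s z"
  shows "s \<in> carrier (sections (const_sheaf (upper_topology P) S) U)"
  using assms(3-5) by (auto simp: carrier_const_sheaf[OF assms(1,2)])

lemma const_sheaf_memD:
  assumes "s \<in> carrier (sections (const_sheaf (upper_topology P) S) U)"
    and "S \<subseteq> P" "openin (upper_topology P) U"
  shows "x \<notin> U \<Longrightarrow> s x = 0" "x \<notin> S \<Longrightarrow> s x = 0"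
    and "x \<in> U \<Longrightarrow> z \<in> U \<Longrightarrow> z \<in> S \<Longrightarrow> x \<le> z \<Longrightarrow> s x = s z"
  using assms(1) unfolding carrier_const_sheaf[OF assms(2,3)] by blast+

lemma comm_group_const_sheaf:
  assumes S: "S \<subseteq> P" and U: "openin (upper_topology P) U"
  shows "comm_group (sections (const_sheaf (upper_topology P) S) U)" (is "comm_group ?G")
proof (rule comm_groupI)
  show "s \<otimes>\<^bsub>?G\<^esub> t \<in> carrier ?G" if s: "s \<in> carrier ?G" and t: "t \<in> carrier ?G" for s t
  proof (rule const_sheaf_memI[OF S U])
    fix x z assume xz: "x \<in> U" "z \<in> U" "z \<in> S" "x \<le> z"
    show "(s \<otimes>\<^bsub>?G\<^esub> t) x = (s \<otimes>\<^bsub>?G\<^esub> t) z"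
      using const_sheaf_memD(3)[OF s S U xz] const_sheaf_memD(3)[OF t S U xz] by simp
  qed (simp_all add: const_sheaf_memD[OF s S U] const_sheaf_memD[OF t S U])
  show "\<one>\<^bsub>?G\<^esub> \<in> carrier ?G" by (rule const_sheaf_memI[OF S U]) simp_all
  show "\<exists>t\<in>carrier ?G. t \<otimes>\<^bsub>?G\<^esub> s = \<one>\<^bsub>?G\<^esub>" if s: "s \<in> carrier ?G" for s
  proof (rule bexI)
    show "(\<lambda>x. - s x) \<in> carrier ?G"
    proof (rule const_sheaf_memI[OF S U])
      show "- s x = - s z" if "x \<in> U" "z \<in> U" "z \<in> S" "x \<le> z" for x z
        using const_sheaf_memD(3)[OF s S U that] by simp
    qed (simp_all add: const_sheaf_memD(1,2)[OF s S U])
  qed simp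
qed (simp_all add: ac_simps)

lemma sheaf_const_sheaf:
  assumes S: "S \<subseteq> P"
  shows "sheaf (upper_topology P) (const_sheaf (upper_topology P) S)"
  unfolding sheaf_def
proof (intro conjI allI impI, goal_cases)
  case (1 U)
  then show ?case by (rule comm_group_const_sheaf[OF S])
next
  case (2 U V)
  then have U: "openin (upper_topology P) U" and V: "openin (upper_topology P) V" and sub: "V \<subseteq> U" by auto
  show ?case
  proof (rule homI)
    fix s assume s: "s \<in> carrier (sections (const_sheaf (upper_topology P) S) U)"
    show "restr (const_sheaf (upper_topology P) S) U V s \<in> carrier (sections (const_sheaf (upper_topology P) S) V)"
      by (rule const_sheaf_memI[OF S V]) (use const_sheaf_memD[OF s S U] sub in \<open>simp_all add: subset_iff\<close>)
  qed auto
next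
  case (3 U)
  then show ?case by (auto intro!: ext dest: const_sheaf_memD(1)[OF _ S])
next
  case (4 U V W)
  then show ?case by (auto simp: fun_eq_iff)
next
  case (5 \<U> s)
  then have op: "\<And>U. U \<in> \<U> \<Longrightarrow> openin (upper_topology P) U"
    and s: "\<And>U. U \<in> \<U> \<Longrightarrow> s U \<in> carrier (sections (const_sheaf (upper_topology P) S) U)"
    and eq: "\<And>U V. U \<in> \<U> \<Longrightarrow> V \<in> \<U> \<Longrightarrow> (\<lambda>x. if x \<in> U \<inter> V then s U x else 0) = (\<lambda>x. if x \<in> U \<inter> V then s V x else 0)"
    by auto
  have opU: "openin (upper_topology P) (\<Union>\<U>)" using op by blast
  have eq': "s U x = s V x" if "U \<in> \<U>" "V \<in> \<U>" "x \<in> U" "x \<in> V" for U V x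
    using fun_cong[OF eq[OF that(1,2)], of x] that by simp
  \<comment> \<open>All members of the cover that contain \<open>x\<close> give the same value, by
    \<open>eq'\<close>.\<close>
  define t where "t x = (if x \<in> \<Union>\<U> then s (SOME U. U \<in> \<U> \<and> x \<in> U) x else 0)" for x
  have t: "t x = s U x" if "U \<in> \<U>" "x \<in> U" for x U
    
  proof -
    have U: "(SOME U. U \<in> \<U> \<and> x \<in> U) \<in> \<U> \<and> x \<in> (SOME U. U \<in> \<U> \<and> x \<in> U)"
      by (rule someI[of "\<lambda>U. U \<in> \<U> \<and> x \<in> U" U]) (use that in simp)
    have x: "x \<in> \<Union>\<U>" using that by blast
    show ?thesis unfolding t_def if_P[OF x]
      by (rule eq'[OF conjunct1[OF U] that(1) conjunct2[OF U] that(2)])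
  qed
  have t0: "t x = 0" if "x \<notin> \<Union>\<U>" for x using that by (auto simp: t_def)
  have "t \<in> carrier (sections (const_sheaf (upper_topology P) S) (\<Union>\<U>))"
  proof (rule const_sheaf_memI[OF S opU t0])
    show "t x = 0" if "x \<notin> S" for x
    proof (cases "x \<in> \<Union>\<U>")
      case True
      then obtain U where U: "U \<in> \<U>" "x \<in> U" by blast
      then show ?thesis using const_sheaf_memD(2)[OF s[OF U(1)] S op[OF U(1)] that] t[OF U] by simp
    qed (use t0 in auto)
    show "t x = t z" if x: "x \<in> \<Union>\<U>" and z: "z \<in> \<Union>\<U>" "z \<in> S" and xz: "x \<le> z" for x z
    proof -
      obtain U where U: "U \<in> \<U>" "x \<in> U" using x by blast
      have "z \<in> P" using z(2) S by auto
      \<comment> \<open>\<open>U\<close> is an upper set, so the comparison of \<open>x\<close> and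
        \<open>z\<close> takes place inside a single member of the cover.\<close>
      then have zU: "z \<in> U" using op[OF U(1)] U(2) xz unfolding openin_upper_topology by blast
      show ?thesis
        using const_sheaf_memD(3)[OF s[OF U(1)] S op[OF U(1)] U(2) zU z(2) xz] t[OF U] t[OF U(1) zU] by simp
    qed
  qed
  moreover have "(\<lambda>x. if x \<in> U then t x else 0) = s U" if "U \<in> \<U>" for U
    using const_sheaf_memD(1)[OF s[OF that] S op[OF that]] t[OF that] by auto
  moreover have "t' = t" if "t' \<in> carrier (sections (const_sheaf (upper_topology P) S) (\<Union>\<U>))"
    "\<forall>U\<in>\<U>. (\<lambda>x. if x \<in> U then t' x else 0) = s U" for t'
  proof
    fix x
    show "t' x = t x"
    proof (cases "x \<in> \<Union>\<U>")
      case True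
      then obtain U where U: "U \<in> \<U>" "x \<in> U" by blast
      then show ?thesis using fun_cong[OF that(2)[rule_format, OF U(1)], of x] t by auto
    qed (use t0 const_sheaf_memD(1)[OF that(1) S opU] in simp)
  qed
  ultimately show ?case unfolding restr_const_sheaf by (intro ex1I[of _ t]) blast+
qed


section \<open>Sections as morphisms out of constant sheaves, and flasqueness of injectives\<close>

lemma sheaf_morphism_hom:
  "sheaf_morphism X A B \<phi> \<Longrightarrow> openin X U \<Longrightarrow> \<phi> U \<in> hom (sections A U) (sections B U)"
  by (simp add: sheaf_morphism_def)

lemma sheaf_morphism_closed:
  "sheaf_morphism X A B \<phi> \<Longrightarrow> openin X U \<Longrightarrow> s \<in> carrier (sections A U) \<Longrightarrow>
    \<phi> U s \<in> carrier (sections B U)"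
  by (rule hom_in_carrier[OF sheaf_morphism_hom])

lemma sheaf_morphism_restr:
  "sheaf_morphism X A B \<phi> \<Longrightarrow> openin X U \<Longrightarrow> openin X V \<Longrightarrow> V \<subseteq> U \<Longrightarrow>
    s \<in> carrier (sections A U) \<Longrightarrow> \<phi> V (restr A U V s) = restr B U V (\<phi> U s)"
  by (simp add: sheaf_morphism_def)

text \<open>The generator of the constant sheaf on \<open>V - V'\<close>; its support is closed in
  \<open>V\<close> because \<open>V'\<close> is open.\<close>

lemma indicator_const_sheaf:
  assumes "openin (upper_topology P) V" "openin (upper_topology P) V'"
  shows "(\<lambda>x. of_bool (x \<in> V - V')) \<in>
    carrier (sections (const_sheaf (upper_topology P) (V - V')) V)"
proof -
  have "V - V' \<subseteq> P" using openin_subset[OF assms(1)] by auto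
  then show ?thesis
    using assms by (auto simp: carrier_const_sheaf openin_upper_topology)
qed

text \<open>A section of \<open>F\<close> over \<open>V\<close> that vanishes on \<open>V'\<close> is the same as a morphism from the constant
  sheaf on \<open>V - V'\<close>; this is the existence half.\<close>

lemma ex_morphism_const_sheaf:
  fixes P :: "'a::order set"
  assumes F: "sheaf (upper_topology P) F"
    and V: "openin (upper_topology P) V" and V': "openin (upper_topology P) V'" and sub: "V' \<subseteq> V"
    and s: "s \<in> carrier (sections F V)" and s0: "restr F V V' s = \<one>\<^bsub>sections F V'\<^esub>"
  obtains \<phi> where "sheaf_morphism (upper_topology P) (const_sheaf (upper_topology P) (V - V')) F \<phi>"
    and "\<phi> V (\<lambda>x. of_bool (x \<in> V - V')) = s"
proof -
  let ?X = "upper_topology P" and ?Z = "const_sheaf (upper_topology P) (V - V')"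
  have VP: "V \<subseteq> P" using openin_subset[OF V] by simp
  then have SP: "V - V' \<subseteq> P" by auto
  have G': "group (sections F (up P x))" for x
    using sheaf_group[OF F] by simp
  have sx: "restr F V (up P x) s \<in> carrier (sections F (up P x))" if "x \<in> V" for x
    using sheaf_restr_closed[OF F V _ up_subset[OF V that] s] by simp
  have sx0: "restr F V (up P x) s = \<one>\<^bsub>sections F (up P x)\<^esub>" if "x \<in> V'" for x
  proof -
    have "restr F V (up P x) s = restr F V' (up P x) (restr F V V' s)"
      using sheaf_restr_restr[OF F V V' _ up_subset[OF V' that] sub s] by simp
    then show ?thesis
      using group_hom.hom_one[OF sheaf_restr_group_hom[OF F V' _ up_subset[OF V' that]]] s0 by simp
  qed
  \<comment> \<open>The germ prescribed at \<open>x\<close> is the \<open>c x\<close>-fold multiple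
    of the germ of \<open>s\<close>, a power because groups are written multiplicatively. Outside
    \<open>V\<close>, where \<open>s\<close> has no germ, it is trivial.\<close>
  define \<tau> where "\<tau> c x = (if x \<in> V then restr F V (up P x) s [^]\<^bsub>sections F (up P x)\<^esub> (c x :: int)
    else \<one>\<^bsub>sections F (up P x)\<^esub>)" for c x
  have \<tau>_closed: "\<tau> c x \<in> carrier (sections F (up P x))" for c x
    unfolding \<tau>_def using sx group.int_pow_closed[OF G'] monoid.one_closed[OF group.is_monoid[OF G']] by simp
  have \<tau>_one: "\<tau> c x = \<one>\<^bsub>sections F (up P x)\<^esub>" if "x \<in> V \<Longrightarrow> x \<notin> V' \<Longrightarrow> c x = 0" for c x
  proof (cases "x \<in> V'")
    case True
    then show ?thesis unfolding \<tau>_def using sx0[OF True] group.int_pow_one[OF G'] by simp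
  next
    case False
    then show ?thesis unfolding \<tau>_def using that[OF _ False] by simp
  qed
  have \<tau>_restr: "restr F (up P x) (up P z) (\<tau> c x) = \<tau> c z"
    if U: "openin ?X U" and c: "c \<in> carrier (sections ?Z U)" and x: "x \<in> U" and z: "z \<in> U"
      and xz: "x \<le> z" for c U x z
  proof -
    interpret h: group_hom "sections F (up P x)" "sections F (up P z)" "restr F (up P x) (up P z)"
      using sheaf_restr_group_hom[OF F] up_mono[OF xz] by simp
    have zP: "z \<in> P" using z openin_subset[OF U] by auto
    have c': "c x = c z" if "z \<in> V - V'"
      using const_sheaf_memD(3)[OF c SP U x z that xz] .
    have c0: "c w = 0" if "w \<notin> V - V'" for w
      using const_sheaf_memD(2)[OF c SP U that] .
    \<comment> \<open>If \<open>z\<close> lies in \<open>V - V'\<close>, the exponents at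
      \<open>x\<close> and \<open>z\<close> agree. For any other \<open>z\<close> the target germ is
      trivial: either \<open>z\<close> is outside \<open>V\<close>, and then so is \<open>x\<close>,
      or \<open>z\<close> is in \<open>V'\<close>, where \<open>s\<close> vanishes.\<close>
    show ?thesis
    proof (cases "z \<in> V - V'")
      case False
      then have z1: "\<tau> c z = \<one>\<^bsub>sections F (up P z)\<^esub>" by (intro \<tau>_one) auto
      show ?thesis
      proof (cases "x \<in> V - V'")
        case True
        then have xV: "x \<in> V" "up P x \<subseteq> V" using up_subset[OF V] by auto
        then have "z \<in> V" using xz zP by (auto simp: up_def)
        then have "restr F V (up P z) s = \<one>\<^bsub>sections F (up P z)\<^esub>" using False sx0 by auto
        then have "restr F (up P x) (up P z) (restr F V (up P x) s) = \<one>\<^bsub>sections F (up P z)\<^esub>"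
          using sheaf_restr_restr[OF F V _ _ up_mono[OF xz] xV(2) s] by simp
        then show ?thesis using xV z1 sx[OF xV(1)] by (simp add: \<tau>_def h.hom_int_pow)
      next
        case False
        then have "\<tau> c x = \<one>\<^bsub>sections F (up P x)\<^esub>" by (intro \<tau>_one) auto
        then show ?thesis using z1 by simp
      qed
    next
      case True
      show ?thesis
      proof (cases "x \<in> V")
        case xV: True
        have "restr F (up P x) (up P z) (restr F V (up P x) s) = restr F V (up P z) s"
          using sheaf_restr_restr[OF F V _ _ up_mono[OF xz] up_subset[OF V xV] s] by simp
        then show ?thesis using xV True sx[OF xV] c'[OF True] by (simp add: \<tau>_def h.hom_int_pow)
      next
        case False
        then have "c z = 0" using c0 c'[OF True] by (metis DiffD1)
        then show ?thesis using False True by (simp add: \<tau>_def)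
      qed
    qed
  qed
  \<comment> \<open>\<open>THE\<close> picks the unique gluing of the germs
    \<open>\<tau> c x\<close>; the properties of \<open>\<phi>\<close> follow by comparing germs
    through \<open>\<phi>_eq\<close>.\<close>
  define \<phi> where "\<phi> U c = (THE t. t \<in> carrier (sections F U) \<and> (\<forall>x\<in>U. restr F U (up P x) t = \<tau> c x))" for U c
  have \<phi>: "\<phi> U c \<in> carrier (sections F U) \<and> (\<forall>x\<in>U. restr F U (up P x) (\<phi> U c) = \<tau> c x)"
    if U: "openin ?X U" and c: "c \<in> carrier (sections ?Z U)" for U c
  proof -
    obtain t where t: "t \<in> carrier (sections F U)" "\<And>x. x \<in> U \<Longrightarrow> restr F U (up P x) t = \<tau> c x"
      by (rule upper_sheaf_glue[OF F U, of "\<tau> c"]) (use \<tau>_closed \<tau>_restr[OF U c] in simp_all)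
    have "\<exists>!t. t \<in> carrier (sections F U) \<and> (\<forall>x\<in>U. restr F U (up P x) t = \<tau> c x)"
    proof (rule ex1I)
      show "t \<in> carrier (sections F U) \<and> (\<forall>x\<in>U. restr F U (up P x) t = \<tau> c x)" using t by simp
      show "t' = t" if "t' \<in> carrier (sections F U) \<and> (\<forall>x\<in>U. restr F U (up P x) t' = \<tau> c x)" for t'
        by (rule upper_sheaf_eqI[OF F U]) (use that t in simp_all)
    qed
    from theI'[OF this] show ?thesis unfolding \<phi>_def .
  qed
  have \<phi>_eq: "\<phi> U c = t" if "openin ?X U" "c \<in> carrier (sections ?Z U)" "t \<in> carrier (sections F U)"
    "\<And>x. x \<in> U \<Longrightarrow> restr F U (up P x) t = \<tau> c x" for U c t
    by (rule upper_sheaf_eqI[OF F that(1)]) (use that(3,4) \<phi>[OF that(1,2)] in simp_all)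
  show ?thesis
  proof (rule that)
    show "sheaf_morphism ?X ?Z F \<phi>"
      unfolding sheaf_morphism_def
    proof (intro conjI allI impI ballI)
      fix U assume U: "openin ?X U"
      show "\<phi> U \<in> hom (sections ?Z U) (sections F U)"
      proof (rule homI)
        fix c c' assume c: "c \<in> carrier (sections ?Z U)" and c': "c' \<in> carrier (sections ?Z U)"
        have cc: "c \<otimes>\<^bsub>sections ?Z U\<^esub> c' \<in> carrier (sections ?Z U)"
          by (rule comm_groupE(1)[OF comm_group_const_sheaf[OF SP U] c c'])
        show "\<phi> U (c \<otimes>\<^bsub>sections ?Z U\<^esub> c') = \<phi> U c \<otimes>\<^bsub>sections F U\<^esub> \<phi> U c'"
        proof (rule \<phi>_eq[OF U cc])
          show "\<phi> U c \<otimes>\<^bsub>sections F U\<^esub> \<phi> U c' \<in> carrier (sections F U)"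
            using comm_groupE(1)[OF sheaf_comm_group[OF F U]] \<phi>[OF U c] \<phi>[OF U c'] by simp
          fix x assume x: "x \<in> U"
          interpret h: group_hom "sections F U" "sections F (up P x)" "restr F U (up P x)"
            using sheaf_restr_group_hom[OF F U _ up_subset[OF U x]] by simp
          show "restr F U (up P x) (\<phi> U c \<otimes>\<^bsub>sections F U\<^esub> \<phi> U c') = \<tau> (c \<otimes>\<^bsub>sections ?Z U\<^esub> c') x"
            using \<phi>[OF U c] \<phi>[OF U c'] x sx[of x] group.int_pow_mult[OF G'] by (auto simp: \<tau>_def)
        qed
      qed (use \<phi>[OF U] in auto)
    next
      fix U W c assume UW: "openin ?X U \<and> openin ?X W \<and> W \<subseteq> U" and c: "c \<in> carrier (sections ?Z U)"
      then have U: "openin ?X U" and W: "openin ?X W" and WU: "W \<subseteq> U" by auto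
      show "\<phi> W (restr ?Z U W c) = restr F U W (\<phi> U c)"
      proof (rule \<phi>_eq[OF W])
        show "restr ?Z U W c \<in> carrier (sections ?Z W)"
          using sheaf_restr_closed[OF sheaf_const_sheaf[OF SP] U W WU c] .
        show "restr F U W (\<phi> U c) \<in> carrier (sections F W)"
          using sheaf_restr_closed[OF F U W WU] \<phi>[OF U c] by auto
        fix x assume x: "x \<in> W"
        have "restr F W (up P x) (restr F U W (\<phi> U c)) = \<tau> c x"
          using sheaf_restr_restr[OF F U W _ up_subset[OF W x] WU] \<phi>[OF U c] x WU by auto
        then show "restr F W (up P x) (restr F U W (\<phi> U c)) = \<tau> (restr ?Z U W c) x"
          using x by (simp add: \<tau>_def)
      qed
    qed
    show "\<phi> V (\<lambda>x. of_bool (x \<in> V - V')) = s"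
    proof (rule \<phi>_eq[OF V indicator_const_sheaf[OF V V'] s])
      fix x assume "x \<in> V"
      then show "restr F V (up P x) s = \<tau> (\<lambda>x. of_bool (x \<in> V - V')) x"
        using sx0[of x] sx[of x] group.int_pow_1[OF G'] by (auto simp: \<tau>_def)
    qed
  qed
qed

text \<open>A section over \<open>V'\<close> is a morphism from the constant sheaf on
  \<open>V'\<close>. As \<open>V'\<close> is open, this is a subsheaf of the constant sheaf on
  \<open>V\<close>, so injectivity extends the morphism, and the extension is evaluated at the
  indicator of \<open>V\<close>. Constant sheaves have sections in
  \<open>'a \<Rightarrow> int\<close>, the type on which injectivity is tested.\<close>

lemma injective_sheaf_flasque:
  fixes P :: "'a::order set" and I :: "('a, 'a \<Rightarrow> int) presheaf"
  assumes I: "injective_sheaf (upper_topology P) I"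
    and V: "openin (upper_topology P) V" and V': "openin (upper_topology P) V'" and sub: "V' \<subseteq> V"
    and s: "s \<in> carrier (sections I V')"
  obtains t where "t \<in> carrier (sections I V)" and "restr I V V' t = s"
proof -
  let ?X = "upper_topology P"
  have F: "sheaf ?X I" using I by (simp add: injective_sheaf_def)
  have VP: "V \<subseteq> P" and VP': "V' \<subseteq> P" using openin_subset V V' by fastforce+
  have "restr I V' {} s = \<one>\<^bsub>sections I {}\<^esub>"
    using sheaf_restr_closed[OF F V' _ _ s, of "{}"] sheaf_sections_empty[OF F] by auto
  then obtain \<alpha> where \<alpha>: "sheaf_morphism ?X (const_sheaf ?X V') I \<alpha>"
    and \<alpha>s: "\<alpha> V' (\<lambda>x. of_bool (x \<in> V')) = s"
    using ex_morphism_const_sheaf[OF F V' _ _ s, of "{}"] by auto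
  have mono: "sheaf_mono ?X (const_sheaf ?X V') (const_sheaf ?X V) (\<lambda>U c. c)"
    unfolding sheaf_mono_def sheaf_morphism_def
  proof (intro conjI allI impI ballI homI)
    fix U c assume U: "openin ?X U" and c: "c \<in> carrier (sections (const_sheaf ?X V') U)"
    note cD = const_sheaf_memD[OF c VP' U]
    show "c \<in> carrier (sections (const_sheaf ?X V) U)"
    proof (rule const_sheaf_memI[OF VP U])
      show "c x = 0" if "x \<notin> U" for x using cD(1)[OF that] .
      show "c x = 0" if "x \<notin> V" for x using cD(2)[of x] that sub by auto
      show "c x = c z" if xz: "x \<in> U" "z \<in> U" "z \<in> V" "x \<le> z" for x z
      proof (cases "z \<in> V'")
        case True
        show ?thesis by (rule cD(3)[OF xz(1,2) True xz(4)])
      next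
        case False
        \<comment> \<open>\<open>V'\<close> is an upper set: with \<open>z\<close> outside it,
          everything below \<open>z\<close> is outside too, and both values are
          \<open>0\<close>.\<close>
        then have "x \<notin> V'" using V' xz VP unfolding openin_upper_topology by blast
        then have "c x = 0" by (rule cD(2))
        moreover have "c z = 0" using False by (rule cD(2))
        ultimately show ?thesis by simp
      qed
    qed
  qed auto
  have "sheaf ?X (const_sheaf ?X V') \<and> sheaf ?X (const_sheaf ?X V) \<and>
      sheaf_mono ?X (const_sheaf ?X V') (const_sheaf ?X V) (\<lambda>U c. c) \<and>
      sheaf_morphism ?X (const_sheaf ?X V') I \<alpha>"
    using mono \<alpha> sheaf_const_sheaf[OF VP] sheaf_const_sheaf[OF VP'] by simp
  from I[unfolded injective_sheaf_def, THEN conjunct2, THEN spec, THEN spec, THEN spec, THEN spec,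
      THEN mp, OF this]
  obtain \<beta> where \<beta>: "sheaf_morphism ?X (const_sheaf ?X V) I \<beta>"
    and \<beta>\<alpha>: "\<And>U c. openin ?X U \<Longrightarrow> c \<in> carrier (sections (const_sheaf ?X V') U) \<Longrightarrow> \<beta> U c = \<alpha> U c"
    by (elim exE conjE) (rule that, assumption, simp)
  have ind: "(\<lambda>x. of_bool (x \<in> V)) \<in> carrier (sections (const_sheaf ?X V) V)"
    and ind': "(\<lambda>x. of_bool (x \<in> V')) \<in> carrier (sections (const_sheaf ?X V') V')"
    using indicator_const_sheaf[OF V, of "{}"] indicator_const_sheaf[OF V', of "{}"] by auto
  show thesis
  proof (rule that)
    show "\<beta> V (\<lambda>x. of_bool (x \<in> V)) \<in> carrier (sections I V)"
      by (rule sheaf_morphism_closed[OF \<beta> V ind])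
    have "restr I V V' (\<beta> V (\<lambda>x. of_bool (x \<in> V))) = \<beta> V' (restr (const_sheaf ?X V) V V' (\<lambda>x. of_bool (x \<in> V)))"
      by (rule sheaf_morphism_restr[OF \<beta> V V' sub ind, symmetric])
    also have "restr (const_sheaf ?X V) V V' (\<lambda>x. of_bool (x \<in> V)) = (\<lambda>x. of_bool (x \<in> V'))"
      using sub by (auto simp: fun_eq_iff)
    also have "\<beta> V' \<dots> = s" using \<beta>\<alpha>[OF V' ind'] \<alpha>s by simp
    finally show "restr I V V' (\<beta> V (\<lambda>x. of_bool (x \<in> V))) = s" .
  qed
qed


section \<open>Relative acyclicity of complexes of flasque sheaves\<close>

text \<open>Exactness is left out: the rules for relative acyclicity rest on
  \<open>diff_diff\<close> and flasqueness. Exactness enters later, over minimal neighbourhoods,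
  where it relates the cohomology to the resolved sheaf.\<close>

locale flasque_complex =
  fixes X :: "'a topology" and I :: "('a, 'b) sheaf_complex"
  assumes sheaf_obj: "sheaf X (obj I n)"
    and morphism_diff: "sheaf_morphism X (obj I n) (obj I (n + 1)) (sdiff I n)"
    and diff_diff: "openin X U \<Longrightarrow> s \<in> carrier (sections (obj I n) U) \<Longrightarrow>
      sdiff I (n + 1) U (sdiff I n U s) = \<one>\<^bsub>sections (obj I (n + 1 + 1)) U\<^esub>"
    and flasque: "openin X U \<Longrightarrow> openin X V \<Longrightarrow> V \<subseteq> U \<Longrightarrow> s \<in> carrier (sections (obj I n) V) \<Longrightarrow>
      \<exists>t\<in>carrier (sections (obj I n) U). restr (obj I n) U V t = s"
begin

abbreviation "G n U \<equiv> sections (obj I n) U"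
abbreviation "r n U V \<equiv> restr (obj I n) U V"
abbreviation "d n U \<equiv> sdiff I n U"

lemma group_G: "openin X U \<Longrightarrow> group (G n U)"
  by (rule sheaf_group[OF sheaf_obj])

lemma r_hom: "openin X U \<Longrightarrow> openin X V \<Longrightarrow> V \<subseteq> U \<Longrightarrow> group_hom (G n U) (G n V) (r n U V)"
  by (rule sheaf_restr_group_hom[OF sheaf_obj])

lemma d_hom: "openin X U \<Longrightarrow> group_hom (G n U) (G (n + 1) U) (d n U)"
  using morphism_diff[of n] by (simp add: group_hom_def group_hom_axioms_def group_G sheaf_morphism_def)

lemma d_closed: "openin X U \<Longrightarrow> s \<in> carrier (G n U) \<Longrightarrow> d n U s \<in> carrier (G (n + 1) U)"
  by (rule group_hom.hom_closed[OF d_hom])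

lemma d_r: "openin X U \<Longrightarrow> openin X V \<Longrightarrow> V \<subseteq> U \<Longrightarrow> s \<in> carrier (G n U) \<Longrightarrow>
    d n V (r n U V s) = r (n + 1) U V (d n U s)"
  using morphism_diff[of n] by (simp add: sheaf_morphism_def)

lemma r_closed: "openin X U \<Longrightarrow> openin X V \<Longrightarrow> V \<subseteq> U \<Longrightarrow> s \<in> carrier (G n U) \<Longrightarrow>
    r n U V s \<in> carrier (G n V)"
  by (rule sheaf_restr_closed[OF sheaf_obj])

lemma r_r: "openin X U \<Longrightarrow> openin X V \<Longrightarrow> openin X W \<Longrightarrow> W \<subseteq> V \<Longrightarrow> V \<subseteq> U \<Longrightarrow> s \<in> carrier (G n U) \<Longrightarrow>
    r n V W (r n U V s) = r n U W s"
  by (rule sheaf_restr_restr[OF sheaf_obj])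

text \<open>Acyclicity of the complex of sections over \<open>V\<close> that are trivial on
  \<open>A\<close>. By flasqueness this complex is the kernel of a surjective chain map onto the
  sections over \<open>A\<close>, so the condition says that restriction from \<open>V\<close> to
  \<open>A\<close> is a quasi-isomorphism. Since \<open>n\<close> ranges over all integers, degree
  \<open>n + 1\<close> covers every degree.\<close>

definition rel_acyclic :: "'a set \<Rightarrow> 'a set \<Rightarrow> bool" where
  "rel_acyclic A V \<longleftrightarrow>
     (\<forall>n. \<forall>s\<in>carrier (G (n + 1) V). r (n + 1) V A s = \<one>\<^bsub>G (n + 1) A\<^esub> \<longrightarrow>
        d (n + 1) V s = \<one>\<^bsub>G (n + 1 + 1) V\<^esub> \<longrightarrow>
        (\<exists>t\<in>carrier (G n V). r n V A t = \<one>\<^bsub>G n A\<^esub> \<and> d n V t = s))"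

lemma rel_acyclicD:
  assumes "rel_acyclic A V" "s \<in> carrier (G (n + 1) V)" "r (n + 1) V A s = \<one>\<^bsub>G (n + 1) A\<^esub>"
    "d (n + 1) V s = \<one>\<^bsub>G (n + 1 + 1) V\<^esub>"
  obtains t where "t \<in> carrier (G n V)" "r n V A t = \<one>\<^bsub>G n A\<^esub>" "d n V t = s"
  using assms unfolding rel_acyclic_def by blast

text \<open>\<open>s\<close> is corrected by the coboundary of an extension of \<open>t\<close> to \<open>V\<close>.\<close>

lemma subtract_coboundary:
  assumes V: "openin X V" and V': "openin X V'" and sub: "V' \<subseteq> V"
    and s: "s \<in> carrier (G (n + 1) V)" and t: "t \<in> carrier (G n V')" and st: "d n V' t = r (n + 1) V V' s"
  obtains t' s' where "t' \<in> carrier (G n V)" "r n V V' t' = t"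
    "s' \<in> carrier (G (n + 1) V)" "s = s' \<otimes>\<^bsub>G (n + 1) V\<^esub> d n V t'"
    "r (n + 1) V V' s' = \<one>\<^bsub>G (n + 1) V'\<^esub>" "d (n + 1) V s' = d (n + 1) V s"
proof -
  obtain t' where t': "t' \<in> carrier (G n V)" "r n V V' t' = t"
    using flasque[OF V V' sub t] by blast
  interpret C: group "G (n + 1) V" by (rule group_G[OF V])
  interpret C': group "G (n + 1) V'" by (rule group_G[OF V'])
  interpret C2: group "G (n + 1 + 1) V" by (rule group_G[OF V])
  interpret R: group_hom "G (n + 1) V" "G (n + 1) V'" "r (n + 1) V V'" by (rule r_hom[OF V V' sub])
  interpret D: group_hom "G (n + 1) V" "G (n + 1 + 1) V" "d (n + 1) V" by (rule d_hom[OF V])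
  define c where "c = d n V t'"
  have c: "c \<in> carrier (G (n + 1) V)" unfolding c_def by (rule d_closed[OF V t'(1)])
  have rc: "r (n + 1) V V' c = r (n + 1) V V' s"
    unfolding c_def using d_r[OF V V' sub t'(1)] t'(2) st by simp
  have dc: "d (n + 1) V c = \<one>\<^bsub>G (n + 1 + 1) V\<^esub>" unfolding c_def by (rule diff_diff[OF V t'(1)])
  show ?thesis
  proof (rule that[OF t', of "s \<otimes>\<^bsub>G (n + 1) V\<^esub> inv\<^bsub>G (n + 1) V\<^esub> c"])
    show "s = s \<otimes>\<^bsub>G (n + 1) V\<^esub> inv\<^bsub>G (n + 1) V\<^esub> c \<otimes>\<^bsub>G (n + 1) V\<^esub> d n V t'"
      using s c by (simp add: C.m_assoc flip: c_def)
    show "r (n + 1) V V' (s \<otimes>\<^bsub>G (n + 1) V\<^esub> inv\<^bsub>G (n + 1) V\<^esub> c) = \<one>\<^bsub>G (n + 1) V'\<^esub>"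
      using s c rc R.hom_closed[OF s] by simp
    show "d (n + 1) V (s \<otimes>\<^bsub>G (n + 1) V\<^esub> inv\<^bsub>G (n + 1) V\<^esub> c) = d (n + 1) V s"
    proof -
      have "d (n + 1) V (s \<otimes>\<^bsub>G (n + 1) V\<^esub> inv\<^bsub>G (n + 1) V\<^esub> c) =
          d (n + 1) V s \<otimes>\<^bsub>G (n + 1 + 1) V\<^esub> inv\<^bsub>G (n + 1 + 1) V\<^esub> (d (n + 1) V c)"
        using s c by (simp only: D.hom_mult D.hom_inv C.inv_closed)
      then show ?thesis
        unfolding dc C2.inv_one C2.r_one[OF D.hom_closed[OF s]] .
    qed
  qed (use s c in simp)
qed

lemma rel_acyclic_refl:
  assumes V: "openin X V" shows "rel_acyclic V V"
  unfolding rel_acyclic_def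
proof (intro allI ballI impI)
  fix n s assume s: "s \<in> carrier (G (n + 1) V)" and "r (n + 1) V V s = \<one>\<^bsub>G (n + 1) V\<^esub>"
  then have "s = \<one>\<^bsub>G (n + 1) V\<^esub>" using sheaf_restr_id[OF sheaf_obj V s] by simp
  then show "\<exists>t\<in>carrier (G n V). r n V V t = \<one>\<^bsub>G n V\<^esub> \<and> d n V t = s"
    using group_hom.hom_one[OF d_hom[OF V]] group_hom.hom_one[OF r_hom[OF V V]]
      monoid.one_closed[OF group.is_monoid[OF group_G[OF V]]] by (intro bexI[of _ "\<one>\<^bsub>G n V\<^esub>"]) simp_all
qed

text \<open>For \<open>A \<subseteq> V' \<subseteq> V\<close> the relative sections form a short
  exact sequence whose outer terms belong to the pairs \<open>V' \<subseteq> V\<close> and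
  \<open>A \<subseteq> V'\<close>; acyclicity of both passes to the middle. Explicitly, a primitive
  over \<open>V'\<close> is extended to \<open>V\<close>, and what remains of \<open>s\<close> is
  trivial on \<open>V'\<close>.\<close>

lemma rel_acyclic_trans:
  assumes A: "openin X A" and V': "openin X V'" and V: "openin X V" and sub': "A \<subseteq> V'" and sub: "V' \<subseteq> V"
    and r1: "rel_acyclic A V'" and r2: "rel_acyclic V' V"
  shows "rel_acyclic A V"
  unfolding rel_acyclic_def
proof (intro allI ballI impI)
  fix n s assume s: "s \<in> carrier (G (n + 1) V)" and sA: "r (n + 1) V A s = \<one>\<^bsub>G (n + 1) A\<^esub>"
    and ds: "d (n + 1) V s = \<one>\<^bsub>G (n + 1 + 1) V\<^esub>"
  obtain t where t: "t \<in> carrier (G n V')" "r n V' A t = \<one>\<^bsub>G n A\<^esub>" "d n V' t = r (n + 1) V V' s"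
  proof (rule rel_acyclicD[OF r1, of "r (n + 1) V V' s" n])
    show "r (n + 1) V V' s \<in> carrier (G (n + 1) V')" by (rule r_closed[OF V V' sub s])
    show "r (n + 1) V' A (r (n + 1) V V' s) = \<one>\<^bsub>G (n + 1) A\<^esub>"
      using r_r[OF V V' A sub' sub s] sA by simp
    show "d (n + 1) V' (r (n + 1) V V' s) = \<one>\<^bsub>G (n + 1 + 1) V'\<^esub>"
      using d_r[OF V V' sub s] ds group_hom.hom_one[OF r_hom[OF V V' sub]] by simp
  qed
  obtain t' s' where t': "t' \<in> carrier (G n V)" "r n V V' t' = t"
    and s': "s' \<in> carrier (G (n + 1) V)" "s = s' \<otimes>\<^bsub>G (n + 1) V\<^esub> d n V t'"
      "r (n + 1) V V' s' = \<one>\<^bsub>G (n + 1) V'\<^esub>" "d (n + 1) V s' = d (n + 1) V s"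
    by (rule subtract_coboundary[OF V V' sub s t(1,3)])
  obtain u where u: "u \<in> carrier (G n V)" "r n V V' u = \<one>\<^bsub>G n V'\<^esub>" "d n V u = s'"
    by (rule rel_acyclicD[OF r2 s'(1,3)]) (use s'(4) ds in simp)
  interpret D: group_hom "G n V" "G (n + 1) V" "d n V" by (rule d_hom[OF V])
  interpret R: group_hom "G n V" "G n A" "r n V A" by (rule r_hom[OF V A order_trans[OF sub' sub]])
  have "r n V A u = \<one>\<^bsub>G n A\<^esub>"
    using r_r[OF V V' A sub' sub u(1)] u(2) group_hom.hom_one[OF r_hom[OF V' A sub']] by simp
  moreover have "r n V A t' = \<one>\<^bsub>G n A\<^esub>"
    using r_r[OF V V' A sub' sub t'(1)] t'(2) t(2) by simp
  ultimately show "\<exists>t\<in>carrier (G n V). r n V A t = \<one>\<^bsub>G n A\<^esub> \<and> d n V t = s"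
    using u t' s'(2) by (intro bexI[of _ "u \<otimes>\<^bsub>G n V\<^esub> t'"]) simp_all
qed

text \<open>The same short exact sequence, now with the middle and the quotient acyclic. A primitive
  \<open>t\<close> relative to \<open>A\<close> need not be trivial on \<open>V'\<close>, but it is
  a cocycle there, hence a coboundary of some \<open>u\<close> one degree lower; the coboundary of
  an extension of \<open>u\<close> is divided out.\<close>

lemma rel_acyclic_cancel:
  assumes A: "openin X A" and V': "openin X V'" and V: "openin X V" and sub': "A \<subseteq> V'" and sub: "V' \<subseteq> V"
    and r1: "rel_acyclic A V'" and r2: "rel_acyclic A V"
  shows "rel_acyclic V' V"
  unfolding rel_acyclic_def
proof (intro allI ballI impI)
  fix n s assume s: "s \<in> carrier (G (n + 1) V)" and sV': "r (n + 1) V V' s = \<one>\<^bsub>G (n + 1) V'\<^esub>"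
    and ds: "d (n + 1) V s = \<one>\<^bsub>G (n + 1 + 1) V\<^esub>"
  have sA: "r (n + 1) V A s = \<one>\<^bsub>G (n + 1) A\<^esub>"
    using r_r[OF V V' A sub' sub s] sV' group_hom.hom_one[OF r_hom[OF V' A sub']] by simp
  obtain t where t: "t \<in> carrier (G n V)" "r n V A t = \<one>\<^bsub>G n A\<^esub>" "d n V t = s"
    by (rule rel_acyclicD[OF r2 s sA ds])
  have n: "n - 1 + 1 = n" by simp
  let ?t = "r n V V' t"
  obtain u where u: "u \<in> carrier (G (n - 1) V')" "r (n - 1) V' A u = \<one>\<^bsub>G (n - 1) A\<^esub>" "d (n - 1) V' u = ?t"
  proof (rule rel_acyclicD[OF r1, of ?t "n - 1", unfolded n])
    show "?t \<in> carrier (G n V')" by (rule r_closed[OF V V' sub t(1)])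
    show "r n V' A ?t = \<one>\<^bsub>G n A\<^esub>" using r_r[OF V V' A sub' sub t(1)] t(2) by simp
    show "d n V' ?t = \<one>\<^bsub>G (n + 1) V'\<^esub>" using d_r[OF V V' sub t(1)] t(3) sV' by simp
  qed
  obtain t' where t': "t' \<in> carrier (G n V)" "r n V V' t' = \<one>\<^bsub>G n V'\<^esub>" "d n V t' = d n V t"
    by (rule subtract_coboundary[OF V V' sub, of t "n - 1" u, unfolded n]) (use t u in simp_all)
  then show "\<exists>t\<in>carrier (G n V). r n V V' t = \<one>\<^bsub>G n V'\<^esub> \<and> d n V t = s"
    using t(3) by blast
qed

text \<open>Gluing with the neutral section over \<open>V\<close> identifies the sections over
  \<open>W\<close> that are trivial on \<open>V \<inter> W\<close> with the sections over
  \<open>V \<union> W\<close> that are trivial on \<open>V\<close>.\<close>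

lemma rel_acyclic_excision:
  assumes V: "openin X V" and W: "openin X W" and r1: "rel_acyclic (V \<inter> W) W"
  shows "rel_acyclic V (V \<union> W)"
  unfolding rel_acyclic_def
proof (intro allI ballI impI)
  let ?U = "V \<union> W"
  have U: "openin X ?U" and VW: "openin X (V \<inter> W)" using V W by (simp_all add: openin_Int openin_Un)
  fix n s assume s: "s \<in> carrier (G (n + 1) ?U)" and sV: "r (n + 1) ?U V s = \<one>\<^bsub>G (n + 1) V\<^esub>"
    and ds: "d (n + 1) ?U s = \<one>\<^bsub>G (n + 1 + 1) ?U\<^esub>"
  have one: "\<one>\<^bsub>G n V\<^esub> \<in> carrier (G n V)" for n
    by (rule monoid.one_closed[OF group.is_monoid[OF group_G[OF V]]])
  obtain t where t: "t \<in> carrier (G n W)" "r n W (V \<inter> W) t = \<one>\<^bsub>G n (V \<inter> W)\<^esub>" "d n W t = r (n + 1) ?U W s"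
  proof (rule rel_acyclicD[OF r1, of "r (n + 1) ?U W s" n])
    show "r (n + 1) ?U W s \<in> carrier (G (n + 1) W)" by (rule r_closed[OF U W _ s]) simp
    have "r (n + 1) W (V \<inter> W) (r (n + 1) ?U W s) = r (n + 1) ?U (V \<inter> W) s"
      by (rule r_r[OF U W VW _ _ s]) simp_all
    also have "\<dots> = r (n + 1) V (V \<inter> W) (r (n + 1) ?U V s)"
      by (rule r_r[OF U V VW _ _ s, symmetric]) simp_all
    finally show "r (n + 1) W (V \<inter> W) (r (n + 1) ?U W s) = \<one>\<^bsub>G (n + 1) (V \<inter> W)\<^esub>"
      using sV group_hom.hom_one[OF r_hom[OF V VW inf_le1]] by simp
    show "d (n + 1) W (r (n + 1) ?U W s) = \<one>\<^bsub>G (n + 1 + 1) W\<^esub>"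
      using d_r[OF U W _ s] ds group_hom.hom_one[OF r_hom[OF U W]] by simp
  qed
  obtain t' where t': "t' \<in> carrier (G n ?U)" "r n ?U V t' = \<one>\<^bsub>G n V\<^esub>" "r n ?U W t' = t"
    by (rule sheaf_glue2[OF sheaf_obj V W one t(1)])
       (use t(2) group_hom.hom_one[OF r_hom[OF V VW inf_le1]] in simp)
  have "d n ?U t' = s"
  proof (rule sheaf_eqI2[OF sheaf_obj V W d_closed[OF U t'(1)] s])
    show "r (n + 1) ?U V (d n ?U t') = r (n + 1) ?U V s"
      using d_r[OF U V _ t'(1)] t'(2) sV group_hom.hom_one[OF d_hom[OF V]] by simp
    show "r (n + 1) ?U W (d n ?U t') = r (n + 1) ?U W s"
      using d_r[OF U W _ t'(1)] t'(3) t(3) by simp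
  qed
  with t' show "\<exists>t\<in>carrier (G n ?U). r n ?U V t = \<one>\<^bsub>G n V\<^esub> \<and> d n ?U t = s" by blast
qed

end

section \<open>A local criterion for acyclicity on finite posets\<close>

locale flasque_complex_upper = flasque_complex "upper_topology P" I
  for P :: "'a::order set" and I :: "('a, 'b) sheaf_complex" +
  assumes finite_P: "finite P"
begin

text \<open>Mayer-Vietoris for the cover of \<open>V\<close> by \<open>V - {x}\<close> and
  \<open>up P x\<close>: the induction hypothesis applies to \<open>V - {x}\<close> and to the
  intersection, so cancellation followed by excision adds the point \<open>x\<close>. Acyclicity
  relative to \<open>A\<close> thereby becomes a condition on minimal neighbourhoods.\<close>

lemma rel_acyclic_local:
  assumes A: "openin (upper_topology P) A" and V: "openin (upper_topology P) V" and sub: "A \<subseteq> V"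
    and loc: "\<And>x. x \<in> V - A \<Longrightarrow> A \<subseteq> up P x \<and> rel_acyclic A (up P x)"
  shows "rel_acyclic A V"
  using V sub loc
proof (induction "card V" arbitrary: V rule: less_induct)
  case less
  have VP: "V \<subseteq> P" using openin_subset[OF less.prems(1)] by simp
  then have fin: "finite V" using finite_P finite_subset by blast
  show ?case
  proof (cases "V = A")
    case True
    then show ?thesis using rel_acyclic_refl[OF A] by simp
  next
    case False
    then have "V - A \<noteq> {}" "finite (V - A)" using less.prems(2) fin by auto
    then obtain x where x: "x \<in> V - A" and min: "\<And>z. z \<in> V - A \<Longrightarrow> z \<le> x \<Longrightarrow> z = x"
      using finite_has_minimal by metis
    let ?V' = "V - {x}" and ?W = "up P x"
    \<comment> \<open>Minimality of \<open>x\<close> within \<open>V - A\<close> is enough: a point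
      of the open set \<open>A\<close> below \<open>x\<close> would force \<open>x\<close> into
      \<open>A\<close>.\<close>
    have V': "openin (upper_topology P) ?V'"
      using less.prems(1) A x min VP unfolding openin_upper_topology by (metis (no_types, lifting) Diff_iff Diff_subset empty_iff insert_iff subset_trans)
    have W: "?W \<subseteq> V" using up_subset[OF less.prems(1)] x by blast
    have xP: "x \<in> P" using x VP by auto
    have AV': "A \<subseteq> ?V'" using x less.prems(2) by auto
    have UN: "?V' \<union> ?W = V" using W up_self[OF xP] by blast
    have AW: "A \<subseteq> ?W" "rel_acyclic A ?W" using less.prems(3)[OF x] by auto
    have AW': "A \<subseteq> ?V' \<inter> ?W" using AW AV' by blast
    have W': "openin (upper_topology P) (?V' \<inter> ?W)" using V' by (simp add: openin_Int)
    have "card ?V' < card V" using x fin by (intro psubset_card_mono) auto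
    moreover have "card (?V' \<inter> ?W) \<le> card ?V'" using fin by (intro card_mono) auto
    ultimately have c: "card ?V' < card V" "card (?V' \<inter> ?W) < card V" by simp_all
    have r1: "rel_acyclic A ?V'"
      by (rule less.hyps[OF c(1) V' AV']) (use less.prems(3) in blast)
    have r2: "rel_acyclic A (?V' \<inter> ?W)"
      by (rule less.hyps[OF c(2) W' AW']) (use less.prems(3) in blast)
    have "rel_acyclic (?V' \<inter> ?W) ?W"
      by (rule rel_acyclic_cancel[OF A W' openin_up AW' inf_le2 r2 AW(2)])
    from rel_acyclic_excision[OF V' openin_up this] have "rel_acyclic ?V' V"
      unfolding UN .
    then show ?thesis
      by (rule rel_acyclic_trans[OF A V' less.prems(1) AV' Diff_subset r1])
  qed
qed

end


section \<open>Injective resolutions\<close>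

locale upper_resolution =
  fixes P :: "'a::order set" and F :: "('a, 'a \<Rightarrow> int) presheaf"
    and I :: "('a, 'a \<Rightarrow> int) sheaf_complex" and \<epsilon> :: "'a set \<Rightarrow> ('a \<Rightarrow> int) \<Rightarrow> ('a \<Rightarrow> int)"
  assumes finite_P: "finite P" and sheaf_F: "sheaf (upper_topology P) F"
    and resolution: "injective_resolution (upper_topology P) F I \<epsilon>"
begin

lemma injective_I: "injective_sheaf (upper_topology P) (obj I n)"
  using resolution by (simp add: injective_resolution_def)

lemma carrier_neg: "n < 0 \<Longrightarrow> openin (upper_topology P) U \<Longrightarrow>
    carrier (sections (obj I n) U) = {\<one>\<^bsub>sections (obj I n) U\<^esub>}"
  using resolution by (simp add: injective_resolution_def)

lemma mono_augmentation: "sheaf_mono (upper_topology P) F (obj I 0) \<epsilon>"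
  using resolution by (simp add: injective_resolution_def)

lemma morphism_augmentation: "sheaf_morphism (upper_topology P) F (obj I 0) \<epsilon>"
  using mono_augmentation by (simp add: sheaf_mono_def)

lemma exact_augmentation: "sheaf_exact (upper_topology P) F \<epsilon> (obj I 0) (sdiff I 0) (obj I (0 + 1))"
  using resolution by (simp add: injective_resolution_def)

lemma exact_diff: "0 \<le> n \<Longrightarrow>
    sheaf_exact (upper_topology P) (obj I n) (sdiff I n) (obj I (n + 1)) (sdiff I (n + 1)) (obj I (n + 1 + 1))"
  using resolution by (simp add: injective_resolution_def)

sublocale flasque_complex_upper P I
proof
  show "sheaf (upper_topology P) (obj I n)" for n
    using injective_I[of n] by (simp add: injective_sheaf_def)
  show m: "sheaf_morphism (upper_topology P) (obj I n) (obj I (n + 1)) (sdiff I n)" for n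
    using resolution by (simp add: injective_resolution_def)
  show "sdiff I (n + 1) U (sdiff I n U s) = \<one>\<^bsub>sections (obj I (n + 1 + 1)) U\<^esub>"
    if U: "openin (upper_topology P) U" and s: "s \<in> carrier (sections (obj I n) U)" for n U s
  proof (cases "0 \<le> n")
    case True
    then show ?thesis using exact_diff[OF True] U s unfolding sheaf_exact_def by simp
  next
    \<comment> \<open>In negative degrees the resolution asserts no exactness, but its groups are
      trivial, so \<open>s\<close> is neutral.\<close>
    case False
    have gr: "group (sections (obj I n) U)" for n
    proof (rule sheaf_group[OF _ U])
      show "sheaf (upper_topology P) (obj I n)" using injective_I[of n] by (simp add: injective_sheaf_def)
    qed
    have h: "sdiff I n U \<one>\<^bsub>sections (obj I n) U\<^esub> = \<one>\<^bsub>sections (obj I (n + 1)) U\<^esub>" for n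
      by (rule hom_one[OF sheaf_morphism_hom[OF m U] gr gr])
    have "s = \<one>\<^bsub>sections (obj I n) U\<^esub>" using carrier_neg[OF _ U, of n] False s by simp
    then show ?thesis by (simp only: h)
  qed
  show "\<exists>t\<in>carrier (sections (obj I n) U). restr (obj I n) U V t = s"
    if "openin (upper_topology P) U" "openin (upper_topology P) V" "V \<subseteq> U"
      "s \<in> carrier (sections (obj I n) V)" for n U V s
    by (rule injective_sheaf_flasque[OF injective_I that]) blast
qed (rule finite_P)

text \<open>Open sets over which taking sections is exact: minimal neighbourhoods, whose sections
  are stalks, and the empty set, which serves as the \<open>A\<close> of absolute
  acyclicity.\<close>

definition basic :: "'a set \<Rightarrow> bool" where
  "basic A \<longleftrightarrow> A = {} \<or> (\<exists>m\<in>P. A = up P m)"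

lemma openin_basic: "basic A \<Longrightarrow> openin (upper_topology P) A"
  by (auto simp: basic_def)

lemma group_hom_augmentation:
  "openin (upper_topology P) U \<Longrightarrow> group_hom (sections F U) (G 0 U) (\<epsilon> U)"
  by (simp add: group_hom_def group_hom_axioms_def group_G sheaf_group[OF sheaf_F]
      sheaf_morphism_hom[OF morphism_augmentation])

lemma diff_augmentation: "openin (upper_topology P) U \<Longrightarrow> c \<in> carrier (sections F U) \<Longrightarrow>
    d 0 U (\<epsilon> U c) = \<one>\<^bsub>G (0 + 1) U\<^esub>"
  using exact_augmentation unfolding sheaf_exact_def by simp

text \<open>Exactness yields a solution over some neighbourhood of \<open>x\<close> inside
  \<open>up P x\<close>, which by minimality is all of \<open>up P x\<close>.\<close>

lemma sheaf_exact_up: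
  assumes ex: "sheaf_exact (upper_topology P) A \<phi> B \<psi> C" and B: "sheaf (upper_topology P) B"
    and x: "x \<in> P" and s: "s \<in> carrier (sections B (up P x))" "\<psi> (up P x) s = \<one>\<^bsub>sections C (up P x)\<^esub>"
  obtains t where "t \<in> carrier (sections A (up P x))" "\<phi> (up P x) t = s"
proof -
  obtain V t where V: "openin (upper_topology P) V" "x \<in> V" "V \<subseteq> up P x"
    and t: "t \<in> carrier (sections A V)" "\<phi> V t = restr B (up P x) V s"
    using ex[unfolded sheaf_exact_def, THEN conjunct2, rule_format, OF openin_up s up_self[OF x]] by blast
  have "V = up P x" using V up_subset by blast
  then show thesis using that t sheaf_restr_id[OF B openin_up s(1)] by simp
qed

lemma basic_exact_diff:
  assumes A: "basic A" and n: "0 \<le> n" and s: "s \<in> carrier (G (n + 1) A)"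
    and ds: "d (n + 1) A s = \<one>\<^bsub>G (n + 1 + 1) A\<^esub>"
  obtains t where "t \<in> carrier (G n A)" "d n A t = s"
proof (cases "A = {}")
  case True
  have op: "openin (upper_topology P) {}" by simp
  have "s = \<one>\<^bsub>G (n + 1) {}\<^esub>" using sheaf_sections_empty[OF sheaf_obj] s True by blast
  then have "d n A \<one>\<^bsub>G n A\<^esub> = s" using group_hom.hom_one[OF d_hom[OF op]] True by simp
  then show thesis using that monoid.one_closed[OF group.is_monoid[OF group_G[OF op]]] True by blast
next
  case False
  then obtain m where m: "m \<in> P" "A = up P m" using A by (auto simp: basic_def)
  show thesis
    by (rule sheaf_exact_up[OF exact_diff[OF n], OF sheaf_obj m(1) s[unfolded m(2)] ds[unfolded m(2)]])
       (rule that[unfolded m(2)])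
qed

lemma basic_exact_augmentation:
  assumes A: "basic A" and s: "s \<in> carrier (G 0 A)" and ds: "d 0 A s = \<one>\<^bsub>G (0 + 1) A\<^esub>"
  obtains c where "c \<in> carrier (sections F A)" "\<epsilon> A c = s"
proof (cases "A = {}")
  case True
  have op: "openin (upper_topology P) {}" by simp
  have "s = \<one>\<^bsub>G 0 {}\<^esub>" using sheaf_sections_empty[OF sheaf_obj] s True by blast
  then have "\<epsilon> A \<one>\<^bsub>sections F A\<^esub> = s" using group_hom.hom_one[OF group_hom_augmentation[OF op]] True by simp
  then show thesis using that monoid.one_closed[OF group.is_monoid[OF sheaf_group[OF sheaf_F op]]] True by blast
next
  case False
  then obtain m where m: "m \<in> P" "A = up P m" using A by (auto simp: basic_def)
  show thesis
    by (rule sheaf_exact_up[OF exact_augmentation, OF sheaf_obj m(1) s[unfolded m(2)] ds[unfolded m(2)]])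
       (rule that[unfolded m(2)])
qed

lemma augmentation_restr: "openin (upper_topology P) U \<Longrightarrow> openin (upper_topology P) V \<Longrightarrow> V \<subseteq> U \<Longrightarrow>
    c \<in> carrier (sections F U) \<Longrightarrow> \<epsilon> V (restr F U V c) = r 0 U V (\<epsilon> U c)"
  by (rule sheaf_morphism_restr[OF morphism_augmentation])

lemma augmentation_eq_one:
  assumes U: "openin (upper_topology P) U" and c: "c \<in> carrier (sections F U)" and "\<epsilon> U c = \<one>\<^bsub>G 0 U\<^esub>"
  shows "c = \<one>\<^bsub>sections F U\<^esub>"
proof -
  interpret group_hom "sections F U" "G 0 U" "\<epsilon> U" by (rule group_hom_augmentation[OF U])
  have "inj_on (\<epsilon> U) (carrier (sections F U))" using mono_augmentation U by (simp add: sheaf_mono_def)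
  then show ?thesis using assms(3) c by (simp add: inj_on_def)
qed

text \<open>Over a basic set, \<open>I\<close> has cohomology only in degree \<open>0\<close>,
  namely the sections of \<open>F\<close>. So the cohomology of \<open>up P x\<close> relative to
  \<open>A\<close> is the kernel of the restriction map of \<open>F\<close> in degree
  \<open>0\<close> and its cokernel in degree \<open>1\<close>; \<open>inj\<close> and
  \<open>surj\<close> remove both.\<close>

lemma rel_acyclic_basic:
  assumes A: "basic A" and x: "x \<in> P" and sub: "A \<subseteq> up P x"
    and inj: "\<And>c. c \<in> carrier (sections F (up P x)) \<Longrightarrow> restr F (up P x) A c = \<one>\<^bsub>sections F A\<^esub> \<Longrightarrow>
      c = \<one>\<^bsub>sections F (up P x)\<^esub>"
    and surj: "\<And>c. c \<in> carrier (sections F A) \<Longrightarrow> \<exists>c'\<in>carrier (sections F (up P x)). restr F (up P x) A c' = c"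
  shows "rel_acyclic A (up P x)"
  unfolding rel_acyclic_def
proof (intro allI ballI impI)
  let ?U = "up P x"
  note U = openin_up[of P x] and opA = openin_basic[OF A]
  have bU: "basic ?U" using x by (auto simp: basic_def)
  fix n s assume s: "s \<in> carrier (G (n + 1) ?U)" and sA: "r (n + 1) ?U A s = \<one>\<^bsub>G (n + 1) A\<^esub>"
    and ds: "d (n + 1) ?U s = \<one>\<^bsub>G (n + 1 + 1) ?U\<^esub>"
  have one: "\<exists>t\<in>carrier (G n ?U). r n ?U A t = \<one>\<^bsub>G n A\<^esub> \<and> d n ?U t = s" if s1: "s = \<one>\<^bsub>G (n + 1) ?U\<^esub>"
  proof (rule bexI[of _ "\<one>\<^bsub>G n ?U\<^esub>"])
    show "\<one>\<^bsub>G n ?U\<^esub> \<in> carrier (G n ?U)" by (rule monoid.one_closed[OF group.is_monoid[OF group_G[OF U]]])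
    show "r n ?U A \<one>\<^bsub>G n ?U\<^esub> = \<one>\<^bsub>G n A\<^esub> \<and> d n ?U \<one>\<^bsub>G n ?U\<^esub> = s"
      unfolding s1 by (intro conjI group_hom.hom_one[OF d_hom[OF U]] group_hom.hom_one[OF r_hom[OF U opA sub]])
  qed
  \<comment> \<open>The cocycle \<open>s\<close> has degree \<open>n + 1\<close>: \<open>inj\<close>
    settles degree \<open>0\<close>, \<open>surj\<close> degree \<open>1\<close>, and exactness over
    \<open>?U\<close> and over \<open>A\<close> the higher degrees.\<close>
  consider "n + 1 < 0" | "n + 1 = 0" | "n = 0" | "0 < n" by linarith
  then show "\<exists>t\<in>carrier (G n ?U). r n ?U A t = \<one>\<^bsub>G n A\<^esub> \<and> d n ?U t = s"
  proof cases
    case 1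
    show ?thesis by (rule one) (use carrier_neg[OF 1 U] s in blast)
  next
    case 2
    show ?thesis
    proof (rule one)
      obtain c where c: "c \<in> carrier (sections F ?U)" "\<epsilon> ?U c = s"
        by (rule basic_exact_augmentation[OF bU s[unfolded 2] ds[unfolded 2]])
      have "\<epsilon> A (restr F ?U A c) = \<one>\<^bsub>G 0 A\<^esub>"
        using augmentation_restr[OF U opA sub c(1)] c(2) sA unfolding 2 by simp
      then have "restr F ?U A c = \<one>\<^bsub>sections F A\<^esub>"
        by (rule augmentation_eq_one[OF opA sheaf_restr_closed[OF sheaf_F U opA sub c(1)]])
      then have "c = \<one>\<^bsub>sections F ?U\<^esub>" by (rule inj[OF c(1)])
      then show "s = \<one>\<^bsub>G (n + 1) ?U\<^esub>"
        unfolding 2 using c(2) group_hom.hom_one[OF group_hom_augmentation[OF U]] by simp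
    qed
  next
    case 3
    obtain t where t: "t \<in> carrier (G 0 ?U)" "d 0 ?U t = s"
      by (rule basic_exact_diff[OF bU order_refl s[unfolded 3] ds[unfolded 3]])
    \<comment> \<open>The primitive \<open>t\<close> need not be trivial on \<open>A\<close>. There
      it is a cocycle of degree \<open>0\<close>, hence a section of \<open>F\<close>; extended to
      \<open>?U\<close> by \<open>surj\<close>, this section is divided out without changing the
      coboundary.\<close>
    have "d 0 A (r 0 ?U A t) = \<one>\<^bsub>G (0 + 1) A\<^esub>"
      using d_r[OF U opA sub t(1)] t(2) sA unfolding 3 by simp
    then obtain c where c: "c \<in> carrier (sections F A)" "\<epsilon> A c = r 0 ?U A t"
      by (rule basic_exact_augmentation[OF A r_closed[OF U opA sub t(1)]])
    obtain c' where c': "c' \<in> carrier (sections F ?U)" "restr F ?U A c' = c"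
      using surj[OF c(1)] by blast
    interpret E: group_hom "sections F ?U" "G 0 ?U" "\<epsilon> ?U" by (rule group_hom_augmentation[OF U])
    interpret R: group_hom "G 0 ?U" "G 0 A" "r 0 ?U A" by (rule r_hom[OF U opA sub])
    interpret D: group_hom "G 0 ?U" "G (0 + 1) ?U" "d 0 ?U" by (rule d_hom[OF U])
    define e where "e = \<epsilon> ?U c'"
    have e: "e \<in> carrier (G 0 ?U)" unfolding e_def by (rule E.hom_closed[OF c'(1)])
    have re: "r 0 ?U A e = r 0 ?U A t"
      unfolding e_def using augmentation_restr[OF U opA sub c'(1)] c' c by simp
    have de: "d 0 ?U e = \<one>\<^bsub>G (0 + 1) ?U\<^esub>" unfolding e_def by (rule diff_augmentation[OF U c'(1)])
    let ?t = "t \<otimes>\<^bsub>G 0 ?U\<^esub> inv\<^bsub>G 0 ?U\<^esub> e"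
    have "?t \<in> carrier (G 0 ?U)" using t e by simp
    moreover have "r 0 ?U A ?t = \<one>\<^bsub>G 0 A\<^esub>" using t e re R.hom_closed[OF t(1)] by simp
    moreover have "d 0 ?U ?t = s"
    proof -
      have "d 0 ?U ?t = d 0 ?U t \<otimes>\<^bsub>G (0 + 1) ?U\<^esub> inv\<^bsub>G (0 + 1) ?U\<^esub> (d 0 ?U e)"
        using t e by (simp only: D.hom_mult D.hom_inv E.H.inv_closed)
      then show ?thesis
        unfolding de D.H.inv_one using D.H.r_one[OF D.hom_closed[OF t(1)]] t(2) by simp
    qed
    ultimately show ?thesis unfolding 3 by blast
  next
    case 4
    have n: "n - 1 + 1 = n" "0 \<le> n" "0 \<le> n - 1" using 4 by simp_all
    obtain t where t: "t \<in> carrier (G n ?U)" "d n ?U t = s"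
      by (rule basic_exact_diff[OF bU n(2) s ds])
    \<comment> \<open>Over \<open>A\<close> the primitive is a cocycle of positive degree, hence a
      coboundary, and is corrected by an extension of \<open>u\<close>.\<close>
    have "d n A (r n ?U A t) = \<one>\<^bsub>G (n + 1) A\<^esub>"
      using d_r[OF U opA sub t(1)] t(2) sA by simp
    then obtain u where u: "u \<in> carrier (G (n - 1) A)" "d (n - 1) A u = r n ?U A t"
      by (rule basic_exact_diff[OF A n(3), unfolded n(1), OF r_closed[OF U opA sub t(1)]])
    obtain t' where "t' \<in> carrier (G n ?U)" "r n ?U A t' = \<one>\<^bsub>G n A\<^esub>" "d n ?U t' = d n ?U t"
      by (rule subtract_coboundary[OF U opA sub, of t "n - 1" u, unfolded n(1)]) (use t u in simp_all)
    then show ?thesis using t(2) by blast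
  qed
qed

end


section \<open>Resolutions of a sheaf concentrated at one point\<close>

locale point_resolution = upper_resolution P "const_sheaf (upper_topology P) {p}" I \<epsilon>
  for P :: "'a::order set" and p I \<epsilon> +
  assumes p_in: "p \<in> P"
begin

abbreviation "Z \<equiv> const_sheaf (upper_topology P) {p}"

text \<open>The stalk of \<open>Z\<close> at \<open>x\<close> is zero: if \<open>p\<close> lies
  above \<open>x\<close>, a section \<open>c\<close> satisfies \<open>c p = c x = 0\<close>. So
  \<open>Z\<close> has the same sections over \<open>up P x\<close> as over the empty set.\<close>

lemma rel_acyclic_empty_up:
  assumes x: "x \<in> P" and xp: "x \<noteq> p"
  shows "rel_acyclic {} (up P x)"
proof (rule rel_acyclic_basic[OF _ x])
  have sp: "{p} \<subseteq> P" using p_in by simp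
  show "c = \<one>\<^bsub>sections Z (up P x)\<^esub>" if c: "c \<in> carrier (sections Z (up P x))" for c
  proof
    note cD = const_sheaf_memD[OF c sp openin_up]
    fix z
    have "c z = 0"
    proof (cases "z = p \<and> p \<in> up P x")
      case True
      then have "c x = c p" using cD(3)[OF up_self[OF x], of p] by (simp add: up_def)
      then show ?thesis using cD(2)[of x] xp True by simp
    next
      case False
      then show ?thesis using cD(1)[of z] cD(2)[of z] by auto
    qed
    then show "c z = \<one>\<^bsub>sections Z (up P x)\<^esub> z" by simp
  qed
  show "\<exists>c'\<in>carrier (sections Z (up P x)). restr Z (up P x) {} c' = c" if "c \<in> carrier (sections Z {})" for c
  proof (rule bexI)
    show "\<one>\<^bsub>sections Z (up P x)\<^esub> \<in> carrier (sections Z (up P x))"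
      by (rule monoid.one_closed[OF group.is_monoid[OF sheaf_group[OF sheaf_F openin_up]]])
    show "restr Z (up P x) {} \<one>\<^bsub>sections Z (up P x)\<^esub> = c"
      using sheaf_sections_empty[OF sheaf_F] that by auto
  qed
qed (simp_all add: basic_def)

lemma rel_acyclic_empty:
  assumes V: "openin (upper_topology P) V" and p: "p \<notin> V"
  shows "rel_acyclic {} V"
proof (rule rel_acyclic_local[OF _ V])
  fix x assume x: "x \<in> V - {}"
  then have "x \<in> P" "x \<noteq> p" using openin_subset[OF V] p by auto
  then show "{} \<subseteq> up P x \<and> rel_acyclic {} (up P x)" using rel_acyclic_empty_up by simp
qed simp_all

end


section \<open>Acyclicity of fibres of simplicial maps\<close>

text \<open>Only \<open>b\<close> and \<open>insert a b\<close> are carried into the pair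
  \<open>{b, insert a b}\<close> by inserting \<open>a\<close>, and the next lemma says the same for
  deletion. Hence a family stable under toggling \<open>a\<close> stays stable when such a pair is
  removed.\<close>

lemma insert_toggle:
  "a \<notin> b \<Longrightarrow> insert a z = b \<or> insert a z = insert a b \<Longrightarrow> z = b \<or> z = insert a b"
  by (cases "a \<in> z") (auto simp: insert_absorb insert_ident)

lemma Diff_toggle:
  "a \<notin> b \<Longrightarrow> z - {a} = b \<or> z - {a} = insert a b \<Longrightarrow> z = b \<or> z = insert a b"
  by (cases "a \<in> z") (auto simp: insert_absorb)

text \<open>Closure under faces is asked for \<open>p\<close> alone: simplices not contained in
  \<open>p\<close> form open sets that avoid \<open>p\<close> and carry no cohomology of \<int> on
  \<open>{p}\<close>.\<close>

locale simplex_resolution = point_resolution K p I \<epsilon>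
  for K :: "'v set set" and p I \<epsilon> +
  assumes faces: "\<And>z. z \<subseteq> p \<Longrightarrow> z \<noteq> {} \<Longrightarrow> z \<in> K"
    and nonempty: "\<And>z. z \<in> K \<Longrightarrow> z \<noteq> {}"
    and finite_p: "finite p"
begin

text \<open>The pairs \<open>{z - {a}, insert a z}\<close> partition \<open>V - V'\<close>. They are removed one at a time, starting
  with maximal elements.\<close>

lemma rel_acyclic_toggle:
  assumes "openin (upper_topology K) V'" "openin (upper_topology K) V" "V' \<subseteq> V"
    and "\<And>z. z \<in> V - V' \<Longrightarrow> z \<subseteq> p \<and> card p < card z + N"
    and "\<And>z. z \<in> V - V' \<Longrightarrow> insert a z \<in> V - V' \<and> z - {a} \<in> V - V'"
  shows "rel_acyclic V' V"
  using assms
proof (induction N arbitrary: V V')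
  \<comment> \<open>\<open>N\<close> bounds the codimension in \<open>p\<close> of the simplices in
    \<open>V - V'\<close>; for \<open>N = 0\<close> there are none.\<close>
  case 0
  have "card z \<le> card p" if "z \<in> V - V'" for z
    using 0(4)[OF that] finite_p by (simp add: card_mono)
  then have "V - V' = {}" using 0(4) by (metis add.right_neutral ex_in_conv leD)
  then have "V = V'" using 0(3) by blast
  then show ?case using rel_acyclic_refl[OF 0(2)] by simp
next
  case (Suc N)
  \<comment> \<open>Two inductions are nested: \<open>outer\<close> lowers the codimension bound and
    treats simplices strictly above \<open>b\<close>; the inner one counts the elements of
    \<open>V - V'\<close> still to be removed.\<close>
  note outer = Suc.IH
  from Suc.prems show ?case
  proof (induction "card (V - V')" arbitrary: V' rule: less_induct)
    case less
    note V' = less.prems(1) and V = less.prems(2) and sub = less.prems(3)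
    have VK: "V \<subseteq> K" using openin_subset[OF V] by simp
    have fin: "finite (V - V')" using finite_P VK by (meson finite_Diff finite_subset)
    have up_V: "z' \<in> V" if "z \<in> V" "z \<subseteq> z'" "z' \<in> K" for z z'
      using V that unfolding openin_upper_topology by blast
    have up_V': "z' \<in> V'" if "z \<in> V'" "z \<subseteq> z'" "z' \<in> K" for z z'
      using V' that unfolding openin_upper_topology by blast
    show ?case
    proof (cases "V = V'")
      case True
      then show ?thesis using rel_acyclic_refl[OF V] by simp
    next
      case False
      then have "V - V' \<noteq> {}" using sub by blast
      then obtain m where m: "m \<in> V - V'" and max: "\<And>z. z \<in> V - V' \<Longrightarrow> m \<subseteq> z \<Longrightarrow> z = m"
        using finite_has_maximal[OF fin] by metis
      \<comment> \<open>Inserting \<open>a\<close> stays in \<open>V - V'\<close>, so a maximal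
        element already contains \<open>a\<close>.\<close>
      have am: "a \<in> m" using max[of "insert a m"] less.prems(5)[OF m] by blast
      define b where "b = m - {a}"
      have b: "b \<in> V - V'" using less.prems(5)[OF m] by (simp add: b_def)
      have mb: "m = insert a b" using am by (auto simp: b_def)
      have ab: "a \<notin> b" by (simp add: b_def)
      have bK: "b \<in> K" and mK: "m \<in> K" using b m VK by auto
      have mp: "m \<subseteq> p" using less.prems(4) m by auto
      \<comment> \<open>Inserting \<open>a\<close> into such a \<open>z\<close> gives an element of
        \<open>V - V'\<close> above \<open>m\<close>, hence \<open>m\<close> itself.\<close>
      have above: "z = b \<or> z = m" if "z \<in> V - V'" "b \<subseteq> z" for z
      proof -
        have "insert a z = m" using max[of "insert a z"] less.prems(5)[OF that(1)] that(2) mb by blast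
        then show ?thesis using that(2) mb ab by (cases "a \<in> z") auto
      qed
      let ?V1 = "V' \<union> {b, m}"
      have V1: "openin (upper_topology K) ?V1"
        unfolding openin_upper_topology
      proof (intro conjI ballI impI)
        show "?V1 \<subseteq> K" using sub VK b m by auto
        fix z z' assume z: "z \<in> ?V1" and z': "z' \<in> K" "z \<subseteq> z'"
        show "z' \<in> ?V1"
        proof (cases "z \<in> V'")
          case True
          then show ?thesis using up_V' z' by blast
        next
          case False
          then have "z = b \<or> z = m" using z by simp
          then have bz: "b \<subseteq> z'" and "z \<in> V" using z' mb b m by auto
          then have "z' \<in> V" using up_V z' by blast
          then show ?thesis using above[of z'] bz by blast
        qed
      qed
      have V1V: "?V1 \<subseteq> V" using sub b m by auto
      have r1: "rel_acyclic ?V1 V"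
      proof (rule less.hyps[OF _ V1 V V1V])
        show "card (V - ?V1) < card (V - V')"
          using fin m by (intro psubset_card_mono) auto
        fix z assume z: "z \<in> V - ?V1"
        then have z': "z \<in> V - V'" "z \<noteq> b" "z \<noteq> m" by auto
        show "z \<subseteq> p \<and> card p < card z + Suc N" using less.prems(4)[OF z'(1)] .
        have "insert a z \<noteq> m" "insert a z \<noteq> b" "z - {a} \<noteq> b" "z - {a} \<noteq> m"
          using insert_toggle[OF ab] Diff_toggle[OF ab] z'(2,3) unfolding mb by metis+
        then show "insert a z \<in> V - ?V1 \<and> z - {a} \<in> V - ?V1" using less.prems(5)[OF z'(1)] by simp
      qed
      \<comment> \<open>The part of \<open>up K b\<close> outside the pair, which will equal
        \<open>V' \<inter> up K b\<close>. Apart from simplices outside \<open>p\<close>, it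
        consists of the faces of \<open>p\<close> strictly above \<open>b\<close> and different from
        \<open>m\<close>, again stable under toggling \<open>a\<close>.\<close>
      define U where "U = up K b - {b, m}"
      have Uop: "openin (upper_topology K) U"
        unfolding openin_upper_topology U_def up_def
      proof (intro conjI ballI impI)
        fix z z' assume "z \<in> {z \<in> K. b \<le> z} - {b, m}" "z' \<in> K" "z \<le> z'"
        moreover then have "z' \<noteq> b" "z' \<noteq> m" using mb by auto
        ultimately show "z' \<in> {z \<in> K. b \<le> z} - {b, m}" by auto
      qed blast
      have Ub: "U \<subseteq> up K b" by (auto simp: U_def)
      let ?O = "{z \<in> U. \<not> z \<subseteq> p}"
      have e: "openin (upper_topology K) {}" by simp
      have Oop: "openin (upper_topology K) ?O"
        using Uop unfolding openin_upper_topology by blast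
      have "rel_acyclic {} ?O" by (rule rel_acyclic_empty[OF Oop]) simp
      \<comment> \<open>Each \<open>z\<close> treated here has at least one vertex more than
        \<open>b\<close>, which pays for the passage from \<open>Suc N\<close> to
        \<open>N\<close>.\<close>
      moreover have "rel_acyclic ?O U"
      proof (rule outer[OF Oop Uop])
        fix z assume z: "z \<in> U - ?O"
        then have zp: "z \<subseteq> p" and bz: "b \<subset> z" and zm: "z \<noteq> m"
          by (auto simp: U_def up_def)
        have "finite z" using zp finite_p finite_subset by blast
        then have "card b < card z" using bz psubset_card_mono by blast
        moreover have "card p < card b + Suc N" using less.prems(4)[OF b] by simp
        ultimately show "z \<subseteq> p \<and> card p < card z + N" using zp by simp
        have ap: "a \<in> p" using am mp by auto
        have "insert a z \<subseteq> p" using ap zp by simp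
        moreover from this have "insert a z \<in> K" by (rule faces) simp
        moreover have "insert a z \<noteq> b" "insert a z \<noteq> m" 
          using insert_toggle[OF ab] bz zm unfolding mb by blast+
        ultimately have i: "insert a z \<in> U - ?O" using bz by (auto simp: U_def up_def)
        have "z - {a} \<subseteq> p" "b \<subseteq> z - {a}" using zp bz ab by auto
        moreover have "z - {a} \<noteq> {}" using \<open>b \<subseteq> z - {a}\<close> nonempty[OF bK] by blast
        moreover have "z - {a} \<noteq> b" "z - {a} \<noteq> m" 
          using Diff_toggle[OF ab] bz zm unfolding mb by blast+
        ultimately have "z - {a} \<in> U - ?O" using faces[of "z - {a}"] by (auto simp: U_def up_def)
        with i show "insert a z \<in> U - ?O \<and> z - {a} \<in> U - ?O" by blast
      qed blast
      ultimately have r2: "rel_acyclic {} U"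
        using rel_acyclic_trans[OF e Oop Uop] by blast
      \<comment> \<open>\<open>a\<close> lies in \<open>m \<subseteq> p\<close> but not in
        \<open>b\<close>. So \<open>Z\<close> has zero stalk at \<open>b\<close> and
        \<open>up K b\<close> has no cohomology; as \<open>U\<close> has none either, adding the
        pair to \<open>V'\<close> changes nothing.\<close>
      have "b \<noteq> p" using mb mp ab by blast
      then have "rel_acyclic {} (up K b)" by (rule rel_acyclic_empty_up[OF bK])
      then have r3: "rel_acyclic U (up K b)"
        by (rule rel_acyclic_cancel[OF e Uop openin_up empty_subsetI Ub r2])
      have "V' \<inter> up K b = U"
      proof (intro equalityI subsetI)
        fix z assume "z \<in> U"
        then have z: "z \<in> K" "b \<subseteq> z" "z \<noteq> b" "z \<noteq> m" by (auto simp: U_def up_def)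
        then have "z \<in> V" using up_V b by blast
        then have "z \<in> V'" using above[of z] z by blast
        then show "z \<in> V' \<inter> up K b" using z by (simp add: up_def)
      qed (use b m in \<open>auto simp: U_def\<close>)
      then have r4: "rel_acyclic V' (V' \<union> up K b)"
        using rel_acyclic_excision[OF V' openin_up] r3 by metis
      have "V' \<union> up K b = ?V1"
      proof (intro equalityI subsetI)
        fix z assume "z \<in> V' \<union> up K b"
        then show "z \<in> ?V1" using up_subset[OF V1, of b] by auto
      qed (use bK mK mb in \<open>auto simp: up_def\<close>)
      then have "rel_acyclic V' ?V1" using r4 by simp
      then show ?thesis by (rule rel_acyclic_trans[OF V' V1 V Un_upper1 V1V _ r1])
    qed
  qed
qed

text \<open>A face of \<open>p\<close> in the fibre other than \<open>x0\<close> has, over the image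
  of some vertex \<open>v\<close> of \<open>x0\<close>, a vertex \<open>u \<noteq> v\<close>. This
  \<open>u\<close> keeps the image unchanged when \<open>v\<close> is added or removed, so toggling
  \<open>v\<close> stays in the fibre. Injectivity of \<open>\<phi>\<close> on \<open>x0\<close>
  keeps the toggles for different vertices from interfering.\<close>

lemma rel_acyclic_fibre:
  fixes \<phi> :: "'v \<Rightarrow> 'w"
  assumes x0: "x0 \<in> K" and x0p: "x0 \<subseteq> p" and inj: "inj_on \<phi> x0"
    and V: "V = {z \<in> K. \<phi> ` x0 \<subseteq> \<phi> ` z}" and V': "V' = {z \<in> V. \<phi> ` z \<noteq> \<phi> ` x0}"
  shows "rel_acyclic V' (V - {x0})"
proof -
  have Vop: "openin (upper_topology K) V"
    unfolding openin_upper_topology V by blast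
  have V'op: "openin (upper_topology K) V'"
    unfolding openin_upper_topology V' V by blast
  \<comment> \<open>\<open>F\<close> interpolates: \<open>F {}\<close> consists of all faces of
    \<open>p\<close> in the fibre, \<open>F x0\<close> of \<open>x0\<close> alone. Enlarging
    \<open>T\<close> excludes further vertices outside \<open>x0\<close>.\<close>
  define F where "F T = {z \<in> V. \<phi> ` z = \<phi> ` x0 \<and> z \<subseteq> p \<and> (\<forall>v\<in>T. \<forall>u\<in>z. \<phi> u = \<phi> v \<longrightarrow> u = v)}" for T
  have Fop: "openin (upper_topology K) (V - F T)" for T
    unfolding openin_upper_topology
  proof (intro conjI ballI impI)
    show "V - F T \<subseteq> K" by (auto simp: V)
    fix z z' assume z: "z \<in> V - F T" and z': "z' \<in> K" "z \<subseteq> z'"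
    have "\<phi> ` x0 \<subseteq> \<phi> ` z'" using z image_mono[OF z'(2), of \<phi>] unfolding V by blast
    then have "z' \<in> V" using z' by (simp add: V)
    \<comment> \<open>\<open>F T\<close> is closed in \<open>V\<close>: a face in \<open>V\<close>
      of one of its members has image squeezed between those of \<open>x0\<close> and the
      member.\<close>
    moreover have "z \<in> F T" if z'F: "z' \<in> F T"
    proof -
      have "\<phi> ` z \<subseteq> \<phi> ` x0" using z'F image_mono[OF z'(2), of \<phi>] by (simp add: F_def)
      then have "\<phi> ` z = \<phi> ` x0" using z by (auto simp: V)
      then show ?thesis using z'F z z'(2) unfolding F_def by blast
    qed
    ultimately show "z' \<in> V - F T" using z by blast
  qed
  let ?W = "{z \<in> V. \<not> z \<subseteq> p}"
  have W: "openin (upper_topology K) ?W"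
    using Vop unfolding openin_upper_topology by blast
  have V'W: "openin (upper_topology K) (V' \<inter> ?W)" using V'op W by (rule openin_Int)
  have e: "openin (upper_topology K) {}" by simp
  \<comment> \<open>Neither open set contains \<open>p\<close>, so both have zero cohomology; this
    disposes of the simplices outside \<open>p\<close>.\<close>
  have "rel_acyclic (V' \<inter> ?W) ?W"
    by (rule rel_acyclic_cancel[OF e V'W W]) (auto intro!: rel_acyclic_empty V'W W)
  then have "rel_acyclic V' (V' \<union> ?W)" by (rule rel_acyclic_excision[OF V'op W])
  moreover have "V' \<union> ?W = V - F {}" by (auto simp: F_def V')
  ultimately have r0: "rel_acyclic V' (V - F {})" by simp
  have V'F: "V' \<subseteq> V - F T" for T by (auto simp: F_def V')
  have "rel_acyclic V' (V - F T)" if "finite T" "T \<subseteq> x0" for T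
    using that
  proof (induction T)
    case empty
    then show ?case using r0 by simp
  next
    case (insert v T)
    have sub: "V - F T \<subseteq> V - F (insert v T)" by (auto simp: F_def)
    have vx: "v \<in> x0" "v \<in> p" using insert.prems x0p by auto
    \<comment> \<open>With the codimension bound \<open>Suc (card p)\<close> the condition on
      \<open>card z\<close> holds for every \<open>z\<close>.\<close>
    have "rel_acyclic (V - F T) (V - F (insert v T))"
    proof (rule rel_acyclic_toggle[OF Fop Fop sub, of "Suc (card p)" v])
      fix z assume "z \<in> V - F (insert v T) - (V - F T)"
      then have z: "z \<in> F T" and "z \<notin> F (insert v T)" and zV: "z \<in> V" by auto
      then have zp: "z \<subseteq> p" and \<phi>z: "\<phi> ` z = \<phi> ` x0" and zT: "\<And>v u. v \<in> T \<Longrightarrow> u \<in> z \<Longrightarrow> \<phi> u = \<phi> v \<Longrightarrow> u = v"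
        by (auto simp: F_def)
      obtain u where u: "u \<in> z" "\<phi> u = \<phi> v" "u \<noteq> v"
        using z \<open>z \<notin> F (insert v T)\<close> by (auto simp: F_def)
      show "z \<subseteq> p \<and> card p < card z + Suc (card p)" using zp by simp
      \<comment> \<open>As long as \<open>u\<close> stays, \<open>z'\<close> violates the condition
        for \<open>v\<close>. The conditions for \<open>T\<close> survive the arrival of
        \<open>v\<close> because \<open>\<phi>\<close> is injective on \<open>x0\<close>.\<close>
      have *: "z' \<in> V - F (insert v T) - (V - F T)"
        if "z' \<subseteq> p" "\<phi> ` z' = \<phi> ` x0" "z' \<subseteq> insert v z" "u \<in> z'" for z'
      proof -
        have "z' \<in> K" by (rule faces) (use that in auto)
        then have zV: "z' \<in> V" using that(2) by (simp add: V)
        have "u' = v'" if u': "v' \<in> T" "u' \<in> z'" "\<phi> u' = \<phi> v'" for u' v'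
        proof (cases "u' = v")
          case True
          then show ?thesis using inj vx insert.prems u' by (auto simp: inj_on_def)
        next
          case False
          then show ?thesis using zT u' \<open>z' \<subseteq> insert v z\<close> by blast
        qed
        then have "z' \<in> F T" using zV that by (simp add: F_def)
        moreover have "z' \<notin> F (insert v T)" using u that(4) by (auto simp: F_def)
        ultimately show ?thesis using zV by blast
      qed
      have "\<phi> ` insert v z = \<phi> ` x0" using \<phi>z vx by auto
      then have "insert v z \<in> V - F (insert v T) - (V - F T)"
        by (intro *) (use zp vx u in auto)
      \<comment> \<open>After \<open>v\<close> is removed, \<open>u\<close> still maps to
        \<open>\<phi> v\<close>.\<close>
      moreover have "\<phi> ` (z - {v}) = \<phi> ` x0"
      proof -
        have "\<phi> w \<in> \<phi> ` (z - {v})" if "w \<in> z" for w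
          by (cases "w = v") (use that u in \<open>auto intro: rev_image_eqI[of u]\<close>)
        then have "\<phi> ` z \<subseteq> \<phi> ` (z - {v})" by (rule image_subsetI)
        moreover have "\<phi> ` (z - {v}) \<subseteq> \<phi> ` z" by (rule image_mono) simp
        ultimately show ?thesis using \<phi>z by simp
      qed
      then have "z - {v} \<in> V - F (insert v T) - (V - F T)"
        by (intro *) (use zp vx u in auto)
      ultimately show "insert v z \<in> V - F (insert v T) - (V - F T) \<and> z - {v} \<in> V - F (insert v T) - (V - F T)"
        by blast
    qed
    moreover have "rel_acyclic V' (V - F T)" using insert by simp
    ultimately show ?case
      using rel_acyclic_trans[OF V'op Fop Fop V'F sub] by simp
  qed
  moreover have "finite x0" using x0p finite_p finite_subset by blast
  moreover have "F x0 = {x0}"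
  proof (intro equalityI subsetI)
    fix z assume "z \<in> F x0"
    then have z: "\<phi> ` z = \<phi> ` x0" and eq: "\<And>v u. v \<in> x0 \<Longrightarrow> u \<in> z \<Longrightarrow> \<phi> u = \<phi> v \<Longrightarrow> u = v"
      by (auto simp: F_def)
    have "z \<subseteq> x0"
    proof
      fix u assume u: "u \<in> z"
      then obtain v where "v \<in> x0" "\<phi> u = \<phi> v" using z by (metis imageE imageI)
      then show "u \<in> x0" using eq u by blast
    qed
    moreover have "x0 \<subseteq> z"
    proof
      fix v assume v: "v \<in> x0"
      then obtain u where "u \<in> z" "\<phi> u = \<phi> v" using z by (metis imageE imageI)
      then show "v \<in> z" using eq v by blast
    qed
    ultimately show "z \<in> {x0}" by blast
  qed (use x0 x0p inj in \<open>auto simp: F_def V inj_on_def\<close>)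
  ultimately show ?thesis by (metis subset_refl)
qed

end


section \<open>Quasi-isomorphisms\<close>

lemma (in comm_group) coset_mult:
  assumes "subgroup H G" "x \<in> carrier G" "y \<in> carrier G"
  shows "(H #> x) <#> (H #> y) = H #> (x \<otimes> y)"
  using normal.rcos_sum[OF subgroup_imp_normal[OF assms(1)] assms(2,3)] .

lemma carrier_cohomology:
  "carrier (cohomology C n) = (\<lambda>x. coboundaries C n #>\<^bsub>grp C n\<^esub> x) ` cocycles C n"
  by (simp add: cohomology_def carrier_FactGroup r_coset_def)

lemma mult_cohomology: "monoid.mult (cohomology C n) = set_mult (grp C n)"
  by (simp add: cohomology_def set_mult_def fun_eq_iff)

locale cochain_complex =
  fixes C :: "'b cochain"
  assumes comm_group_grp: "comm_group (grp C n)"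
    and diff_hom: "diff C n \<in> hom (grp C n) (grp C (n + 1))"
    and diff_diff: "x \<in> carrier (grp C n) \<Longrightarrow> diff C (n + 1) (diff C n x) = \<one>\<^bsub>grp C (n + 1 + 1)\<^esub>"
begin

lemma group_grp: "group (grp C n)"
  using comm_group_grp comm_group.axioms(2) by blast

lemma group_hom_diff: "group_hom (grp C n) (grp C (n + 1)) (diff C n)"
  by (simp add: group_hom_def group_hom_axioms_def group_grp diff_hom)

lemma mem_cocycles: "x \<in> cocycles C n \<longleftrightarrow> x \<in> carrier (grp C n) \<and> diff C n x = \<one>\<^bsub>grp C (n + 1)\<^esub>"
  by (simp add: cocycles_def kernel_def)

lemma coboundaries_Suc: "coboundaries C (n + 1) = diff C n ` carrier (grp C n)"
  by (simp add: coboundaries_def)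

lemma subgroup_cocycles: "subgroup (cocycles C n) (grp C n)"
  unfolding cocycles_def by (rule group_hom.subgroup_kernel[OF group_hom_diff])

lemma subgroup_coboundaries: "subgroup (coboundaries C (n + 1)) (grp C (n + 1))"
  unfolding coboundaries_Suc by (rule group_hom.img_is_subgroup[OF group_hom_diff])

end

text \<open>\<open>inj\<close> and \<open>surj\<close> express bijectivity on cohomology through
  representatives. Degree \<open>n + 1\<close> is used throughout, because the coboundaries there
  are the image of the differential from degree \<open>n\<close>.\<close>

lemma quasi_isoI:
  assumes C: "cochain_complex C" and D: "cochain_complex D"
    and g: "\<And>n. g n \<in> hom (grp C n) (grp D n)"
    and chain: "\<And>n x. x \<in> carrier (grp C n) \<Longrightarrow> g (n + 1) (diff C n x) = diff D n (g n x)"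
    and inj: "\<And>n x y. x \<in> carrier (grp C (n + 1)) \<Longrightarrow> diff C (n + 1) x = \<one>\<^bsub>grp C (n + 1 + 1)\<^esub> \<Longrightarrow>
      y \<in> carrier (grp D n) \<Longrightarrow> g (n + 1) x = diff D n y \<Longrightarrow> \<exists>x'\<in>carrier (grp C n). diff C n x' = x"
    and surj: "\<And>n z. z \<in> carrier (grp D (n + 1)) \<Longrightarrow> diff D (n + 1) z = \<one>\<^bsub>grp D (n + 1 + 1)\<^esub> \<Longrightarrow>
      \<exists>x\<in>carrier (grp C (n + 1)). \<exists>y\<in>carrier (grp D n). diff C (n + 1) x = \<one>\<^bsub>grp C (n + 1 + 1)\<^esub> \<and>
        z = g (n + 1) x \<otimes>\<^bsub>grp D (n + 1)\<^esub> diff D n y"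
  shows "quasi_iso C D g"
proof -
  interpret C: cochain_complex C by (rule C)
  interpret D: cochain_complex D by (rule D)
  have "cohomology_map D g (n + 1) \<in> iso (cohomology C (n + 1)) (cohomology D (n + 1))" for n
  proof -
    let ?n = "n + 1"
    let ?BC = "coboundaries C ?n" and ?BD = "coboundaries D ?n"
    interpret GC: comm_group "grp C ?n" by (rule C.comm_group_grp)
    interpret GD: comm_group "grp D ?n" by (rule D.comm_group_grp)
    interpret g: group_hom "grp C ?n" "grp D ?n" "g ?n"
      by (simp add: group_hom_def group_hom_axioms_def GC.is_group GD.is_group g)
    interpret dD: group_hom "grp D n" "grp D ?n" "diff D n" by (rule D.group_hom_diff)
    interpret BC: subgroup ?BC "grp C ?n" by (rule C.subgroup_coboundaries)
    interpret BD: subgroup ?BD "grp D ?n" by (rule D.subgroup_coboundaries)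
    have gB: "g ?n b \<in> ?BD" if "b \<in> ?BC" for b
      using that chain g[of n] unfolding C.coboundaries_Suc D.coboundaries_Suc
      by (auto intro!: imageI hom_in_carrier)
    have gZ: "g ?n x \<in> cocycles D ?n" if "x \<in> cocycles C ?n" for x
    proof -
      have x: "x \<in> carrier (grp C ?n)" "diff C ?n x = \<one>\<^bsub>grp C (?n + 1)\<^esub>"
        using that by (simp_all only: C.mem_cocycles)
      have "diff D ?n (g ?n x) = g (?n + 1) \<one>\<^bsub>grp C (?n + 1)\<^esub>"
        using chain[OF x(1)] x(2) by simp
      also have "\<dots> = \<one>\<^bsub>grp D (?n + 1)\<^esub>" by (rule hom_one[OF g C.group_grp D.group_grp])
      finally show ?thesis using x(1) by (simp only: D.mem_cocycles g.hom_closed)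
    qed
    \<comment> \<open>The map on classes multiplies the image of a coset by all coboundaries of
      \<open>D\<close>; the result is the full coset of the image of any representative.\<close>
    have map: "cohomology_map D g ?n (?BC #>\<^bsub>grp C ?n\<^esub> x) = ?BD #>\<^bsub>grp D ?n\<^esub> g ?n x" (is "?l = ?r")
      if x: "x \<in> carrier (grp C ?n)" for x
    proof (intro equalityI subsetI)
      fix w assume "w \<in> ?l"
      then obtain b c where bc: "b \<in> ?BD" "c \<in> ?BC" "w = b \<otimes>\<^bsub>grp D ?n\<^esub> g ?n (c \<otimes>\<^bsub>grp C ?n\<^esub> x)"
        by (auto simp: cohomology_map_def set_mult_def r_coset_def)
      then have "w = (b \<otimes>\<^bsub>grp D ?n\<^esub> g ?n c) \<otimes>\<^bsub>grp D ?n\<^esub> g ?n x"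
        using x by (simp add: GD.m_assoc)
      moreover have "b \<otimes>\<^bsub>grp D ?n\<^esub> g ?n c \<in> ?BD" using bc gB by (intro BD.m_closed)
      ultimately show "w \<in> ?r" by (auto simp: r_coset_def)
    next
      fix w assume "w \<in> ?r"
      then obtain b where b: "b \<in> ?BD" "w = b \<otimes>\<^bsub>grp D ?n\<^esub> g ?n x" by (auto simp: r_coset_def)
      have "\<one>\<^bsub>grp C ?n\<^esub> \<otimes>\<^bsub>grp C ?n\<^esub> x \<in> ?BC #>\<^bsub>grp C ?n\<^esub> x"
        using BC.one_closed by (auto simp: r_coset_def)
      then have "x \<in> ?BC #>\<^bsub>grp C ?n\<^esub> x" using x by simp
      then show "w \<in> ?l" using b by (auto simp: cohomology_map_def set_mult_def)
    qed
    show ?thesis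
      unfolding iso_def bij_betw_def
    proof (intro CollectI conjI homI)
      fix c assume "c \<in> carrier (cohomology C ?n)"
      then obtain x where x: "x \<in> cocycles C ?n" "c = ?BC #>\<^bsub>grp C ?n\<^esub> x"
        unfolding carrier_cohomology by blast
      then have "cohomology_map D g ?n c = ?BD #>\<^bsub>grp D ?n\<^esub> g ?n x"
        using map by (simp only: C.mem_cocycles)
      then show "cohomology_map D g ?n c \<in> carrier (cohomology D ?n)"
        using gZ[OF x(1)] unfolding carrier_cohomology by blast
    next
      fix c c' assume "c \<in> carrier (cohomology C ?n)" "c' \<in> carrier (cohomology C ?n)"
      then obtain x x' where x: "x \<in> carrier (grp C ?n)" "c = ?BC #>\<^bsub>grp C ?n\<^esub> x"
        and x': "x' \<in> carrier (grp C ?n)" "c' = ?BC #>\<^bsub>grp C ?n\<^esub> x'"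
        unfolding carrier_cohomology C.mem_cocycles by (auto simp: C.mem_cocycles)
      have "c <#>\<^bsub>grp C ?n\<^esub> c' = ?BC #>\<^bsub>grp C ?n\<^esub> (x \<otimes>\<^bsub>grp C ?n\<^esub> x')"
        unfolding x x' by (rule GC.coset_mult[OF C.subgroup_coboundaries x(1) x'(1)])
      then have "cohomology_map D g ?n (c <#>\<^bsub>grp C ?n\<^esub> c') =
          ?BD #>\<^bsub>grp D ?n\<^esub> (g ?n x \<otimes>\<^bsub>grp D ?n\<^esub> g ?n x')"
        using map x(1) x'(1) by simp
      also have "\<dots> = cohomology_map D g ?n c <#>\<^bsub>grp D ?n\<^esub> cohomology_map D g ?n c'"
        unfolding x x' map[OF x(1)] map[OF x'(1)]
        by (rule GD.coset_mult[OF D.subgroup_coboundaries g.hom_closed[OF x(1)] g.hom_closed[OF x'(1)], symmetric])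
      finally show "cohomology_map D g ?n (c \<otimes>\<^bsub>cohomology C ?n\<^esub> c') =
          cohomology_map D g ?n c \<otimes>\<^bsub>cohomology D ?n\<^esub> cohomology_map D g ?n c'"
        by (simp only: mult_cohomology)
    next
      show "inj_on (cohomology_map D g ?n) (carrier (cohomology C ?n))"
      proof (rule inj_onI)
        fix c c' assume "c \<in> carrier (cohomology C ?n)" "c' \<in> carrier (cohomology C ?n)"
          and eq: "cohomology_map D g ?n c = cohomology_map D g ?n c'"
        then obtain x x' where xZ: "x \<in> cocycles C ?n" "x' \<in> cocycles C ?n"
          and c: "c = ?BC #>\<^bsub>grp C ?n\<^esub> x" "c' = ?BC #>\<^bsub>grp C ?n\<^esub> x'"
          unfolding carrier_cohomology by blast
        then have x: "x \<in> carrier (grp C ?n)" "x' \<in> carrier (grp C ?n)"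
          by (simp_all only: C.mem_cocycles)
        have "?BD #>\<^bsub>grp D ?n\<^esub> g ?n x = ?BD #>\<^bsub>grp D ?n\<^esub> g ?n x'"
          using eq map[OF x(1)] map[OF x(2)] c by simp
        then have "g ?n x \<in> ?BD #>\<^bsub>grp D ?n\<^esub> g ?n x'"
          using GD.rcos_self[OF g.hom_closed[OF x(1)] D.subgroup_coboundaries] by simp
        then obtain y where y: "y \<in> carrier (grp D n)" "g ?n x = diff D n y \<otimes>\<^bsub>grp D ?n\<^esub> g ?n x'"
          unfolding r_coset_def D.coboundaries_Suc by blast
        define u where "u = x \<otimes>\<^bsub>grp C ?n\<^esub> inv\<^bsub>grp C ?n\<^esub> x'"
        have uZ: "u \<in> cocycles C ?n"
          unfolding u_def using xZ subgroup.m_closed[OF C.subgroup_cocycles]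
            subgroup.m_inv_closed[OF C.subgroup_cocycles] by blast
        have "g ?n u = diff D n y"
          unfolding u_def using x y by (simp add: GD.m_assoc)
        then obtain x'' where x'': "x'' \<in> carrier (grp C n)" "diff C n x'' = u"
          using inj[of u n y] uZ y(1) unfolding C.mem_cocycles by blast
        have "u \<in> ?BC" using x'' unfolding C.coboundaries_Suc by blast
        moreover have "x = u \<otimes>\<^bsub>grp C ?n\<^esub> x'" unfolding u_def using x by (simp add: GC.m_assoc)
        ultimately have "x \<in> ?BC #>\<^bsub>grp C ?n\<^esub> x'" by (auto simp: r_coset_def)
        then show "c = c'"
          unfolding c using GC.repr_independence[OF _ x(2) C.subgroup_coboundaries] by simp
      qed
    next
      show "cohomology_map D g ?n ` carrier (cohomology C ?n) = carrier (cohomology D ?n)"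
      proof (intro equalityI subsetI)
        fix w assume "w \<in> cohomology_map D g ?n ` carrier (cohomology C ?n)"
        then obtain x where x: "x \<in> cocycles C ?n" "w = cohomology_map D g ?n (?BC #>\<^bsub>grp C ?n\<^esub> x)"
          unfolding carrier_cohomology by blast
        then have "w = ?BD #>\<^bsub>grp D ?n\<^esub> g ?n x"
          using map by (simp only: C.mem_cocycles)
        then show "w \<in> carrier (cohomology D ?n)"
          using gZ[OF x(1)] unfolding carrier_cohomology by blast
      next
        fix w assume "w \<in> carrier (cohomology D ?n)"
        then obtain z where z: "z \<in> cocycles D ?n" "w = ?BD #>\<^bsub>grp D ?n\<^esub> z"
          unfolding carrier_cohomology by blast
        obtain x y where x: "x \<in> carrier (grp C ?n)" "diff C ?n x = \<one>\<^bsub>grp C (?n + 1)\<^esub>"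
          and y: "y \<in> carrier (grp D n)" and zxy: "z = g ?n x \<otimes>\<^bsub>grp D ?n\<^esub> diff D n y"
          using surj[of z n] z(1) unfolding D.mem_cocycles by blast
        have "diff D n y \<in> ?BD" using y unfolding D.coboundaries_Suc by blast
        moreover have "z = diff D n y \<otimes>\<^bsub>grp D ?n\<^esub> g ?n x"
          unfolding zxy using x y by (simp add: GD.m_comm)
        ultimately have "z \<in> ?BD #>\<^bsub>grp D ?n\<^esub> g ?n x" by (auto simp: r_coset_def)
        then have "w = cohomology_map D g ?n (?BC #>\<^bsub>grp C ?n\<^esub> x)"
          unfolding z map[OF x(1)]
          using GD.repr_independence[OF _ g.hom_closed[OF x(1)] D.subgroup_coboundaries] by simp
        moreover have "x \<in> cocycles C ?n" using x unfolding C.mem_cocycles by blast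
        ultimately show "w \<in> cohomology_map D g ?n ` carrier (cohomology C ?n)"
          unfolding carrier_cohomology by blast
      qed
    qed
  qed
  \<comment> \<open>Every integer degree has the form \<open>n + 1\<close>.\<close>
  from this[of "_ - 1"] show ?thesis unfolding quasi_iso_def by simp
qed


section \<open>Groups of morphisms of sheaves\<close>

lemma normalise_apply:
  "openin X U \<Longrightarrow> s \<in> carrier (sections A U) \<Longrightarrow> normalise X A \<phi> U s = \<phi> U s"
  by (simp add: normalise_def)

lemma normalise_cong:
  "(\<And>U s. openin X U \<Longrightarrow> s \<in> carrier (sections A U) \<Longrightarrow> \<phi> U s = \<psi> U s) \<Longrightarrow>
    normalise X A \<phi> = normalise X A \<psi>"
  by (auto simp: normalise_def fun_eq_iff)

lemma normalise_normalise [simp]: "normalise X A (normalise X A \<phi>) = normalise X A \<phi>"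
  by (rule normalise_cong) (rule normalise_apply)

text \<open>Being a morphism depends only on values at sections over open sets, so the values
  overwritten by \<open>normalise\<close> do not matter.\<close>

lemma sheaf_morphism_cong:
  assumes A: "sheaf X A" and \<phi>: "sheaf_morphism X A B \<phi>"
    and eq: "\<And>U s. openin X U \<Longrightarrow> s \<in> carrier (sections A U) \<Longrightarrow> \<psi> U s = \<phi> U s"
  shows "sheaf_morphism X A B \<psi>"
  unfolding sheaf_morphism_def
proof (intro conjI allI impI ballI)
  show "\<psi> U \<in> hom (sections A U) (sections B U)" if U: "openin X U" for U
  proof (rule homI)
    fix s t assume s: "s \<in> carrier (sections A U)" and t: "t \<in> carrier (sections A U)"
    have "s \<otimes>\<^bsub>sections A U\<^esub> t \<in> carrier (sections A U)"
      by (rule comm_groupE(1)[OF sheaf_comm_group[OF A U] s t])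
    then show "\<psi> U (s \<otimes>\<^bsub>sections A U\<^esub> t) = \<psi> U s \<otimes>\<^bsub>sections B U\<^esub> \<psi> U t"
      using hom_mult[OF sheaf_morphism_hom[OF \<phi> U] s t] eq[OF U] s t by simp
  qed (use eq[OF U] sheaf_morphism_closed[OF \<phi> U] in simp)
  show "\<psi> V (restr A U V s) = restr B U V (\<psi> U s)"
    if "openin X U \<and> openin X V \<and> V \<subseteq> U" and s: "s \<in> carrier (sections A U)" for U V s
    using that eq sheaf_morphism_restr[OF \<phi>] sheaf_restr_closed[OF A] by simp
qed

lemma normalise_mem_hom_group:
  "sheaf X A \<Longrightarrow> sheaf_morphism X A B \<phi> \<Longrightarrow> normalise X A \<phi> \<in> carrier (hom_group X A B)"
  by (simp add: hom_group_def) (rule sheaf_morphism_cong; (assumption | rule normalise_apply); assumption)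

lemma hom_groupD: "\<phi> \<in> carrier (hom_group X A B) \<Longrightarrow> sheaf_morphism X A B \<phi>"
  by (simp add: hom_group_def)

lemma hom_group_eqI:
  assumes "\<phi> \<in> carrier (hom_group X A B)" "\<psi> \<in> carrier (hom_group X A B)"
    and "\<And>U s. openin X U \<Longrightarrow> s \<in> carrier (sections A U) \<Longrightarrow> \<phi> U s = \<psi> U s"
  shows "\<phi> = \<psi>"
proof -
  have "normalise X A \<phi> = normalise X A \<psi>" by (rule normalise_cong) (rule assms(3))
  then show ?thesis using assms(1,2) by (simp add: hom_group_def)
qed

lemma mult_hom_group_apply:
  "openin X U \<Longrightarrow> s \<in> carrier (sections A U) \<Longrightarrow>
    (\<phi> \<otimes>\<^bsub>hom_group X A B\<^esub> \<psi>) U s = \<phi> U s \<otimes>\<^bsub>sections B U\<^esub> \<psi> U s"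
  by (simp add: hom_group_def normalise_apply)

lemma one_hom_group_apply:
  "openin X U \<Longrightarrow> s \<in> carrier (sections A U) \<Longrightarrow> \<one>\<^bsub>hom_group X A B\<^esub> U s = \<one>\<^bsub>sections B U\<^esub>"
  by (simp add: hom_group_def normalise_apply)

lemma comm_group_hom_group:
  assumes A: "sheaf X A" and B: "sheaf X B"
  shows "comm_group (hom_group X A B)" (is "comm_group ?H")
proof -
  have mult: "\<phi> \<otimes>\<^bsub>?H\<^esub> \<psi> \<in> carrier ?H" if \<phi>: "\<phi> \<in> carrier ?H" and \<psi>: "\<psi> \<in> carrier ?H" for \<phi> \<psi>
  proof -
    note m = hom_groupD[OF \<phi>] hom_groupD[OF \<psi>]
    have "sheaf_morphism X A B (\<lambda>U s. \<phi> U s \<otimes>\<^bsub>sections B U\<^esub> \<psi> U s)"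
      unfolding sheaf_morphism_def
    proof (intro conjI allI impI ballI)
      show "(\<lambda>s. \<phi> U s \<otimes>\<^bsub>sections B U\<^esub> \<psi> U s) \<in> hom (sections A U) (sections B U)" if U: "openin X U" for U
        by (rule comm_group.hom_group_mult[OF sheaf_comm_group[OF B U]]) (rule sheaf_morphism_hom[OF _ U], fact m)+
      show "\<phi> V (restr A U V s) \<otimes>\<^bsub>sections B V\<^esub> \<psi> V (restr A U V s) =
          restr B U V (\<phi> U s \<otimes>\<^bsub>sections B U\<^esub> \<psi> U s)"
        if UV: "openin X U \<and> openin X V \<and> V \<subseteq> U" and s: "s \<in> carrier (sections A U)" for U V s
        using hom_mult[OF sheaf_restr_hom[OF B]] UV sheaf_morphism_restr[OF m(1)] sheaf_morphism_restr[OF m(2)]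
          sheaf_morphism_closed[OF m(1)] sheaf_morphism_closed[OF m(2)] s by simp
    qed
    then show ?thesis using normalise_mem_hom_group[OF A] by (simp add: hom_group_def)
  qed
  have one: "\<one>\<^bsub>?H\<^esub> \<in> carrier ?H"
  proof -
    have "sheaf_morphism X A B (\<lambda>U s. \<one>\<^bsub>sections B U\<^esub>)"
      unfolding sheaf_morphism_def
    proof (intro conjI allI impI ballI)
      show "(\<lambda>s. \<one>\<^bsub>sections B U\<^esub>) \<in> hom (sections A U) (sections B U)" if U: "openin X U" for U
      proof -
        interpret group "sections B U" by (rule sheaf_group[OF B U])
        show ?thesis by (rule homI) simp_all
      qed
      show "\<one>\<^bsub>sections B V\<^esub> = restr B U V \<one>\<^bsub>sections B U\<^esub>"
        if UV: "openin X U \<and> openin X V \<and> V \<subseteq> U" for U V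
        using group_hom.hom_one[OF sheaf_restr_group_hom[OF B]] UV by simp
    qed
    then show ?thesis using normalise_mem_hom_group[OF A] by (simp add: hom_group_def)
  qed
  show ?thesis
  proof (rule comm_groupI[OF mult one])
    fix \<phi> \<psi> \<theta> assume \<phi>: "\<phi> \<in> carrier ?H" and \<psi>: "\<psi> \<in> carrier ?H" and \<theta>: "\<theta> \<in> carrier ?H"
    note m = hom_groupD[OF \<phi>] hom_groupD[OF \<psi>] hom_groupD[OF \<theta>]
    show "\<phi> \<otimes>\<^bsub>?H\<^esub> \<psi> \<otimes>\<^bsub>?H\<^esub> \<theta> = \<phi> \<otimes>\<^bsub>?H\<^esub> (\<psi> \<otimes>\<^bsub>?H\<^esub> \<theta>)"
    proof (rule hom_group_eqI[where B = B])
      fix U s assume U: "openin X U" and s: "s \<in> carrier (sections A U)"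
      show "(\<phi> \<otimes>\<^bsub>?H\<^esub> \<psi> \<otimes>\<^bsub>?H\<^esub> \<theta>) U s = (\<phi> \<otimes>\<^bsub>?H\<^esub> (\<psi> \<otimes>\<^bsub>?H\<^esub> \<theta>)) U s"
        using comm_groupE(3)[OF sheaf_comm_group[OF B U]] sheaf_morphism_closed[OF m(1) U s]
          sheaf_morphism_closed[OF m(2) U s] sheaf_morphism_closed[OF m(3) U s]
        by (simp add: mult_hom_group_apply[OF U s])
    qed (intro mult \<phi> \<psi> \<theta>)+
  next
    fix \<phi> \<psi> assume \<phi>: "\<phi> \<in> carrier ?H" and \<psi>: "\<psi> \<in> carrier ?H"
    note m = hom_groupD[OF \<phi>] hom_groupD[OF \<psi>]
    show "\<phi> \<otimes>\<^bsub>?H\<^esub> \<psi> = \<psi> \<otimes>\<^bsub>?H\<^esub> \<phi>"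
    proof (rule hom_group_eqI[where B = B])
      fix U s assume U: "openin X U" and s: "s \<in> carrier (sections A U)"
      show "(\<phi> \<otimes>\<^bsub>?H\<^esub> \<psi>) U s = (\<psi> \<otimes>\<^bsub>?H\<^esub> \<phi>) U s"
        using comm_groupE(4)[OF sheaf_comm_group[OF B U]] sheaf_morphism_closed[OF m(1) U s]
          sheaf_morphism_closed[OF m(2) U s]
        by (simp add: mult_hom_group_apply[OF U s])
    qed (intro mult \<phi> \<psi>)+
  next
    fix \<phi> assume \<phi>: "\<phi> \<in> carrier ?H"
    note m = hom_groupD[OF \<phi>]
    show "\<one>\<^bsub>?H\<^esub> \<otimes>\<^bsub>?H\<^esub> \<phi> = \<phi>"
    proof (rule hom_group_eqI[where B = B])
      fix U s assume U: "openin X U" and s: "s \<in> carrier (sections A U)"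
      show "(\<one>\<^bsub>?H\<^esub> \<otimes>\<^bsub>?H\<^esub> \<phi>) U s = \<phi> U s"
        using comm_groupE(5)[OF sheaf_comm_group[OF B U]] sheaf_morphism_closed[OF m U s]
        by (simp add: mult_hom_group_apply[OF U s] one_hom_group_apply[OF U s])
    qed (intro mult one \<phi>)+
    let ?i = "\<lambda>U s. inv\<^bsub>sections B U\<^esub> (\<phi> U s)"
    have "sheaf_morphism X A B ?i"
      unfolding sheaf_morphism_def
    proof (intro conjI allI impI ballI)
      show "?i U \<in> hom (sections A U) (sections B U)" if U: "openin X U" for U
      proof -
        interpret comm_group "sections B U" by (rule sheaf_comm_group[OF B U])
        show ?thesis
          by (rule homI) (simp_all add: hom_mult[OF sheaf_morphism_hom[OF m U]] sheaf_morphism_closed[OF m U] inv_mult)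
      qed
      show "?i V (restr A U V s) = restr B U V (?i U s)"
        if UV: "openin X U \<and> openin X V \<and> V \<subseteq> U" and s: "s \<in> carrier (sections A U)" for U V s
        using group_hom.hom_inv[OF sheaf_restr_group_hom[OF B]] UV sheaf_morphism_restr[OF m]
          sheaf_morphism_closed[OF m] s by simp
    qed
    then have i: "normalise X A ?i \<in> carrier ?H" by (rule normalise_mem_hom_group[OF A])
    have "normalise X A ?i \<otimes>\<^bsub>?H\<^esub> \<phi> = \<one>\<^bsub>?H\<^esub>"
    proof (rule hom_group_eqI[where B = B])
      fix U s assume U: "openin X U" and s: "s \<in> carrier (sections A U)"
      show "(normalise X A ?i \<otimes>\<^bsub>?H\<^esub> \<phi>) U s = \<one>\<^bsub>?H\<^esub> U s"
        using group.l_inv[OF sheaf_group[OF B U]] sheaf_morphism_closed[OF m U s]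
        by (simp add: mult_hom_group_apply[OF U s] one_hom_group_apply[OF U s] normalise_apply[OF U s])
    qed (intro mult one \<phi> i)+
    then show "\<exists>\<psi>\<in>carrier ?H. \<psi> \<otimes>\<^bsub>?H\<^esub> \<phi> = \<one>\<^bsub>?H\<^esub>" using i by blast
  qed
qed

lemma cochain_complex_hom_complex:
  assumes A: "sheaf X A" and J: "\<And>n. sheaf X (obj J n)"
    and m: "\<And>n. sheaf_morphism X (obj J n) (obj J (n + 1)) (sdiff J n)"
    and dd: "\<And>n U s. openin X U \<Longrightarrow> s \<in> carrier (sections (obj J n) U) \<Longrightarrow>
      sdiff J (n + 1) U (sdiff J n U s) = \<one>\<^bsub>sections (obj J (n + 1 + 1)) U\<^esub>"
  shows "cochain_complex (hom_complex X A J)"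
proof (rule cochain_complex.intro)
  let ?H = "\<lambda>n. hom_group X A (obj J n)"
  have [simp]: "grp (hom_complex X A J) n = ?H n" for n by (simp add: hom_complex_def)
  show c: "comm_group (grp (hom_complex X A J) n)" for n
    using comm_group_hom_group[OF A J] by simp
  have cl: "diff (hom_complex X A J) n \<phi> \<in> carrier (?H (n + 1))" if \<phi>: "\<phi> \<in> carrier (?H n)" for n \<phi>
  proof -
    note mp = hom_groupD[OF \<phi>]
    have "sheaf_morphism X A (obj J (n + 1)) (\<lambda>U s. sdiff J n U (\<phi> U s))"
      unfolding sheaf_morphism_def
    proof (intro conjI allI impI ballI)
      show "(\<lambda>s. sdiff J n U (\<phi> U s)) \<in> hom (sections A U) (sections (obj J (n + 1)) U)" if U: "openin X U" for U
        using hom_compose[OF sheaf_morphism_hom[OF mp U] sheaf_morphism_hom[OF m U]] by (simp add: comp_def)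
      show "sdiff J n V (\<phi> V (restr A U V s)) = restr (obj J (n + 1)) U V (sdiff J n U (\<phi> U s))"
        if UV: "openin X U \<and> openin X V \<and> V \<subseteq> U" and s: "s \<in> carrier (sections A U)" for U V s
        using UV sheaf_morphism_restr[OF mp] sheaf_morphism_restr[OF m] sheaf_morphism_closed[OF mp] s by simp
    qed
    then show ?thesis unfolding hom_complex_def by (simp add: normalise_mem_hom_group[OF A])
  qed
  have ap: "diff (hom_complex X A J) n \<phi> U s = sdiff J n U (\<phi> U s)"
    if "openin X U" "s \<in> carrier (sections A U)" for n \<phi> U s
    using that by (simp add: hom_complex_def normalise_apply)
  show "diff (hom_complex X A J) n \<in> hom (grp (hom_complex X A J) n) (grp (hom_complex X A J) (n + 1))" for n
  proof (rule homI)
    fix \<phi> \<psi> assume "\<phi> \<in> carrier (grp (hom_complex X A J) n)" "\<psi> \<in> carrier (grp (hom_complex X A J) n)"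
    then have \<phi>: "\<phi> \<in> carrier (?H n)" and \<psi>: "\<psi> \<in> carrier (?H n)" by simp_all
    have "diff (hom_complex X A J) n (\<phi> \<otimes>\<^bsub>?H n\<^esub> \<psi>) =
      diff (hom_complex X A J) n \<phi> \<otimes>\<^bsub>?H (n + 1)\<^esub> diff (hom_complex X A J) n \<psi>"
    proof (rule hom_group_eqI)
      show "diff (hom_complex X A J) n (\<phi> \<otimes>\<^bsub>?H n\<^esub> \<psi>) \<in> carrier (?H (n + 1))"
        by (rule cl[OF comm_groupE(1)[OF comm_group_hom_group[OF A J] \<phi> \<psi>]])
      show "diff (hom_complex X A J) n \<phi> \<otimes>\<^bsub>?H (n + 1)\<^esub> diff (hom_complex X A J) n \<psi> \<in> carrier (?H (n + 1))"
        by (rule comm_groupE(1)[OF comm_group_hom_group[OF A J] cl[OF \<phi>] cl[OF \<psi>]])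
      fix U s assume U: "openin X U" and s: "s \<in> carrier (sections A U)"
      show "diff (hom_complex X A J) n (\<phi> \<otimes>\<^bsub>?H n\<^esub> \<psi>) U s =
          (diff (hom_complex X A J) n \<phi> \<otimes>\<^bsub>?H (n + 1)\<^esub> diff (hom_complex X A J) n \<psi>) U s"
        using hom_mult[OF sheaf_morphism_hom[OF m U]] sheaf_morphism_closed[OF hom_groupD[OF \<phi>] U s]
          sheaf_morphism_closed[OF hom_groupD[OF \<psi>] U s]
        by (simp add: ap[OF U s] mult_hom_group_apply[OF U s])
    qed
    then show "diff (hom_complex X A J) n (\<phi> \<otimes>\<^bsub>grp (hom_complex X A J) n\<^esub> \<psi>) =
      diff (hom_complex X A J) n \<phi> \<otimes>\<^bsub>grp (hom_complex X A J) (n + 1)\<^esub> diff (hom_complex X A J) n \<psi>"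
      by simp
  qed (use cl in simp)
  fix n \<phi> assume "\<phi> \<in> carrier (grp (hom_complex X A J) n)"
  then have \<phi>: "\<phi> \<in> carrier (?H n)" by simp
  have "diff (hom_complex X A J) (n + 1) (diff (hom_complex X A J) n \<phi>) = \<one>\<^bsub>?H (n + 1 + 1)\<^esub>"
  proof (rule hom_group_eqI[OF cl[OF cl[OF \<phi>]]])
    show "\<one>\<^bsub>?H (n + 1 + 1)\<^esub> \<in> carrier (?H (n + 1 + 1))"
      by (rule comm_groupE(2)[OF comm_group_hom_group[OF A J]])
    fix U s assume U: "openin X U" and s: "s \<in> carrier (sections A U)"
    show "diff (hom_complex X A J) (n + 1) (diff (hom_complex X A J) n \<phi>) U s = \<one>\<^bsub>?H (n + 1 + 1)\<^esub> U s"
      unfolding ap[OF U s] one_hom_group_apply[OF U s]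
      by (rule dd[OF U sheaf_morphism_closed[OF hom_groupD[OF \<phi>] U s]])
  qed
  then show "diff (hom_complex X A J) (n + 1) (diff (hom_complex X A J) n \<phi>) = \<one>\<^bsub>grp (hom_complex X A J) (n + 1 + 1)\<^esub>"
    by (simp only: \<open>\<And>n. grp (hom_complex X A J) n = ?H n\<close>)
qed


subsection \<open>Morphisms out of a skyscraper\<close>

text \<open>Minimality of \<open>q\<close> in \<open>U\<close> makes \<open>{q}\<close> closed in
  \<open>U\<close>, as the support condition demands.\<close>

lemma point_section:
  assumes "q \<in> Q" "openin (upper_topology Q) U" "q \<in> U" and min: "\<And>x. x \<in> U \<Longrightarrow> x \<le> q \<Longrightarrow> x = q"
  shows "(\<lambda>x. if x = q then k else 0) \<in> carrier (sections (const_sheaf (upper_topology Q) {q}) U)"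
  by (rule const_sheaf_memI) (use assms in auto)

lemma up_Diff_self: "q \<in> Q \<Longrightarrow> up Q q - (up Q q - {q}) = {q}"
  by (auto simp: up_def)

lemma point_section_up:
  "q \<in> Q \<Longrightarrow> (\<lambda>x. if x = q then k else 0) \<in> carrier (sections (const_sheaf (upper_topology Q) {q}) (up Q q))"
  by (rule point_section[OF _ openin_up]) (auto simp: up_def)

abbreviation point_one :: "'a \<Rightarrow> 'a \<Rightarrow> int" where
  "point_one q \<equiv> (\<lambda>x. if x = q then 1 else 0)"

text \<open>The sections over \<open>up Q q\<close> form a copy of the integers, and a homomorphism
  from the integers is fixed by its value at \<open>1\<close>.\<close>

lemma morphism_point_multiple:
  assumes F: "sheaf (upper_topology Q) F" and q: "q \<in> Q"
    and \<phi>: "sheaf_morphism (upper_topology Q) (const_sheaf (upper_topology Q) {q}) F \<phi>"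
  shows "\<phi> (up Q q) (\<lambda>x. if x = q then k else 0) =
    \<phi> (up Q q) (point_one q) [^]\<^bsub>sections F (up Q q)\<^esub> (k::int)"
proof -
  let ?Z = "const_sheaf (upper_topology Q) {q}"
  let ?h = "\<lambda>k::int. \<phi> (up Q q) (\<lambda>x. if x = q then k else 0)"
  note hm = sheaf_morphism_hom[OF \<phi> openin_up]
  have "?h \<in> hom integer_group (sections F (up Q q))"
  proof (rule homI)
    fix k l :: int
    have "(\<lambda>x. if x = q then k \<otimes>\<^bsub>integer_group\<^esub> l else 0) =
        (\<lambda>x. if x = q then k else 0) \<otimes>\<^bsub>sections ?Z (up Q q)\<^esub> (\<lambda>x. if x = q then l else 0)"
      by (auto simp: fun_eq_iff)
    then show "?h (k \<otimes>\<^bsub>integer_group\<^esub> l) = ?h k \<otimes>\<^bsub>sections F (up Q q)\<^esub> ?h l"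
      using hom_mult[OF hm point_section_up[OF q] point_section_up[OF q], of k l] by simp
  qed (rule sheaf_morphism_closed[OF \<phi> openin_up point_section_up[OF q]])
  from hom_int_pow[OF this _ group_integer_group sheaf_group[OF F openin_up], of 1 k]
  show ?thesis by (simp cong: if_cong)
qed

text \<open>At a point other than \<open>q\<close> every section of the skyscraper has zero germ, so
  only the germ at \<open>q\<close> matters, and there the generator decides.\<close>

lemma hom_point_eqI:
  assumes F: "sheaf (upper_topology Q) F" and q: "q \<in> Q"
    and \<phi>: "\<phi> \<in> carrier (hom_group (upper_topology Q) (const_sheaf (upper_topology Q) {q}) F)"
    and \<psi>: "\<psi> \<in> carrier (hom_group (upper_topology Q) (const_sheaf (upper_topology Q) {q}) F)"
    and eq: "\<phi> (up Q q) (point_one q) = \<psi> (up Q q) (point_one q)"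
  shows "\<phi> = \<psi>"
proof (rule hom_group_eqI[OF \<phi> \<psi>])
  let ?X = "upper_topology Q" and ?Z = "const_sheaf (upper_topology Q) {q}"
  have qQ: "{q} \<subseteq> Q" using q by simp
  note Z = sheaf_const_sheaf[OF qQ]
  fix U c assume U: "openin ?X U" and c: "c \<in> carrier (sections ?Z U)"
  note cD = const_sheaf_memD[OF c qQ U]
  show "\<phi> U c = \<psi> U c"
  proof (rule upper_sheaf_eqI[OF F U])
    fix x assume x: "x \<in> U"
    have sub: "up Q x \<subseteq> U" by (rule up_subset[OF U x])
    have *: "\<theta> (up Q x) (restr ?Z U (up Q x) c) = restr F U (up Q x) (\<theta> U c)"
      if "\<theta> \<in> carrier (hom_group ?X ?Z F)" for \<theta>
      by (rule sheaf_morphism_restr[OF hom_groupD[OF that] U openin_up sub c])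
    have "\<phi> (up Q x) (restr ?Z U (up Q x) c) = \<psi> (up Q x) (restr ?Z U (up Q x) c)"
    proof (cases "x = q")
      case True
      have r: "restr ?Z U (up Q q) c = (\<lambda>x. if x = q then c q else 0)"
        using cD(2) up_self[OF q] by (auto simp: fun_eq_iff)
      show ?thesis
        unfolding True r morphism_point_multiple[OF F q hom_groupD[OF \<phi>], of "c q"]
          morphism_point_multiple[OF F q hom_groupD[OF \<psi>], of "c q"] eq ..
    next
      case False
      have "c z = 0" if z: "z \<in> up Q x" for z
      proof (cases "z = q")
        case True
        then have "c x = c q" using cD(3)[OF x, of q] z sub by (auto simp: up_def)
        then show ?thesis using cD(2)[of x] False True by simp
      qed (use cD(2) in simp)
      then have "restr ?Z U (up Q x) c = \<one>\<^bsub>sections ?Z (up Q x)\<^esub>"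
        by (auto simp: fun_eq_iff)
      moreover have "\<theta> (up Q x) \<one>\<^bsub>sections ?Z (up Q x)\<^esub> = \<one>\<^bsub>sections F (up Q x)\<^esub>"
        if "\<theta> \<in> carrier (hom_group ?X ?Z F)" for \<theta>
        by (rule hom_one[OF sheaf_morphism_hom[OF hom_groupD[OF that] openin_up] sheaf_group[OF Z openin_up] sheaf_group[OF F openin_up]])
      ultimately show ?thesis using \<phi> \<psi> by metis
    qed
    then show "restr F U (up Q x) (\<phi> U c) = restr F U (up Q x) (\<psi> U c)"
      using *[OF \<phi>] *[OF \<psi>] by metis
  qed (rule sheaf_morphism_closed[OF hom_groupD[OF \<phi>] U c] sheaf_morphism_closed[OF hom_groupD[OF \<psi>] U c])+
qed

text \<open>The generator restricts to zero on \<open>W\<close>. The set \<open>U\<close> may exceed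
  \<open>up Q q\<close>, because the natural map evaluates the generator at \<open>x0\<close> over a
  whole preimage.\<close>

lemma morphism_point_vanish:
  assumes F: "sheaf (upper_topology Q) F" and q: "q \<in> Q"
    and \<phi>: "sheaf_morphism (upper_topology Q) (const_sheaf (upper_topology Q) {q}) F \<phi>"
    and U: "openin (upper_topology Q) U" and W: "openin (upper_topology Q) W" and sub: "W \<subseteq> U" and qW: "q \<notin> W"
    and one: "point_one q \<in> carrier (sections (const_sheaf (upper_topology Q) {q}) U)"
  shows "restr F U W (\<phi> U (point_one q)) = \<one>\<^bsub>sections F W\<^esub>"
proof -
  let ?Z = "const_sheaf (upper_topology Q) {q}"
  have Z: "sheaf (upper_topology Q) ?Z" using sheaf_const_sheaf[of "{q}" Q] q by simp
  have "restr F U W (\<phi> U (point_one q)) = \<phi> W (restr ?Z U W (point_one q))"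
    by (rule sheaf_morphism_restr[OF \<phi> U W sub one, symmetric])
  also have "restr ?Z U W (point_one q) = \<one>\<^bsub>sections ?Z W\<^esub>"
    using qW by (auto simp: fun_eq_iff)
  also have "\<phi> W \<one>\<^bsub>sections ?Z W\<^esub> = \<one>\<^bsub>sections F W\<^esub>"
    by (rule hom_one[OF sheaf_morphism_hom[OF \<phi> W] sheaf_group[OF Z W] sheaf_group[OF F W]])
  finally show ?thesis .
qed

text \<open>Together with \<open>hom_point_eqI\<close> this identifies morphisms out of the
  skyscraper with the sections over \<open>up Q q\<close> that are supported at
  \<open>q\<close>.\<close>

lemma ex_hom_point:
  assumes F: "sheaf (upper_topology Q) F" and q: "q \<in> Q"
    and s: "s \<in> carrier (sections F (up Q q))"
    and s0: "restr F (up Q q) (up Q q - {q}) s = \<one>\<^bsub>sections F (up Q q - {q})\<^esub>"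
  obtains \<phi> where "\<phi> \<in> carrier (hom_group (upper_topology Q) (const_sheaf (upper_topology Q) {q}) F)"
    and "\<phi> (up Q q) (point_one q) = s"
proof -
  let ?X = "upper_topology Q" and ?Z = "const_sheaf (upper_topology Q) {q}"
  have Z: "sheaf ?X ?Z" using sheaf_const_sheaf[of "{q}" Q] q by simp
  obtain \<phi> where \<phi>: "sheaf_morphism ?X ?Z F \<phi>" "\<phi> (up Q q) (\<lambda>x. of_bool (x \<in> {q})) = s"
    by (rule ex_morphism_const_sheaf[OF F openin_up openin_up_Diff Diff_subset s s0, unfolded up_Diff_self[OF q]])
  have "(\<lambda>x. of_bool (x \<in> {q})) = point_one q" by auto
  then have "normalise ?X ?Z \<phi> (up Q q) (point_one q) = s"
    using \<phi>(2) normalise_apply[OF openin_up point_section_up[OF q]] by metis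
  with normalise_mem_hom_group[OF Z \<phi>(1)] show thesis by (rule that)
qed


subsection \<open>Direct images\<close>

lemma sections_direct_image [simp]:
  "sections (direct_image X f F) V = sections F {x \<in> topspace X. f x \<in> V}"
  by (simp add: direct_image_def)

lemma restr_direct_image [simp]:
  "restr (direct_image X f F) V W = restr F {x \<in> topspace X. f x \<in> V} {x \<in> topspace X. f x \<in> W}"
  by (simp add: direct_image_def)

text \<open>Preimages commute with unions and intersections, so gluing data pull back to
  \<open>X\<close>. Distinct open sets may have equal preimages, hence the use of gluing for indexed
  families.\<close>

lemma sheaf_direct_image:
  assumes f: "continuous_map X Y f" and F: "sheaf X F"
  shows "sheaf Y (direct_image X f F)"
proof -
  define pre where "pre V = {x \<in> topspace X. f x \<in> V}" for V
  have op: "openin X (pre V)" if "openin Y V" for V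
    unfolding pre_def by (rule openin_continuous_map_preimage[OF f that])
  have mono: "pre W \<subseteq> pre V" if "W \<subseteq> V" for V W using that by (auto simp: pre_def)
  have Int: "pre (V \<inter> W) = pre V \<inter> pre W" for V W by (auto simp: pre_def)
  have Un: "pre (\<Union>\<U>) = (\<Union>U\<in>\<U>. pre U)" for \<U> by (auto simp: pre_def)
  show ?thesis
    unfolding sheaf_def sections_direct_image restr_direct_image pre_def[symmetric]
  proof (intro conjI allI impI, goal_cases)
    case (1 U)
    then show ?case by (rule sheaf_comm_group[OF F op])
  next
    case (2 U V)
    then show ?case using sheaf_restr_hom[OF F op op mono] by simp
  next
    case (3 U)
    then show ?case using sheaf_restr_id[OF F op] by simp
  next
    case (4 U V W)
    then show ?case using sheaf_restr_restr[OF F op op op mono mono] by simp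
  next
    case (5 \<U> s)
    then have o: "openin Y U" and s: "s U \<in> carrier (sections F (pre U))" if "U \<in> \<U>" for U
      using that by blast+
    have eq: "restr F (pre U) (pre U \<inter> pre V) (s U) = restr F (pre V) (pre U \<inter> pre V) (s V)"
      if "U \<in> \<U>" "V \<in> \<U>" for U V
      using 5 that unfolding Int by blast
    obtain t where "t \<in> carrier (sections F (\<Union>U\<in>\<U>. pre U))"
      "\<And>U. U \<in> \<U> \<Longrightarrow> restr F (\<Union>U\<in>\<U>. pre U) (pre U) t = s U"
    proof (rule sheaf_glue[OF F, of \<U> pre s])
      show "openin X (pre U)" if "U \<in> \<U>" for U by (rule op[OF o[OF that]])
      show "s U \<in> carrier (sections F (pre U))" if "U \<in> \<U>" for U by (rule s[OF that])
      show "restr F (pre U) (pre U \<inter> pre V) (s U) = restr F (pre V) (pre U \<inter> pre V) (s V)"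
        if "U \<in> \<U>" "V \<in> \<U>" for U V by (rule eq[OF that])
    qed (rule that)
    note t = this[folded Un]
    show ?case
    proof (rule ex1I)
      show "t \<in> carrier (sections F (pre (\<Union>\<U>))) \<and> (\<forall>U\<in>\<U>. restr F (pre (\<Union>\<U>)) (pre U) t = s U)"
        using t by simp
      fix t' assume t': "t' \<in> carrier (sections F (pre (\<Union>\<U>))) \<and> (\<forall>U\<in>\<U>. restr F (pre (\<Union>\<U>)) (pre U) t' = s U)"
      show "t' = t"
      proof (rule sheaf_eqI[OF F, of \<U> pre])
        show "openin X (pre U)" if "U \<in> \<U>" for U by (rule op[OF o[OF that]])
        show "restr F (pre (\<Union>\<U>)) (pre U) t' = restr F (pre (\<Union>\<U>)) (pre U) t" if "U \<in> \<U>" for U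
          using t'[THEN conjunct2, rule_format, OF that] t(2)[OF that] by (rule trans[OF _ sym])
      qed (use t' t(1) Un in \<open>simp_all only:\<close>)
    qed
  qed
qed

lemma sheaf_morphism_direct_image:
  assumes f: "continuous_map X Y f" and \<phi>: "sheaf_morphism X A B \<phi>"
  shows "sheaf_morphism Y (direct_image X f A) (direct_image X f B) (\<lambda>V. \<phi> {x \<in> topspace X. f x \<in> V})"
  unfolding sheaf_morphism_def sections_direct_image restr_direct_image
proof (intro conjI allI impI ballI, goal_cases)
  case (1 U)
  then show ?case by (rule sheaf_morphism_hom[OF \<phi> openin_continuous_map_preimage[OF f]])
next
  case (2 U V s)
  then have sub: "{x \<in> topspace X. f x \<in> V} \<subseteq> {x \<in> topspace X. f x \<in> U}" by auto
  show ?case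
    by (rule sheaf_morphism_restr[OF \<phi> openin_continuous_map_preimage[OF f] openin_continuous_map_preimage[OF f] sub])
       (use 2 in auto)
qed


subsection \<open>The natural map\<close>

text \<open>Evaluation at generators turns both complexes into complexes of sections over
  \<open>?V\<close>: trivial on \<open>?N\<close> for the source, on \<open>?V'\<close> for the
  target. \<open>min\<close> makes \<open>?N\<close> open. Bijectivity on cohomology is then read
  off from the acyclicity \<open>ra\<close> of the quotient by explicit corrections.\<close>

lemma quasi_iso_natural_map:
  fixes P :: "'a::order set" and Q :: "'c::order set"
  assumes res: "upper_resolution P F I \<epsilon>"
    and f: "continuous_map (upper_topology P) (upper_topology Q) f" and x0: "x0 \<in> P"
    and min: "\<And>x. x \<in> P \<Longrightarrow> f x = f x0 \<Longrightarrow> x \<le> x0 \<Longrightarrow> x = x0"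
    and ra: "flasque_complex.rel_acyclic I {x \<in> P. f x \<in> up Q (f x0) - {f x0}}
      ({x \<in> P. f x \<in> up Q (f x0)} - {x0})"
  shows "quasi_iso (hom_complex (upper_topology P) (const_sheaf (upper_topology P) {x0}) I)
    (hom_complex (upper_topology Q) (const_sheaf (upper_topology Q) {f x0})
      (direct_image_complex (upper_topology P) f I))
    (natural_map (upper_topology P) (upper_topology Q) f x0)"
proof -
  interpret upper_resolution P F I \<epsilon> by (rule res)
  let ?X = "upper_topology P" and ?Y = "upper_topology Q"
  define q where "q = f x0"
  define pre where "pre W = {x \<in> P. f x \<in> W}" for W
  let ?A = "const_sheaf ?X {x0}" and ?B = "const_sheaf ?Y {q}"
  let ?J = "direct_image_complex ?X f I"
  let ?C = "hom_complex ?X ?A I" and ?D = "hom_complex ?Y ?B ?J"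
  let ?g = "natural_map ?X ?Y f x0"
  have q: "q \<in> Q" using f x0 by (auto simp: q_def continuous_map_def)
  have qQ: "{q} \<subseteq> Q" and xP: "{x0} \<subseteq> P" using q x0 by auto
  note A = sheaf_const_sheaf[OF xP] and B = sheaf_const_sheaf[OF qQ]
  have pre_op: "openin ?X (pre W)" if "openin ?Y W" for W
    using openin_continuous_map_preimage[OF f that] by (simp add: pre_def)
  have pre_mono: "pre W' \<subseteq> pre W" if "W' \<subseteq> W" for W W' using that by (auto simp: pre_def)
  have x0_pre: "x0 \<in> pre W \<longleftrightarrow> q \<in> W" for W using x0 by (simp add: pre_def q_def)
  have obj_J: "obj ?J n = direct_image ?X f (obj I n)" for n
    by (simp add: direct_image_complex_def)
  have sec_J: "sections (obj ?J n) W = G n (pre W)" for n W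
    by (simp add: obj_J pre_def)
  have res_J: "restr (obj ?J n) W W' = r n (pre W) (pre W')" for n W W'
    by (simp add: obj_J pre_def)
  have sdiff_J: "sdiff ?J n W = d n (pre W)" for n W
    by (simp add: direct_image_complex_def pre_def)
  have J: "sheaf ?Y (obj ?J n)" for n
    unfolding obj_J by (rule sheaf_direct_image[OF f sheaf_obj])
  have mJ: "sheaf_morphism ?Y (obj ?J n) (obj ?J (n + 1)) (sdiff ?J n)" for n
    using sheaf_morphism_direct_image[OF f morphism_diff[of n]] unfolding obj_J
    by (simp add: direct_image_complex_def)
  interpret C: cochain_complex ?C
    by (rule cochain_complex_hom_complex[OF A sheaf_obj morphism_diff diff_diff])
  interpret D: cochain_complex ?D
  proof (rule cochain_complex_hom_complex[OF B J mJ])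
    show "sdiff ?J (n + 1) W (sdiff ?J n W s) = \<one>\<^bsub>sections (obj ?J (n + 1 + 1)) W\<^esub>"
      if "openin ?Y W" "s \<in> carrier (sections (obj ?J n) W)" for n W s
      using diff_diff[OF pre_op[OF that(1)]] that(2) unfolding sec_J sdiff_J by simp
  qed
  have grp_C: "grp ?C n = hom_group ?X ?A (obj I n)" for n by (simp add: hom_complex_def)
  have grp_D: "grp ?D n = hom_group ?Y ?B (obj ?J n)" for n by (simp add: hom_complex_def)
  have diff_C: "diff ?C n \<alpha> U c = d n U (\<alpha> U c)" if "openin ?X U" "c \<in> carrier (sections ?A U)" for n \<alpha> U c
    using that by (simp add: hom_complex_def normalise_apply)
  have diff_D: "diff ?D n \<beta> W c = d n (pre W) (\<beta> W c)" if "openin ?Y W" "c \<in> carrier (sections ?B W)" for n \<beta> W c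
    using that by (simp add: hom_complex_def normalise_apply sdiff_J)

  let ?V = "pre (up Q q)" and ?V' = "pre (up Q q - {q})" and ?N = "pre (up Q q) - {x0}" and ?U = "up P x0"
  have V: "openin ?X ?V" and V': "openin ?X ?V'" using pre_op by simp_all
  have f_mono: "f x \<le> f z" if "x \<in> P" "z \<in> P" "x \<le> z" for x z
    by (rule continuous_map_upper_mono[OF f that])
  have x0V: "x0 \<in> ?V" using up_self[OF q] x0_pre by simp
  \<comment> \<open>Within \<open>?V\<close> images cannot drop below \<open>q\<close>, so a point
    below \<open>x0\<close> lies in the fibre of \<open>q\<close> and \<open>min\<close>
    applies.\<close>
  have minV: "x = x0" if x: "x \<in> ?V" "x \<le> x0" for x
  proof (rule min)
    show "x \<in> P" using x by (simp add: pre_def)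
    then have "f x \<le> q" using f_mono x x0 by (simp add: q_def)
    moreover have "q \<le> f x" using x by (simp add: pre_def up_def)
    ultimately show "f x = f x0" by (simp add: q_def)
  qed (rule x(2))
  have UV: "?U \<subseteq> ?V" by (rule up_subset[OF V x0V])
  have V0: "openin ?X ?N"
    using V minV unfolding openin_upper_topology by blast
  have V0V: "?N \<subseteq> ?V" by blast
  have V'V0: "?V' \<subseteq> ?N" using x0_pre[of "up Q q - {q}"] by (auto simp: pre_def)
  have V'V: "?V' \<subseteq> ?V" using V'V0 by blast
  have U0: "openin ?X (?U - {x0})" by simp
  have U0V0: "?U - {x0} \<subseteq> ?N" using UV by blast
  have VU: "?N \<union> ?U = ?V" using UV up_self[OF x0] by blast
  have ra': "rel_acyclic ?V' ?N" using ra unfolding pre_def q_def .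
  have eV: "point_one x0 \<in> carrier (sections ?A ?V)"
    by (rule point_section[OF x0 V x0V minV])
  have eU: "point_one x0 \<in> carrier (sections ?A ?U)" by (rule point_section_up[OF x0])
  have eq: "point_one q \<in> carrier (sections ?B (up Q q))" by (rule point_section_up[OF q])
  have rV0: "r n ?V ?N (\<alpha> ?V (point_one x0)) = \<one>\<^bsub>G n ?N\<^esub>" if "\<alpha> \<in> carrier (grp ?C n)" for n \<alpha>
    by (rule morphism_point_vanish[OF sheaf_obj x0 hom_groupD[OF that[unfolded grp_C]] V V0 V0V _ eV]) simp
  have rU: "r n ?V ?U (\<alpha> ?V (point_one x0)) = \<alpha> ?U (point_one x0)" if "\<alpha> \<in> carrier (grp ?C n)" for n \<alpha>
  proof -
    have "r n ?V ?U (\<alpha> ?V (point_one x0)) = \<alpha> ?U (restr ?A ?V ?U (point_one x0))"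
      by (rule sheaf_morphism_restr[OF hom_groupD[OF that[unfolded grp_C]] V openin_up UV eV, symmetric])
    also have "restr ?A ?V ?U (point_one x0) = point_one x0"
      using up_self[OF x0] by (auto simp: fun_eq_iff)
    finally show ?thesis .
  qed
  have rV': "r n ?V ?V' (\<beta> (up Q q) (point_one q)) = \<one>\<^bsub>G n ?V'\<^esub>" if "\<beta> \<in> carrier (grp ?D n)" for n \<beta>
    using morphism_point_vanish[OF J q hom_groupD[OF that[unfolded grp_D]] openin_up openin_up_Diff Diff_subset _ eq]
    unfolding res_J sec_J by simp
  have ev_C: "\<alpha> ?V (point_one x0) \<in> carrier (G n ?V)" if "\<alpha> \<in> carrier (grp ?C n)" for n \<alpha>
    by (rule sheaf_morphism_closed[OF hom_groupD[OF that[unfolded grp_C]] V eV])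
  have ev_D: "\<beta> (up Q q) (point_one q) \<in> carrier (G n ?V)" if "\<beta> \<in> carrier (grp ?D n)" for n \<beta>
    using sheaf_morphism_closed[OF hom_groupD[OF that[unfolded grp_D]] openin_up eq] unfolding sec_J .
  have eqI_C: "\<alpha> = \<alpha>'" if "\<alpha> \<in> carrier (grp ?C n)" "\<alpha>' \<in> carrier (grp ?C n)"
    "\<alpha> ?U (point_one x0) = \<alpha>' ?U (point_one x0)" for n \<alpha> \<alpha>'
    by (rule hom_point_eqI[OF sheaf_obj x0 that[unfolded grp_C]])
  have eqI_D: "\<beta> = \<beta>'" if "\<beta> \<in> carrier (grp ?D n)" "\<beta>' \<in> carrier (grp ?D n)"
    "\<beta> (up Q q) (point_one q) = \<beta>' (up Q q) (point_one q)" for n \<beta> \<beta>'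
    by (rule hom_point_eqI[OF J q that[unfolded grp_D]])
  \<comment> \<open>\<open>ex_hom_point\<close> works over the minimal neighbourhood
    \<open>?U\<close> of \<open>x0\<close>, so the morphism comes from the restriction to
    \<open>?U\<close>. Its value over \<open>?V\<close> is recovered later from the cover of
    \<open>?V\<close> by \<open>?N\<close> and \<open>?U\<close>.\<close>
  have ex_C: "\<exists>\<alpha>\<in>carrier (grp ?C n). \<alpha> ?U (point_one x0) = r n ?V ?U s"
    if s: "s \<in> carrier (G n ?V)" "r n ?V ?N s = \<one>\<^bsub>G n ?N\<^esub>" for n s
  proof -
    have "r n ?U (?U - {x0}) (r n ?V ?U s) = r n ?N (?U - {x0}) (r n ?V ?N s)"
      using r_r[OF V openin_up U0 Diff_subset UV s(1)] r_r[OF V V0 U0 U0V0 V0V s(1)] by simp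
    also have "\<dots> = \<one>\<^bsub>G n (?U - {x0})\<^esub>"
      unfolding s(2) by (rule group_hom.hom_one[OF r_hom[OF V0 U0 U0V0]])
    finally show ?thesis
      using ex_hom_point[OF sheaf_obj x0 r_closed[OF V openin_up UV s(1)]] unfolding grp_C by metis
  qed
  have ex_D: "\<exists>\<beta>\<in>carrier (grp ?D n). \<beta> (up Q q) (point_one q) = s"
    if s: "s \<in> carrier (G n ?V)" "r n ?V ?V' s = \<one>\<^bsub>G n ?V'\<^esub>" for n s
    using ex_hom_point[OF J q, of s n] s unfolding grp_D sec_J res_J by metis

  \<comment> \<open>The unit followed by restriction to \<open>x0\<close>; only the value of
    \<open>c\<close> at \<open>q\<close> survives.\<close>
  define \<rho> where "\<rho> W c = restrict_to_point x0 (pre W) (pullback_unit ?X f W c)" for W and c :: "'c \<Rightarrow> int"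
  have \<rho>: "\<rho> W c = (\<lambda>x. if x = x0 then c q else 0)" for W c
    using x0 by (auto simp: \<rho>_def restrict_to_point_def pullback_unit_def q_def fun_eq_iff)
  have \<rho>_closed: "\<rho> W c \<in> carrier (sections ?A (pre W))"
    if W: "openin ?Y W" and c: "c \<in> carrier (sections ?B W)" for W c
    unfolding \<rho>
  proof (rule const_sheaf_memI[OF xP pre_op[OF W]])
    note cD = const_sheaf_memD[OF c qQ W]
    show "(if x = x0 then c q else 0) = 0" if "x \<notin> pre W" for x
      using that x0_pre[of W] cD(1)[of q] by auto
    show "(if x = x0 then c q else 0) = (if z = x0 then c q else 0)"
      if xz: "x \<in> pre W" "z \<in> pre W" "z \<in> {x0}" "x \<le> z" for x z
    proof (cases "x = x0")
      case False
      have "x \<in> P" "f x \<in> W" "q \<in> W" using xz x0_pre[of W] by (auto simp: pre_def)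
      moreover have "f x \<le> q" using f_mono[of x x0] xz x0 \<open>x \<in> P\<close> by (simp add: q_def)
      \<comment> \<open>By \<open>min\<close>, a point strictly below \<open>x0\<close> leaves the
        fibre. So \<open>f x\<close> lies strictly below \<open>q\<close>, and
        \<open>c q = c (f x) = 0\<close>.\<close>
      moreover have "f x \<noteq> q" using min[of x] False xz \<open>x \<in> P\<close> by (auto simp: q_def)
      ultimately have "c q = 0" using cD(3)[of "f x" q] cD(2)[of "f x"] by simp
      then show ?thesis by simp
    qed (use xz in simp)
  qed simp
  have g_apply: "?g n \<alpha> W c = \<alpha> (pre W) (\<rho> W c)" if "openin ?Y W" "c \<in> carrier (sections ?B W)"
    for n W c and \<alpha> :: "'a set \<Rightarrow> ('a \<Rightarrow> int) \<Rightarrow> ('a \<Rightarrow> int)"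
    using that by (simp add: natural_map_def adjoint_morphism_def normalise_apply \<rho>_def pre_def q_def)
  have g_closed: "?g n \<alpha> \<in> carrier (grp ?D n)" if \<alpha>: "\<alpha> \<in> carrier (grp ?C n)" for n \<alpha>
  proof -
    note m = hom_groupD[OF \<alpha>[unfolded grp_C]]
    have "sheaf_morphism ?Y ?B (obj ?J n) (\<lambda>W c. \<alpha> (pre W) (\<rho> W c))"
      unfolding sheaf_morphism_def
    proof (intro conjI allI impI ballI)
      fix W assume W: "openin ?Y W"
      show "(\<lambda>c. \<alpha> (pre W) (\<rho> W c)) \<in> hom (sections ?B W) (sections (obj ?J n) W)"
        unfolding sec_J
      proof (rule homI)
        fix c c' assume c: "c \<in> carrier (sections ?B W)" and c': "c' \<in> carrier (sections ?B W)"
        have "\<rho> W (c \<otimes>\<^bsub>sections ?B W\<^esub> c') = \<rho> W c \<otimes>\<^bsub>sections ?A (pre W)\<^esub> \<rho> W c'"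
          by (auto simp: \<rho> fun_eq_iff)
        then show "\<alpha> (pre W) (\<rho> W (c \<otimes>\<^bsub>sections ?B W\<^esub> c')) =
            \<alpha> (pre W) (\<rho> W c) \<otimes>\<^bsub>G n (pre W)\<^esub> \<alpha> (pre W) (\<rho> W c')"
          using hom_mult[OF sheaf_morphism_hom[OF m pre_op[OF W]] \<rho>_closed[OF W c] \<rho>_closed[OF W c']] by metis
      qed (rule sheaf_morphism_closed[OF m pre_op[OF W] \<rho>_closed[OF W]])
    next
      fix W W' c assume W: "openin ?Y W \<and> openin ?Y W' \<and> W' \<subseteq> W" and c: "c \<in> carrier (sections ?B W)"
      have "\<rho> W' (restr ?B W W' c) = restr ?A (pre W) (pre W') (\<rho> W c)"
        using x0_pre[of W'] by (auto simp: \<rho> fun_eq_iff)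
      then show "\<alpha> (pre W') (\<rho> W' (restr ?B W W' c)) = restr (obj ?J n) W W' (\<alpha> (pre W) (\<rho> W c))"
        using sheaf_morphism_restr[OF m pre_op pre_op pre_mono \<rho>_closed[OF _ c]] W unfolding res_J by metis
    qed
    from normalise_mem_hom_group[OF B this] show ?thesis
      unfolding natural_map_def adjoint_morphism_def \<rho>_def pre_def q_def by (simp add: hom_complex_def)
  qed
  \<comment> \<open>In terms of generators the natural map is an inclusion: it does not change the
    section over \<open>?V\<close>.\<close>
  have ev_g: "?g n \<alpha> (up Q q) (point_one q) = \<alpha> ?V (point_one x0)"
    for n and \<alpha> :: "'a set \<Rightarrow> ('a \<Rightarrow> int) \<Rightarrow> ('a \<Rightarrow> int)"
    using g_apply[OF openin_up eq, of n \<alpha>] by (simp add: \<rho> cong: if_cong)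

  show ?thesis
    unfolding q_def[symmetric]
  proof (rule quasi_isoI[OF C.cochain_complex_axioms D.cochain_complex_axioms])
    fix n
    show "?g n \<in> hom (grp ?C n) (grp ?D n)"
    proof (rule homI)
      fix \<alpha> \<alpha>' assume \<alpha>: "\<alpha> \<in> carrier (grp ?C n)" and \<alpha>': "\<alpha>' \<in> carrier (grp ?C n)"
      have \<alpha>\<alpha>: "\<alpha> \<otimes>\<^bsub>grp ?C n\<^esub> \<alpha>' \<in> carrier (grp ?C n)"
        by (rule comm_groupE(1)[OF C.comm_group_grp \<alpha> \<alpha>'])
      show "?g n (\<alpha> \<otimes>\<^bsub>grp ?C n\<^esub> \<alpha>') = ?g n \<alpha> \<otimes>\<^bsub>grp ?D n\<^esub> ?g n \<alpha>'"
      proof (rule eqI_D[OF g_closed[OF \<alpha>\<alpha>] comm_groupE(1)[OF D.comm_group_grp g_closed[OF \<alpha>] g_closed[OF \<alpha>']]])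
        show "?g n (\<alpha> \<otimes>\<^bsub>grp ?C n\<^esub> \<alpha>') (up Q q) (point_one q) =
            (?g n \<alpha> \<otimes>\<^bsub>grp ?D n\<^esub> ?g n \<alpha>') (up Q q) (point_one q)"
          unfolding grp_D mult_hom_group_apply[OF openin_up eq] ev_g
          unfolding grp_C mult_hom_group_apply[OF V eV] sec_J ..
      qed
    qed (rule g_closed)
  next
    fix n \<alpha> assume \<alpha>: "\<alpha> \<in> carrier (grp ?C n)"
    show "?g (n + 1) (diff ?C n \<alpha>) = diff ?D n (?g n \<alpha>)"
    proof (rule eqI_D[OF g_closed[OF hom_in_carrier[OF C.diff_hom \<alpha>]] hom_in_carrier[OF D.diff_hom g_closed[OF \<alpha>]]])
      show "?g (n + 1) (diff ?C n \<alpha>) (up Q q) (point_one q) = diff ?D n (?g n \<alpha>) (up Q q) (point_one q)"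
        unfolding diff_D[OF openin_up eq] ev_g diff_C[OF V eV] ..
    qed
  next
    fix n \<alpha> \<beta> assume \<alpha>: "\<alpha> \<in> carrier (grp ?C (n + 1))" and \<beta>: "\<beta> \<in> carrier (grp ?D n)"
      and eq_g: "?g (n + 1) \<alpha> = diff ?D n \<beta>"
    define t where "t = \<beta> (up Q q) (point_one q)"
    have t: "t \<in> carrier (G n ?V)" "r n ?V ?V' t = \<one>\<^bsub>G n ?V'\<^esub>"
      unfolding t_def by (rule ev_D[OF \<beta>], rule rV'[OF \<beta>])
    have dt: "d n ?V t = \<alpha> ?V (point_one x0)"
      unfolding t_def diff_D[OF openin_up eq, symmetric] eq_g[symmetric] by (rule ev_g)
    have n: "n - 1 + 1 = n" by simp
    \<comment> \<open>\<open>\<alpha>\<close> is trivial on \<open>?N\<close>, so \<open>t\<close>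
      is a cocycle there. Dividing \<open>t\<close> by the coboundary of an extension of
      \<open>u\<close> yields a primitive of \<open>\<alpha>\<close> that is itself trivial on
      \<open>?N\<close>.\<close>
    obtain u where u: "u \<in> carrier (G (n - 1) ?N)" "r (n - 1) ?N ?V' u = \<one>\<^bsub>G (n - 1) ?V'\<^esub>"
      "d (n - 1) ?N u = r n ?V ?N t"
    proof (rule rel_acyclicD[OF ra', of "r n ?V ?N t" "n - 1", unfolded n])
      show "r n ?V ?N t \<in> carrier (G n ?N)" by (rule r_closed[OF V V0 V0V t(1)])
      show "r n ?N ?V' (r n ?V ?N t) = \<one>\<^bsub>G n ?V'\<^esub>"
        using r_r[OF V V0 V' V'V0 V0V t(1)] t(2) by simp
      show "d n ?N (r n ?V ?N t) = \<one>\<^bsub>G (n + 1) ?N\<^esub>"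
        unfolding d_r[OF V V0 V0V t(1)] dt by (rule rV0[OF \<alpha>])
    qed
    obtain t' where t': "t' \<in> carrier (G n ?V)" "r n ?V ?N t' = \<one>\<^bsub>G n ?N\<^esub>" "d n ?V t' = d n ?V t"
      by (rule subtract_coboundary[OF V V0 V0V, of t "n - 1" u, unfolded n]) (use t u in simp_all)
    obtain \<alpha>' where \<alpha>': "\<alpha>' \<in> carrier (grp ?C n)" "\<alpha>' ?U (point_one x0) = r n ?V ?U t'"
      using ex_C[OF t'(1,2)] by blast
    have "diff ?C n \<alpha>' = \<alpha>"
    proof (rule eqI_C[OF hom_in_carrier[OF C.diff_hom \<alpha>'(1)] \<alpha>])
      have "diff ?C n \<alpha>' ?U (point_one x0) = d n ?U (r n ?V ?U t')"
        unfolding diff_C[OF openin_up eU] \<alpha>'(2) ..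
      also have "\<dots> = r (n + 1) ?V ?U (\<alpha> ?V (point_one x0))"
        unfolding d_r[OF V openin_up UV t'(1)] t'(3) dt ..
      also have "\<dots> = \<alpha> ?U (point_one x0)" by (rule rU[OF \<alpha>])
      finally show "diff ?C n \<alpha>' ?U (point_one x0) = \<alpha> ?U (point_one x0)" .
    qed
    then show "\<exists>x'\<in>carrier (grp ?C n). diff ?C n x' = \<alpha>" using \<alpha>'(1) by blast
  next
    fix n \<beta> assume \<beta>: "\<beta> \<in> carrier (grp ?D (n + 1))" and d\<beta>: "diff ?D (n + 1) \<beta> = \<one>\<^bsub>grp ?D (n + 1 + 1)\<^esub>"
    define s where "s = \<beta> (up Q q) (point_one q)"
    have s: "s \<in> carrier (G (n + 1) ?V)" "r (n + 1) ?V ?V' s = \<one>\<^bsub>G (n + 1) ?V'\<^esub>"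
      unfolding s_def by (rule ev_D[OF \<beta>], rule rV'[OF \<beta>])
    have ds: "d (n + 1) ?V s = \<one>\<^bsub>G (n + 1 + 1) ?V\<^esub>"
      unfolding s_def diff_D[OF openin_up eq, symmetric] d\<beta>
      unfolding grp_D one_hom_group_apply[OF openin_up eq] sec_J ..
    obtain t where t: "t \<in> carrier (G n ?N)" "r n ?N ?V' t = \<one>\<^bsub>G n ?V'\<^esub>" "d n ?N t = r (n + 1) ?V ?N s"
    proof (rule rel_acyclicD[OF ra', of "r (n + 1) ?V ?N s" n])
      show "r (n + 1) ?V ?N s \<in> carrier (G (n + 1) ?N)" by (rule r_closed[OF V V0 V0V s(1)])
      show "r (n + 1) ?N ?V' (r (n + 1) ?V ?N s) = \<one>\<^bsub>G (n + 1) ?V'\<^esub>"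
        using r_r[OF V V0 V' V'V0 V0V s(1)] s(2) by simp
      show "d (n + 1) ?N (r (n + 1) ?V ?N s) = \<one>\<^bsub>G (n + 1 + 1) ?N\<^esub>"
        unfolding d_r[OF V V0 V0V s(1)] ds by (rule group_hom.hom_one[OF r_hom[OF V V0 V0V]])
    qed
    \<comment> \<open>\<open>s\<close> splits into \<open>s'\<close>, trivial on \<open>?N\<close>
      and hence from the source, and the coboundary of \<open>t'\<close>, which is trivial on
      \<open>?V'\<close> and hence from the target.\<close>
    obtain t' s' where t': "t' \<in> carrier (G n ?V)" "r n ?V ?N t' = t"
      and s': "s' \<in> carrier (G (n + 1) ?V)" "s = s' \<otimes>\<^bsub>G (n + 1) ?V\<^esub> d n ?V t'"
        "r (n + 1) ?V ?N s' = \<one>\<^bsub>G (n + 1) ?N\<^esub>" "d (n + 1) ?V s' = d (n + 1) ?V s"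
      by (rule subtract_coboundary[OF V V0 V0V s(1) t(1,3)])
    obtain \<alpha> where \<alpha>: "\<alpha> \<in> carrier (grp ?C (n + 1))" "\<alpha> ?U (point_one x0) = r (n + 1) ?V ?U s'"
      using ex_C[OF s'(1,3)] by blast
    have "r n ?V ?V' t' = \<one>\<^bsub>G n ?V'\<^esub>"
      using r_r[OF V V0 V' V'V0 V0V t'(1)] t'(2) t(2) by simp
    then obtain \<gamma> where \<gamma>: "\<gamma> \<in> carrier (grp ?D n)" "\<gamma> (up Q q) (point_one q) = t'"
      using ex_D[OF t'(1)] by blast
    \<comment> \<open>The two sections agree on \<open>?N\<close>, where both are trivial, and on
      \<open>?U\<close> by the choice of \<open>\<alpha>\<close>.\<close>
    have \<alpha>V: "\<alpha> ?V (point_one x0) = s'"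
    proof (rule sheaf_eqI2[OF sheaf_obj[of "n + 1"] V0 openin_up[of P x0], unfolded VU, OF ev_C[OF \<alpha>(1)] s'(1)])
      show "r (n + 1) ?V ?N (\<alpha> ?V (point_one x0)) = r (n + 1) ?V ?N s'"
        unfolding s'(3) by (rule rV0[OF \<alpha>(1)])
      show "r (n + 1) ?V ?U (\<alpha> ?V (point_one x0)) = r (n + 1) ?V ?U s'"
        unfolding \<alpha>(2)[symmetric] by (rule rU[OF \<alpha>(1)])
    qed
    have "\<beta> = ?g (n + 1) \<alpha> \<otimes>\<^bsub>grp ?D (n + 1)\<^esub> diff ?D n \<gamma>"
    proof (rule eqI_D[OF \<beta> comm_groupE(1)[OF D.comm_group_grp g_closed[OF \<alpha>(1)] hom_in_carrier[OF D.diff_hom \<gamma>(1)]]])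
      show "\<beta> (up Q q) (point_one q) = (?g (n + 1) \<alpha> \<otimes>\<^bsub>grp ?D (n + 1)\<^esub> diff ?D n \<gamma>) (up Q q) (point_one q)"
        unfolding grp_D mult_hom_group_apply[OF openin_up eq] ev_g diff_D[OF openin_up eq] \<gamma>(2) \<alpha>V sec_J
          s_def[symmetric] by (rule s'(2))
    qed
    moreover have "diff ?C (n + 1) \<alpha> = \<one>\<^bsub>grp ?C (n + 1 + 1)\<^esub>"
    proof (rule eqI_C[OF hom_in_carrier[OF C.diff_hom \<alpha>(1)] comm_groupE(2)[OF C.comm_group_grp]])
      have "diff ?C (n + 1) \<alpha> ?U (point_one x0) = d (n + 1) ?U (r (n + 1) ?V ?U s')"
        unfolding diff_C[OF openin_up eU] \<alpha>(2) ..
      also have "\<dots> = \<one>\<^bsub>G (n + 1 + 1) ?U\<^esub>"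
        unfolding d_r[OF V openin_up UV s'(1)] s'(4) ds by (rule group_hom.hom_one[OF r_hom[OF V openin_up UV]])
      also have "\<dots> = \<one>\<^bsub>grp ?C (n + 1 + 1)\<^esub> ?U (point_one x0)"
        unfolding grp_C one_hom_group_apply[OF openin_up eU] ..
      finally show "diff ?C (n + 1) \<alpha> ?U (point_one x0) = \<one>\<^bsub>grp ?C (n + 1 + 1)\<^esub> ?U (point_one x0)" .
    qed
    ultimately show "\<exists>x\<in>carrier (grp ?C (n + 1)). \<exists>y\<in>carrier (grp ?D n).
        diff ?C (n + 1) x = \<one>\<^bsub>grp ?C (n + 1 + 1)\<^esub> \<and> \<beta> = ?g (n + 1) x \<otimes>\<^bsub>grp ?D (n + 1)\<^esub> diff ?D n y"
      using \<alpha>(1) \<gamma>(1) by blast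
  qed
qed


section \<open>Cohomologically trivial finite spaces\<close>

text \<open>Every nonempty open set contains \<open>m\<close>, so each stalk of the constant sheaf
  restricts bijectively to the stalk at \<open>m\<close>, and the space has the cohomology of
  \<open>up S m\<close>. There the resolution is exact, which leaves the integers in degree
  \<open>0\<close>.\<close>

lemma cohomologically_trivial_greatest:
  fixes S :: "'a::order set"
  assumes fin: "finite S" and m: "m \<in> S" and max: "\<And>x. x \<in> S \<Longrightarrow> x \<le> m"
  shows "cohomologically_trivial (upper_topology S)"
  unfolding cohomologically_trivial_def topspace_upper_topology
proof (intro allI impI)
  let ?X = "upper_topology S" and ?F = "const_sheaf (upper_topology S) S" and ?A = "up S m"
  fix I \<epsilon> assume res: "injective_resolution ?X ?F I \<epsilon>"
  interpret upper_resolution S ?F I \<epsilon>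
    by unfold_locales (use fin res sheaf_const_sheaf[of S S] in auto)
  have S: "openin ?X S" using openin_topspace[of ?X] by simp
  have bA: "basic ?A" using m by (auto simp: basic_def)
  have AS: "?A \<subseteq> S" by (auto simp: up_def)
  have A_up: "?A \<subseteq> up S x" if "x \<in> S" for x using max[OF that] by (rule up_mono)
  have const: "c z = c m" if U: "openin ?X U" and c: "c \<in> carrier (sections ?F U)" and z: "z \<in> U" for U c z
  proof -
    have zS: "z \<in> S" using z openin_subset[OF U] by auto
    have "m \<in> U" using U z max[OF zS] m unfolding openin_upper_topology by blast
    then show ?thesis using const_sheaf_memD(3)[OF c subset_refl U z _ m max[OF zS]] by simp
  qed
  have k: "(\<lambda>z. if z \<in> U then k else 0) \<in> carrier (sections ?F U)" if "openin ?X U" for U k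
    by (rule const_sheaf_memI[OF subset_refl that]) (use openin_subset[OF that] in auto)
  have mA: "m \<in> ?A" by (rule up_self[OF m])
  have ra: "rel_acyclic ?A S"
  proof (rule rel_acyclic_local[OF openin_up S AS])
    fix x assume "x \<in> S - ?A"
    then have x: "x \<in> S" by simp
    have "rel_acyclic ?A (up S x)"
    proof (rule rel_acyclic_basic[OF bA x A_up[OF x]])
      fix c assume c: "c \<in> carrier (sections ?F (up S x))" and r: "restr ?F (up S x) ?A c = \<one>\<^bsub>sections ?F ?A\<^esub>"
      have "c m = 0" using fun_cong[OF r, of m] mA by simp
      then have "c z = 0" for z
        using const[OF openin_up c, of z] const_sheaf_memD(1)[OF c subset_refl openin_up, of z] by metis
      then show "c = \<one>\<^bsub>sections ?F (up S x)\<^esub>" by auto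
    next
      fix c assume c: "c \<in> carrier (sections ?F ?A)"
      have "restr ?F (up S x) ?A (\<lambda>z. if z \<in> up S x then c m else 0) = c"
        using const[OF openin_up c] const_sheaf_memD(1)[OF c subset_refl openin_up] A_up[OF x]
        by (auto simp: fun_eq_iff)
      then show "\<exists>c'\<in>carrier (sections ?F (up S x)). restr ?F (up S x) ?A c' = c"
        using k[OF openin_up] by blast
    qed
    then show "?A \<subseteq> up S x \<and> rel_acyclic ?A (up S x)" using A_up[OF x] by simp
  qed

  let ?Z = integers_in_degree_0 and ?g = "constants_map ?X I \<epsilon>" and ?\<Gamma> = "global_sections ?X I"
  let ?C = "cone ?Z ?\<Gamma> ?g"
  define \<kappa> where "\<kappa> k z = (if z \<in> S then k else 0)" for k :: int and z
  have \<kappa>: "\<kappa> k \<in> carrier (sections ?F S)" for k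
    using k[OF S, of k] by (simp add: \<kappa>_def[abs_def])
  have g0: "?g 0 a = \<epsilon> S (\<kappa> a)" for a
    by (simp add: constants_map_def \<kappa>_def[abs_def])
  have gn: "?g n a = \<one>\<^bsub>G n S\<^esub>" if "n \<noteq> 0" for n a
    using that by (simp add: constants_map_def)
  have \<kappa>0: "\<kappa> 0 = \<one>\<^bsub>sections ?F S\<^esub>" by (auto simp: \<kappa>_def[abs_def])
  have gz: "?g n 0 = \<one>\<^bsub>G n S\<^esub>" for n
  proof (cases "n = 0")
    case True
    show ?thesis
      unfolding True g0 \<kappa>0 by (rule group_hom.hom_one[OF group_hom_augmentation[OF S]])
  qed (rule gn)
  have g_closed: "?g n a \<in> carrier (G n S)" for n a
  proof (cases "n = 0")
    case True
    then show ?thesis using group_hom.hom_closed[OF group_hom_augmentation[OF S] \<kappa>] g0 by simp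
  next
    case False
    then show ?thesis using monoid.one_closed[OF group.is_monoid[OF group_G[OF S]]] gn by simp
  qed
  have d_one: "d n S \<one>\<^bsub>G n S\<^esub> = \<one>\<^bsub>G (n + 1) S\<^esub>" for n
    by (rule group_hom.hom_one[OF d_hom[OF S]])
  have dg: "d n S (?g n a) = \<one>\<^bsub>G (n + 1) S\<^esub>" for n a
  proof (cases "n = 0")
    case True
    show ?thesis unfolding True g0 by (rule diff_augmentation[OF S \<kappa>])
  next
    case False
    show ?thesis unfolding gn[OF False] by (rule d_one)
  qed
  have Zc: "a \<in> carrier (grp ?Z n) \<longleftrightarrow> n = 0 \<or> a = 0" for a n
    by (simp add: integers_in_degree_0_def)
  have Z1: "\<one>\<^bsub>grp ?Z n\<^esub> = 0" for n by (simp add: integers_in_degree_0_def singleton_group_def)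
  have Zg: "group (grp ?Z n)" for n by (simp add: integers_in_degree_0_def)
  have Zi: "inv\<^bsub>grp ?Z n\<^esub> 0 = 0" for n using monoid.inv_one[OF group.is_monoid[OF Zg[of n]]] by (simp only: Z1)
  have cone_carrier: "(a, b) \<in> carrier (grp ?C n) \<longleftrightarrow> (n + 1 = 0 \<or> a = 0) \<and> b \<in> carrier (G n S)" for a b n
    by (simp add: cone_def Zc global_sections_def)
  \<comment> \<open>The complex of integers has zero differential, so only the second component
    remains.\<close>
  have cone_diff: "diff ?C n (a, b) = (0, ?g (n + 1) a \<otimes>\<^bsub>G (n + 1) S\<^esub> d n S b)" for n a b
    by (simp add: cone_def global_sections_def Zi integers_in_degree_0_def[THEN arg_cong[where f = diff]])
  have cone_one: "\<one>\<^bsub>grp ?C n\<^esub> = (0, \<one>\<^bsub>G n S\<^esub>)" for n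
    by (simp add: cone_def Z1 global_sections_def)
  have cocycle: "(a, b) \<in> cocycles ?C n \<longleftrightarrow> (n + 1 = 0 \<or> a = 0) \<and> b \<in> carrier (G n S) \<and>
      ?g (n + 1) a \<otimes>\<^bsub>G (n + 1) S\<^esub> d n S b = \<one>\<^bsub>G (n + 1) S\<^esub>" for a b n
    unfolding cocycles_def kernel_def by (auto simp: cone_carrier cone_diff cone_one)
  have coboundaryI: "(0, w) \<in> coboundaries ?C (n + 1)"
    if "n + 1 = 0 \<or> a = 0" "b \<in> carrier (G n S)" "w = ?g (n + 1) a \<otimes>\<^bsub>G (n + 1) S\<^esub> d n S b" for w n a b
  proof -
    have "(a, b) \<in> carrier (grp ?C n)" using that by (simp only: cone_carrier)
    then have "diff ?C n (a, b) \<in> coboundaries ?C (n + 1)" by (simp add: coboundaries_def)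
    then show ?thesis by (simp only: cone_diff that(3))
  qed
  have one: "\<one>\<^bsub>G n S\<^esub> \<in> carrier (G n S)" for n
    by (rule monoid.one_closed[OF group.is_monoid[OF group_G[OF S]]])
  have ll: "\<one>\<^bsub>G n S\<^esub> \<otimes>\<^bsub>G n S\<^esub> b = b" if "b \<in> carrier (G n S)" for n b
    by (rule monoid.l_one[OF group.is_monoid[OF group_G[OF S]] that])
  \<comment> \<open>In a cocycle \<open>(a, b)\<close> the integer \<open>a\<close> can be nonzero
    only in degree \<open>- 1\<close>. Negative degrees use injectivity of the augmentation, degree
    \<open>0\<close> the constancy of sections, and positive degrees exactness over
    \<open>?A\<close>; the last two also use \<open>ra\<close>.\<close>
  have "cocycles ?C (n + 1) = coboundaries ?C (n + 1)" for n
  proof (intro equalityI subsetI)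
    fix w assume "w \<in> coboundaries ?C (n + 1)"
    then obtain a b where ab: "(a, b) \<in> carrier (grp ?C n)" "w = diff ?C n (a, b)"
      by (auto simp: coboundaries_def)
    then have b: "b \<in> carrier (G n S)" and w: "w = (0, ?g (n + 1) a \<otimes>\<^bsub>G (n + 1) S\<^esub> d n S b)"
      by (simp_all only: cone_carrier cone_diff)
    interpret D: group_hom "G (n + 1) S" "G (n + 1 + 1) S" "d (n + 1) S" by (rule d_hom[OF S])
    note db = d_closed[OF S b]
    have "d (n + 1) S (?g (n + 1) a \<otimes>\<^bsub>G (n + 1) S\<^esub> d n S b) = \<one>\<^bsub>G (n + 1 + 1) S\<^esub>"
      unfolding D.hom_mult[OF g_closed db] dg diff_diff[OF S b] by (rule ll[OF one])
    then show "w \<in> cocycles ?C (n + 1)"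
      unfolding w cocycle gz using ll[OF one] D.G.m_closed[OF g_closed db] by simp
  next
    fix w assume w: "w \<in> cocycles ?C (n + 1)"
    obtain a b where ab: "w = (a, b)" by (cases w)
    have a: "n + 1 + 1 = 0 \<or> a = 0" and b: "b \<in> carrier (G (n + 1) S)"
      and c: "?g (n + 1 + 1) a \<otimes>\<^bsub>G (n + 1 + 1) S\<^esub> d (n + 1) S b = \<one>\<^bsub>G (n + 1 + 1) S\<^esub>"
      using w unfolding ab cocycle by blast+
    show "w \<in> coboundaries ?C (n + 1)"
    proof (cases "n + 1 < 0")
      case True
      then have b1: "b = \<one>\<^bsub>G (n + 1) S\<^esub>" using carrier_neg[OF True S] b by blast
      have a0: "a = 0"
      proof (cases "n + 1 + 1 = 0")
        \<comment> \<open>In degree \<open>- 1\<close> the component \<open>b\<close> is trivial, so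
          the augmentation kills the constant section \<open>a\<close>; evaluation at
          \<open>m\<close> gives \<open>a = 0\<close>.\<close>
        case n: True
        have "\<epsilon> S (\<kappa> a) = \<one>\<^bsub>G 0 S\<^esub>"
          using c monoid.r_one[OF group.is_monoid[OF group_G[OF S]] g_closed[of 0 a]]
          unfolding b1 d_one unfolding n g0 by simp
        then have "\<kappa> a = \<one>\<^bsub>sections ?F S\<^esub>" by (rule augmentation_eq_one[OF S \<kappa>])
        then have "\<kappa> a m = 0" by simp
        then show ?thesis using m by (simp add: \<kappa>_def)
      qed (use a in simp)
      show ?thesis
        unfolding ab b1 a0
        by (rule coboundaryI[of n 0 "\<one>\<^bsub>G n S\<^esub>"]) (simp_all only: gz d_one ll one simp_thms)
    next
      case False
      then have a0: "a = 0" using a by simp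
      have db: "d (n + 1) S b = \<one>\<^bsub>G (n + 1 + 1) S\<^esub>"
        using c ll[OF d_closed[OF S b]] unfolding a0 gz by simp
      let ?b = "r (n + 1) S ?A b"
      have bA': "?b \<in> carrier (G (n + 1) ?A)" by (rule r_closed[OF S openin_up AS b])
      have dbA: "d (n + 1) ?A ?b = \<one>\<^bsub>G (n + 1 + 1) ?A\<^esub>"
        unfolding d_r[OF S openin_up AS b] db by (rule group_hom.hom_one[OF r_hom[OF S openin_up AS]])
      show ?thesis
      proof (cases "n + 1 = 0")
        case n: True
        obtain c where c: "c \<in> carrier (sections ?F ?A)" "\<epsilon> ?A c = ?b"
          using basic_exact_augmentation[OF bA, of ?b] bA' dbA unfolding n by blast
        have cr: "c = restr ?F S ?A (\<kappa> (c m))"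
          using const[OF openin_up c(1)] const_sheaf_memD(1)[OF c(1) subset_refl openin_up] AS
          by (auto simp: fun_eq_iff \<kappa>_def)
        \<comment> \<open>The image of the constant section with value \<open>c m\<close>. It agrees
          with \<open>b\<close> over \<open>?A\<close>, so their quotient is trivial on
          \<open>?A\<close> and a coboundary by \<open>ra\<close>.\<close>
        define e where "e = ?g (n + 1) (c m)"
        have e: "e \<in> carrier (G (n + 1) S)" unfolding e_def by (rule g_closed)
        have re: "r (n + 1) S ?A e = ?b"
          unfolding e_def using augmentation_restr[OF S openin_up AS \<kappa>[of "c m"]] c(2) cr
          unfolding n g0 by metis
        have de: "d (n + 1) S e = \<one>\<^bsub>G (n + 1 + 1) S\<^esub>" unfolding e_def by (rule dg)
        interpret R: group_hom "G (n + 1) S" "G (n + 1) ?A" "r (n + 1) S ?A" by (rule r_hom[OF S openin_up AS])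
        interpret D: group_hom "G (n + 1) S" "G (n + 1 + 1) S" "d (n + 1) S" by (rule d_hom[OF S])
        let ?s = "inv\<^bsub>G (n + 1) S\<^esub> e \<otimes>\<^bsub>G (n + 1) S\<^esub> b"
        obtain t where t: "t \<in> carrier (G n S)" "d n S t = ?s"
        proof (rule rel_acyclicD[OF ra, of ?s n])
          show "?s \<in> carrier (G (n + 1) S)" using e b by simp
          show "r (n + 1) S ?A ?s = \<one>\<^bsub>G (n + 1) ?A\<^esub>" using e b re bA' by simp
          show "d (n + 1) S ?s = \<one>\<^bsub>G (n + 1 + 1) S\<^esub>"
            unfolding D.hom_mult[OF R.G.inv_closed[OF e] b] D.hom_inv[OF e] de db D.H.inv_one by (rule ll[OF one])
        qed blast
        have "b = e \<otimes>\<^bsub>G (n + 1) S\<^esub> d n S t"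
          unfolding t(2) using e b by (simp add: R.G.m_assoc[symmetric])
        from coboundaryI[OF disjI1[OF n] t(1) this[unfolded e_def]] show ?thesis
          unfolding ab a0 .
      next
        case n: False
        have n0: "0 \<le> n" using n False by linarith
        obtain u where u: "u \<in> carrier (G n ?A)" "d n ?A u = ?b"
          by (rule basic_exact_diff[OF bA n0 bA' dbA])
        obtain u' s' where u': "u' \<in> carrier (G n S)" and s': "s' \<in> carrier (G (n + 1) S)"
          "b = s' \<otimes>\<^bsub>G (n + 1) S\<^esub> d n S u'" "r (n + 1) S ?A s' = \<one>\<^bsub>G (n + 1) ?A\<^esub>" "d (n + 1) S s' = d (n + 1) S b"
          by (rule subtract_coboundary[OF S openin_up AS b u])
        obtain t where t: "t \<in> carrier (G n S)" "d n S t = s'"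
          by (rule rel_acyclicD[OF ra s'(1,3)]) (use s'(4) db in simp_all)
        interpret D: group_hom "G n S" "G (n + 1) S" "d n S" by (rule d_hom[OF S])
        have "b = d n S (t \<otimes>\<^bsub>G n S\<^esub> u')" unfolding D.hom_mult[OF t(1) u'] t(2) by (rule s'(2))
        then have "b = ?g (n + 1) 0 \<otimes>\<^bsub>G (n + 1) S\<^esub> d n S (t \<otimes>\<^bsub>G n S\<^esub> u')"
          unfolding gz using ll[OF b] by simp
        from coboundaryI[OF disjI2[OF refl] D.G.m_closed[OF t(1) u'] this] show ?thesis
          unfolding ab a0 .
      qed
    qed
  qed
  from this[of "_ - 1"] show "acyclic_cochain ?C"
    unfolding acyclic_cochain_def by simp
qed

text \<open>Triviality quantifies over all injective resolutions, so refuting it takes an actual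
  one. On the empty space all sections are trivial: the constant sheaf is injective, and its copies
  in all degrees with identity differentials form a resolution. The cone reduces to the integers in
  degree \<open>- 1\<close>, which is not acyclic.\<close>

lemma not_cohomologically_trivial_empty:
  "\<not> cohomologically_trivial (upper_topology ({} :: 'a::order set))"
proof
  let ?X = "upper_topology ({} :: 'a set)" and ?F = "const_sheaf (upper_topology ({} :: 'a set)) {}"
  assume triv: "cohomologically_trivial ?X"
  have op: "U = {}" if "openin ?X U" for U using openin_subset[OF that] by simp
  have F: "sheaf ?X ?F" by (rule sheaf_const_sheaf) simp
  have carrier: "carrier (sections ?F U) = {\<lambda>x. 0}" if "openin ?X U" for U
    using sheaf_sections_empty[OF F] op[OF that] by simp
  have id: "sheaf_morphism ?X ?F ?F (\<lambda>U s. s)"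
    unfolding sheaf_morphism_def by (simp add: hom_def)
  have inj: "injective_sheaf ?X ?F"
    unfolding injective_sheaf_def
  proof (intro conjI allI impI F, elim conjE)
    fix A B :: "('a, 'a \<Rightarrow> int) presheaf" and \<iota> \<alpha>
    assume \<alpha>: "sheaf_morphism ?X A ?F \<alpha>"
    have "sheaf_morphism ?X B ?F (\<lambda>U s x. 0)"
      unfolding sheaf_morphism_def by (auto simp: hom_def carrier fun_eq_iff)
    moreover have "(\<lambda>x. 0) = \<alpha> U s" if "openin ?X U" "s \<in> carrier (sections A U)" for U s
      using sheaf_morphism_closed[OF \<alpha> that] carrier[OF that(1)] by simp
    ultimately show "\<exists>\<beta>. sheaf_morphism ?X B ?F \<beta> \<and>
        (\<forall>U. openin ?X U \<longrightarrow> (\<forall>s\<in>carrier (sections A U). \<beta> U (\<iota> U s) = \<alpha> U s))"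
      by blast
  qed
  define I where "I = \<lparr>obj = (\<lambda>n. ?F), sdiff = (\<lambda>n U s. s)\<rparr>"
  let ?\<epsilon> = "\<lambda>U s. s"
  have I: "obj I n = ?F" "sdiff I n = (\<lambda>U s. s)" for n by (simp_all add: I_def)
  have ex: "sheaf_exact ?X ?F (\<lambda>U s. s) ?F (\<lambda>U s. s) ?F"
    unfolding sheaf_exact_def using op carrier by auto
  have "injective_resolution ?X ?F I ?\<epsilon>"
    unfolding injective_resolution_def I using inj id ex carrier by (simp add: sheaf_mono_def)
  then have "acyclic_cochain (cone integers_in_degree_0 (global_sections ?X I) (constants_map ?X I ?\<epsilon>))"
    (is "acyclic_cochain ?C")
    using triv unfolding cohomologically_trivial_def by simp
  then have eq: "cocycles ?C (- 1) = coboundaries ?C (- 1)" unfolding acyclic_cochain_def by blast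
  have z: "(\<lambda>x. 0) \<in> carrier (sections ?F {})" using carrier by simp
  \<comment> \<open>In degree \<open>- 1\<close> the cone differential takes an inverse in the
    degree \<open>1\<close> group of the complex of integers, which is a singleton.\<close>
  have "inv\<^bsub>singleton_group 0\<^esub> 0 = \<one>\<^bsub>singleton_group (0::int)\<^esub>"
    using monoid.inv_one[OF group.is_monoid[OF singleton_group, of "0::int"]] by (simp add: singleton_group_def)
  then have "(1, \<lambda>x. 0) \<in> cocycles ?C (- 1)"
    using z by (simp add: cocycles_def kernel_def cone_def global_sections_def integers_in_degree_0_def I
        constants_map_def)
  moreover have "fst w = 0" if "w \<in> coboundaries ?C (- 1)" for w
    using that by (auto simp: coboundaries_def cone_def integers_in_degree_0_def)
  ultimately show False unfolding eq by fastforce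
qed


section \<open>Simplicial maps\<close>

lemma projective_complexD:
  assumes "projective_complex K"
  shows "finite K" and "\<And>z. z \<in> K \<Longrightarrow> finite z" and "\<And>z. z \<in> K \<Longrightarrow> z \<noteq> {}"
    and "\<And>z z'. z \<in> K \<Longrightarrow> z' \<subseteq> z \<Longrightarrow> z' \<noteq> {} \<Longrightarrow> z' \<in> K"
proof -
  obtain \<Delta> where \<Delta>: "finite \<Delta>" "closedin (upper_topology (projective_space \<Delta>)) K"
    using assms by (auto simp: projective_complex_def)
  then have sub: "K \<subseteq> projective_space \<Delta>"
    and closed: "\<And>z z'. z \<in> K \<Longrightarrow> z' \<in> projective_space \<Delta> \<Longrightarrow> z' \<subseteq> z \<Longrightarrow> z' \<in> K"
    unfolding closedin_upper_topology by blast+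
  have "projective_space \<Delta> \<subseteq> Pow \<Delta>" by (auto simp: projective_space_def)
  then show "finite K" using sub \<Delta>(1) by (meson finite_Pow_iff finite_subset)
  show "finite z" "z \<noteq> {}" if "z \<in> K" for z
    using that sub \<Delta>(1) finite_subset by (auto simp: projective_space_def)
  show "z' \<in> K" if "z \<in> K" "z' \<subseteq> z" "z' \<noteq> {}" for z z'
  proof (rule closed[OF that(1) _ that(2)])
    show "z' \<in> projective_space \<Delta>" using that sub by (auto simp: projective_space_def)
  qed
qed

section \<open>c-properness and fibre-closed points in terms of the order\<close>

lemma c_proper_upper:
  assumes f: "continuous_map (upper_topology P) (upper_topology Q) f"
  shows "c_proper (upper_topology P) (upper_topology Q) f \<longleftrightarrow>
    (\<forall>p\<in>P. \<forall>y\<in>Q. y \<le> f p \<longrightarrow> cohomologically_trivial (upper_topology {x \<in> P. x \<le> p \<and> f x = y}))"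
proof -
  have "f p \<in> Q" if "p \<in> P" for p using f that by (auto simp: continuous_map_def)
  moreover have "subtopology (upper_topology P) {x \<in> {x \<in> P. x \<le> p}. f x = y} =
      upper_topology {x \<in> P. x \<le> p \<and> f x = y}" for p y
    using subtopology_upper_topology[of "{x \<in> P. x \<le> p \<and> f x = y}" P] by (simp add: conj_assoc subset_iff)
  ultimately show ?thesis
    using f by (auto simp: c_proper_def closure_of_upper_topology)
qed

lemma fibre_closed_upper:
  "fibre_closed (upper_topology P) f x0 \<longleftrightarrow> x0 \<in> P \<and> (\<forall>x\<in>P. f x = f x0 \<longrightarrow> x \<le> x0 \<longrightarrow> x = x0)"
  using subtopology_upper_topology[of "{x \<in> P. f x = f x0}" P]
  by (auto simp: fibre_closed_def closedin_upper_topology)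

section \<open>From c-proper to simplicial, and from simplicial to proper\<close>

lemma c_proper_imp_simplicial:
  assumes K: "projective_complex K" and L: "projective_complex L"
    and f: "continuous_map (upper_topology K) (upper_topology L) f"
    and proper: "c_proper (upper_topology K) (upper_topology L) f"
  shows "simplicial K L f"
proof -
  note KD = projective_complexD[OF K] and LD = projective_complexD[OF L]
  have fL: "f p \<in> L" if "p \<in> K" for p using f that by (auto simp: continuous_map_def)
  have mono: "f x \<subseteq> f p" if "x \<in> K" "p \<in> K" "x \<subseteq> p" for x p
    by (rule continuous_map_upper_mono[OF f that])
  \<comment> \<open>Testing the fibres over \<open>{w}\<close> is enough: each vertex
    \<open>w\<close> of \<open>f p\<close> comes from a face of \<open>p\<close> with image exactly
    \<open>{w}\<close>.\<close>
  have fibre: "\<exists>x\<in>K. x \<subseteq> p \<and> f x = {w}" if p: "p \<in> K" and w: "w \<in> f p" for p w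
  proof -
    have "{w} \<in> L" by (rule LD(4)[OF fL[OF p]]) (use w in auto)
    then have "cohomologically_trivial (upper_topology {x \<in> K. x \<subseteq> p \<and> f x = {w}})"
      using proper p w unfolding c_proper_upper[OF f] by simp
    then have "{x \<in> K. x \<subseteq> p \<and> f x = {w}} \<noteq> {}"
      using not_cohomologically_trivial_empty by metis
    then show ?thesis by blast
  qed
  \<comment> \<open>The only face of \<open>{v}\<close> is \<open>{v}\<close> itself, so it is the
    face found over a vertex of \<open>f {v}\<close>.\<close>
  have "\<exists>w. f {v} = {w}" if v: "{v} \<in> K" for v
  proof -
    obtain w where "w \<in> f {v}" using LD(3)[OF fL[OF v]] by blast
    then obtain x where "x \<in> K" "x \<subseteq> {v}" "f x = {w}" using fibre[OF v] by blast
    moreover from this have "x = {v}" using KD(3) by blast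
    ultimately show ?thesis by blast
  qed
  then obtain \<phi> where \<phi>: "\<And>v. {v} \<in> K \<Longrightarrow> f {v} = {\<phi> v}" by metis
  have vertex: "{v} \<in> K" if "p \<in> K" "v \<in> p" for p v
    by (rule KD(4)[OF that(1)]) (use that in auto)
  have "f p = \<phi> ` p" if p: "p \<in> K" for p
  proof (intro equalityI subsetI)
    fix w assume "w \<in> f p"
    then obtain x where x: "x \<in> K" "x \<subseteq> p" "f x = {w}" using fibre[OF p] by blast
    then obtain v where v: "v \<in> x" using KD(3) by blast
    \<comment> \<open>By monotonicity, each vertex of a face with image \<open>{w}\<close> is sent
      to \<open>w\<close>.\<close>
    have "f {v} \<subseteq> f x" by (rule mono) (use x v vertex in auto)
    then have "\<phi> v = w" using \<phi>[OF vertex[OF x(1) v]] x(3) by simp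
    then show "w \<in> \<phi> ` p" using v x(2) by blast
  next
    fix w assume "w \<in> \<phi> ` p"
    then obtain v where v: "v \<in> p" "w = \<phi> v" by blast
    have "f {v} \<subseteq> f p" by (rule mono) (use p v vertex in auto)
    then show "w \<in> f p" using \<phi>[OF vertex[OF p v(1)]] v(2) by simp
  qed
  moreover have "\<phi> \<in> vertices K \<rightarrow> vertices L"
    using \<phi> fL by (force simp: vertices_def)
  ultimately show ?thesis unfolding simplicial_def projective_map_def by blast
qed

lemma simplicial_imp_c_proper:
  assumes K: "projective_complex K" and L: "projective_complex L"
    and f: "continuous_map (upper_topology K) (upper_topology L) f"
    and simp: "simplicial K L f"
  shows "c_proper (upper_topology K) (upper_topology L) f"
  unfolding c_proper_upper[OF f]
proof (intro ballI impI)
  note KD = projective_complexD[OF K] and LD = projective_complexD[OF L]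
  obtain \<phi> where \<phi>: "\<And>z. z \<in> K \<Longrightarrow> f z = \<phi> ` z"
    using simp by (auto simp: simplicial_def projective_map_def)
  fix p y assume p: "p \<in> K" and y: "y \<in> L" "y \<subseteq> f p"
  \<comment> \<open>The greatest face of \<open>p\<close> with image inside \<open>y\<close>; it
    attains \<open>y\<close> because \<open>y\<close> is contained in the image of
    \<open>p\<close>.\<close>
  define m where "m = {v \<in> p. \<phi> v \<in> y}"
  have my: "\<phi> ` m = y" using y(2) \<phi>[OF p] by (auto simp: m_def)
  have mp: "m \<subseteq> p" by (auto simp: m_def)
  have "m \<noteq> {}" using my LD(3)[OF y(1)] by blast
  then have mK: "m \<in> K" by (rule KD(4)[OF p mp])
  show "cohomologically_trivial (upper_topology {x \<in> K. x \<subseteq> p \<and> f x = y})"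
  proof (rule cohomologically_trivial_greatest[of _ m])
    show "finite {x \<in> K. x \<subseteq> p \<and> f x = y}" using KD(1) by simp
    show "m \<in> {x \<in> K. x \<subseteq> p \<and> f x = y}" using mK mp my \<phi> by simp
    show "x \<subseteq> m" if "x \<in> {x \<in> K. x \<subseteq> p \<and> f x = y}" for x
      using that \<phi>[of x] by (auto simp: m_def)
  qed
qed

lemma simplicial_imp_proper:
  assumes K: "projective_complex K" and L: "projective_complex L"
    and f: "continuous_map (upper_topology K) (upper_topology L) f"
    and simp: "simplicial K L f"
  shows "proper (upper_topology K) (upper_topology L) f"
  unfolding proper_def
proof (intro conjI allI impI)
  show "c_proper (upper_topology K) (upper_topology L) f"
    by (rule simplicial_imp_c_proper[OF assms])
  note KD = projective_complexD[OF K]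
  obtain \<phi> where \<phi>: "\<And>z. z \<in> K \<Longrightarrow> f z = \<phi> ` z"
    using simp by (auto simp: simplicial_def projective_map_def)
  fix x0 p I \<epsilon>
  assume *: "fibre_closed (upper_topology K) f x0 \<and> p \<in> topspace (upper_topology K) \<and>
      x0 \<in> upper_topology K closure_of {p}"
    and res: "injective_resolution (upper_topology K) (const_sheaf (upper_topology K) {p}) I \<epsilon>"
  then have p: "p \<in> K" by simp
  have x0: "x0 \<in> K" "x0 \<subseteq> p" using * closure_of_upper_topology[OF p] by auto
  have min: "x = x0" if "x \<in> K" "f x = f x0" "x \<subseteq> x0" for x
    using * that unfolding fibre_closed_upper by blast
  interpret simplex_resolution K p I \<epsilon>
  proof unfold_locales
    show "sheaf (upper_topology K) (const_sheaf (upper_topology K) {p})"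
      by (rule sheaf_const_sheaf) (use p in simp)
    show "z \<in> K" if "z \<subseteq> p" "z \<noteq> {}" for z by (rule KD(4)[OF p that])
  qed (fact KD(1) res p KD(3) KD(2)[OF p])+
  \<comment> \<open>If two vertices of \<open>x0\<close> had the same image, dropping one would give
    a smaller simplex in the same fibre, against the minimality of \<open>x0\<close>.\<close>
  have inj: "inj_on \<phi> x0"
  proof (rule inj_onI, rule ccontr)
    fix u v assume uv: "u \<in> x0" "v \<in> x0" "\<phi> u = \<phi> v" "u \<noteq> v"
    have xK: "x0 - {u} \<in> K" by (rule KD(4)[OF x0(1)]) (use uv in auto)
    have "\<phi> w \<in> \<phi> ` (x0 - {u})" if "w \<in> x0" for w
      by (cases "w = u") (use that uv in \<open>auto intro: rev_image_eqI[of v]\<close>)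
    then have "\<phi> ` (x0 - {u}) = \<phi> ` x0" by (intro equalityI image_subsetI image_mono) auto
    then have "x0 - {u} = x0" by (intro min xK) (auto simp: \<phi>[OF xK] \<phi>[OF x0(1)])
    then show False using uv(1) by blast
  qed
  have fL: "f z \<in> L" if "z \<in> K" for z using f that by (auto simp: continuous_map_def)
  have V: "{x \<in> K. f x \<in> up L (f x0)} = {z \<in> K. \<phi> ` x0 \<subseteq> \<phi> ` z}"
    using \<phi> fL x0(1) by (auto simp: up_def)
  have V': "{x \<in> K. f x \<in> up L (f x0) - {f x0}} = {z \<in> {x \<in> K. f x \<in> up L (f x0)}. \<phi> ` z \<noteq> \<phi> ` x0}"
    using \<phi> x0(1) by auto
  show "quasi_iso (hom_complex (upper_topology K) (const_sheaf (upper_topology K) {x0}) I)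
     (hom_complex (upper_topology L) (const_sheaf (upper_topology L) {f x0})
       (direct_image_complex (upper_topology K) f I))
     (natural_map (upper_topology K) (upper_topology L) f x0)"
  proof (rule quasi_iso_natural_map[OF upper_resolution_axioms f x0(1) min])
    show "rel_acyclic {x \<in> K. f x \<in> up L (f x0) - {f x0}} ({x \<in> K. f x \<in> up L (f x0)} - {x0})"
      by (rule rel_acyclic_fibre[OF x0 inj V V'])
  qed
qed

theorem theorem4p5:
  fixes K :: "'v set set" and L :: "'w set set" and f :: "'v set \<Rightarrow> 'w set"
  assumes "projective_complex K" and "projective_complex L"
    and "continuous_map (upper_topology K) (upper_topology L) f"
  shows "(c_proper (upper_topology K) (upper_topology L) f \<longleftrightarrow>
            proper (upper_topology K) (upper_topology L) f) \<and>
         (proper (upper_topology K) (upper_topology L) f \<longleftrightarrow> simplicial K L f)"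
  using c_proper_imp_simplicial[OF assms] simplicial_imp_proper[OF assms]
  unfolding proper_def by blast

end
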